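(* Let $X=(X_n)_{n\in\mathbb{Z}}$ be the i.i.d. increments of a skip-free to the left random walk and let $[\mathbf{T},\mathbf{o}]$ be the connected component of $0$, rooted at $\mathbf{o}=0$, in the record graph of $(\mathbb{Z},X)$ (as an unordered rooted Family Tree). Let $S_0=0$, $S_n=\sum_{k=0}^{n-1}X_k$ for $n\ge1$, $c=\mathbb{P}[S_n=-1\text{ for some }n>0]$, and for $k\ge0$ let $$\tilde\pi(k)=c^{k-1}\,\mathbb{P}[X_0=k-1],\qquad \bar\pi(k)=c^{k}\,\mathbb{P}[X_0\ge k].$$ If $0<\mathbb{E}[X_0]<\infty$, then the distribution of $[\mathbf{T},\mathbf{o}]$ is the unimodularised bi-variate Eternal Kesten Tree $EKT(\bar\pi,\tilde\pi)$.
   Context: **Increments.** "I.i.d. increments of a skip-free to the left random walk" means: $X=(X_n)_{n\in\mathbb{Z}}$ is i.i.d., each $X_n$ takes values in $\{-1,0,1,2,\dots\}$, $\mathbb{P}[X_0=-1]>0$ and $\mathbb{E}[X_0]<\infty$. **Record graph.** For an integer-valued sequence $x$ the record map is $R_x(i)=\inf\{j>i:\sum_{l=i}^{j-1}x_l\ge 0\}$ if the infimum exists and $R_x(i)=i$ otherwise. The record graph of $(\mathbb{Z},x)$ is the directed graph on $\mathbb{Z}$ with edges $(i,R_x(i))$ for all $i$ with $R_x(i)\ne i$. **Family Trees.** A Family Tree is a locally finite directed tree in which each vertex has out-degree at most $1$ (edges point from child to parent). Rooted Family Trees are considered up to root-preserving isomorphism, with the Borel $\sigma$-algebra of the local topology.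 **Unimodularised $EKT(\alpha,\beta)$.** Let $\alpha,\beta$ be probability distributions on $\{0,1,2,\dots\}$ with means $m(\alpha)<\infty$, $m(\beta)<1$. Let $([\mathbf{T}_i,\mathbf{o}_i])_{i\in\mathbb{Z}}$ be i.i.d. random finite rooted Family Trees with the following law: $\mathbf{o}_i$ has no parent, its number of children has distribution $\alpha$, and the descendant trees of its children are i.i.d. Galton-Watson trees with offspring distribution $\beta$, independent of the number of children of $\mathbf{o}_i$. Let $\mathbf{T}'$ be obtained from the disjoint union of the $\mathbf{T}_i$ by adding a directed edge $(\mathbf{o}_i,\mathbf{o}_{i+1})$ for each $i\in\mathbb{Z}$. (The tree $[\mathbf{T}',\mathbf{o}_0]$ is $EKT(\alpha,\beta)$.) The unimodularised $EKT(\alpha,\beta)$ is the probability measure $$A\mapsto \frac{1}{\mathbb{E}[\#V(\mathbf{T}_0)]}\,\mathbb{E}\Big[\sum_{v\in V(\mathbf{T}_0)}\mathbf{1}_A([\mathbf{T}',v])\Big]$$ on rooted Family Trees. *)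

theory Defs
  imports "HOL-Probability.Probability"
begin

record 'v rooted_digraph =
  vertices :: "'v set"
  edges :: "('v \<times> 'v) set"
  origin :: 'v

text \<open>An edge \<open>(u, v)\<close> points from the child \<open>u\<close> to the parent \<open>v\<close>. Connectedness, cycles, degrees
  and distances refer to the underlying undirected graph, given by the relation \<open>adjacency\<close>.\<close>

definition adjacency :: "'v rooted_digraph \<Rightarrow> ('v \<times> 'v) set" where
  "adjacency G = edges G \<union> (edges G)\<inverse>"

definition undirected_cycle :: "'v rooted_digraph \<Rightarrow> 'v list \<Rightarrow> bool" where
  "undirected_cycle G vs \<longleftrightarrow> 3 \<le> length vs \<and> distinct vs \<and>
     (\<forall>i<length vs. (vs ! i, vs ! (Suc i mod length vs)) \<in> adjacency G)"

text \<open>Asymmetry of the edge relation excludes loops and pairs of opposite edges, that is, the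
  cycles of length one and two.\<close>

definition family_tree :: "'v rooted_digraph \<Rightarrow> bool" where
  "family_tree G \<longleftrightarrow>
     edges G \<subseteq> vertices G \<times> vertices G \<and> origin G \<in> vertices G \<and>
     (\<forall>u\<in>vertices G. \<forall>v\<in>vertices G. (u, v) \<in> (adjacency G)\<^sup>*) \<and>
     asym (edges G) \<and> (\<nexists>vs. undirected_cycle G vs) \<and>
     (\<forall>v\<in>vertices G. finite {u. (v, u) \<in> adjacency G}) \<and>
     single_valued (edges G)"

definition rooted_isomorphic :: "'v rooted_digraph \<Rightarrow> 'w rooted_digraph \<Rightarrow> bool" where
  "rooted_isomorphic G H \<longleftrightarrow>
     (\<exists>f. bij_betw f (vertices G) (vertices H) \<and> f (origin G) = origin H \<and>
        (\<forall>u\<in>vertices G. \<forall>v\<in>vertices G. (u, v) \<in> edges G \<longleftrightarrow> (f u, f v) \<in> edges H))"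

lemma rooted_isomorphic_sym:
  assumes "origin G \<in> vertices G" "rooted_isomorphic G H"
  shows "rooted_isomorphic H G"
proof -
  from assms(2) obtain f where bij: "bij_betw f (vertices G) (vertices H)"
    and o: "f (origin G) = origin H"
    and e: "\<And>u v. u \<in> vertices G \<Longrightarrow> v \<in> vertices G \<Longrightarrow>
              (u, v) \<in> edges G \<longleftrightarrow> (f u, f v) \<in> edges H"
    unfolding rooted_isomorphic_def by blast
  let ?g = "inv_into (vertices G) f"
  have "bij_betw ?g (vertices H) (vertices G)"
    using bij by (rule bij_betw_inv_into)
  moreover have "?g (origin H) = origin G"
    using bij_betw_inv_into_left[OF bij assms(1)] o by simp
  moreover have "(u, v) \<in> edges H \<longleftrightarrow> (?g u, ?g v) \<in> edges G"
    if "u \<in> vertices H" "v \<in> vertices H" for u v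
  proof -
    have "?g u \<in> vertices G" "?g v \<in> vertices G" "f (?g u) = u" "f (?g v) = v"
      using that bij bij_betw_inv_into[OF bij]
      by (simp_all add: bij_betw_apply bij_betw_inv_into_right)
    then show ?thesis using e[of "?g u" "?g v"] by simp
  qed
  ultimately show ?thesis
    unfolding rooted_isomorphic_def by blast
qed

lemma rooted_isomorphic_trans:
  assumes "rooted_isomorphic G H" "rooted_isomorphic H K"
  shows "rooted_isomorphic G K"
proof -
  from assms(1) obtain f where f: "bij_betw f (vertices G) (vertices H)" "f (origin G) = origin H"
    "\<forall>u\<in>vertices G. \<forall>v\<in>vertices G. (u, v) \<in> edges G \<longleftrightarrow> (f u, f v) \<in> edges H"
    unfolding rooted_isomorphic_def by blast
  from assms(2) obtain g where g: "bij_betw g (vertices H) (vertices K)" "g (origin H) = origin K"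
    "\<forall>u\<in>vertices H. \<forall>v\<in>vertices H. (u, v) \<in> edges H \<longleftrightarrow> (g u, g v) \<in> edges K"
    unfolding rooted_isomorphic_def by blast
  have "bij_betw (g \<circ> f) (vertices G) (vertices K)"
    using f(1) g(1) by (rule bij_betw_trans)
  moreover have "(u, v) \<in> edges G \<longleftrightarrow> ((g \<circ> f) u, (g \<circ> f) v) \<in> edges K"
    if "u \<in> vertices G" "v \<in> vertices G" for u v
    using that f g by (simp add: bij_betw_apply)
  ultimately show ?thesis
    unfolding rooted_isomorphic_def using f(2) g(2) by (intro exI[of _ "g \<circ> f"]) auto
qed

text \<open>A locally finite connected graph is countable, so every rooted Family Tree is isomorphic to
  one whose vertices are natural numbers.\<close>

quotient_type ftree = "nat rooted_digraph" /
  partial: "\<lambda>G H. family_tree G \<and> family_tree H \<and> rooted_isomorphic G H"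
proof (rule part_equivpI)
  let ?G = "\<lparr>vertices = {0 :: nat}, edges = {}, origin = 0\<rparr>"
  have "\<not> undirected_cycle ?G vs" for vs
  proof
    assume c: "undirected_cycle ?G vs"
    then have "(vs ! 0, vs ! (Suc 0 mod length vs)) \<in> adjacency ?G"
      unfolding undirected_cycle_def by (metis less_le_trans zero_less_numeral)
    then show False by (simp add: adjacency_def)
  qed
  then have "family_tree ?G"
    by (auto simp: family_tree_def adjacency_def intro: asymI)
  moreover have "rooted_isomorphic ?G ?G"
    unfolding rooted_isomorphic_def by (intro exI[of _ id]) auto
  ultimately show "\<exists>G. family_tree G \<and> family_tree G \<and> rooted_isomorphic G (G :: nat rooted_digraph)"
    by blast
  show "symp (\<lambda>G H. family_tree G \<and> family_tree H \<and> rooted_isomorphic G (H :: nat rooted_digraph))"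
    using rooted_isomorphic_sym unfolding family_tree_def by (blast intro: sympI)
  show "transp (\<lambda>G H. family_tree G \<and> family_tree H \<and> rooted_isomorphic G (H :: nat rooted_digraph))"
    using rooted_isomorphic_trans by (blast intro: transpI)
qed

text \<open>The isomorphism class of a rooted Family Tree on an arbitrary vertex type; meaningful only
  if \<open>family_tree G\<close> holds.\<close>

definition iso_class :: "'v rooted_digraph \<Rightarrow> ftree" where
  "iso_class G = abs_ftree (SOME H. family_tree H \<and> rooted_isomorphic G H)"

definition ball_around_origin :: "'v rooted_digraph \<Rightarrow> nat \<Rightarrow> 'v rooted_digraph" where
  "ball_around_origin G r =
     (let B = {v. \<exists>k\<le>r. (origin G, v) \<in> adjacency G ^^ k}
      in \<lparr>vertices = B, edges = edges G \<inter> B \<times> B, origin = origin G\<rparr>)"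

text \<open>The local topology: the sets of all trees whose ball of radius \<open>r\<close> around the root is
  isomorphic to that of a given tree \<open>S\<close> are the open balls of the local metric.\<close>

instantiation ftree :: topological_space
begin

definition open_ftree :: "ftree set \<Rightarrow> bool" where
  "open_ftree = generate_topology
     (range (\<lambda>(S, r). {T. rooted_isomorphic (ball_around_origin (rep_ftree S) r)
                                            (ball_around_origin (rep_ftree T) r)}))"

instance
  by standard (auto simp: open_ftree_def intro: generate_topology.intros)

end

definition skip_free_left_increments :: "'a measure \<Rightarrow> (int \<Rightarrow> 'a \<Rightarrow> int) \<Rightarrow> bool" where
  "skip_free_left_increments M X \<longleftrightarrow>
     prob_space M \<and>
     prob_space.indep_vars M (\<lambda>_. count_space UNIV) X UNIV \<and>
     (\<forall>n. distr M (count_space UNIV) (X n) = distr M (count_space UNIV) (X 0)) \<and>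
     (\<forall>n. \<forall>\<omega>\<in>space M. - 1 \<le> X n \<omega>) \<and>
     0 < measure M {\<omega>\<in>space M. X 0 \<omega> = - 1} \<and>
     integrable M (\<lambda>\<omega>. real_of_int (X 0 \<omega>))"

definition record_map :: "(int \<Rightarrow> int) \<Rightarrow> int \<Rightarrow> int" where
  "record_map x i =
     (if \<exists>j>i. 0 \<le> (\<Sum>l=i..<j. x l) then Inf {j. i < j \<and> 0 \<le> (\<Sum>l=i..<j. x l)} else i)"

definition record_edges :: "(int \<Rightarrow> int) \<Rightarrow> (int \<times> int) set" where
  "record_edges x = {(i, record_map x i) | i. record_map x i \<noteq> i}"

text \<open>This is a rooted Family Tree for every integer sequence \<open>x\<close>: edges go strictly to the right,
  and in-degrees are finite because distinct children of \<open>j\<close> have distinct heights, all lying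
  between the heights of \<open>j - 1\<close> and \<open>j\<close> (the height of \<open>i\<close> being the walk with increments \<open>x\<close>).\<close>

definition record_component :: "(int \<Rightarrow> int) \<Rightarrow> int \<Rightarrow> int rooted_digraph" where
  "record_component x i =
     (let C = {j. (i, j) \<in> (record_edges x \<union> (record_edges x)\<inverse>)\<^sup>*}
      in \<lparr>vertices = C, edges = record_edges x \<inter> C \<times> C, origin = i\<rparr>)"

text \<open>Vertices of a bush are addressed by lists (in reversed Ulam--Harris order): the children of
  \<open>u\<close> are \<open>k # u\<close> for \<open>k < d u\<close>, where \<open>d\<close> gives the prospective numbers of children.\<close>

inductive_set bush_vertices :: "(nat list \<Rightarrow> nat) \<Rightarrow> nat list set" for d where
  root: "[] \<in> bush_vertices d"
| child: "u \<in> bush_vertices d \<Longrightarrow> k < d u \<Longrightarrow> k # u \<in> bush_vertices d"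

text \<open>With independent numbers of children, distributed as \<open>\<alpha>\<close> for the root and as \<open>\<beta>\<close> for every
  other address, the subtrees of the children of the root are i.i.d. Galton--Watson trees with
  offspring distribution \<open>\<beta>\<close>, independent of the number of these children. The bush is almost
  surely finite if \<open>\<beta>\<close> has mean less than one.\<close>

definition bush_law :: "nat pmf \<Rightarrow> nat pmf \<Rightarrow> (nat list \<Rightarrow> nat) measure" where
  "bush_law \<alpha> \<beta> = (\<Pi>\<^sub>M u\<in>UNIV. measure_pmf (if u = [] then \<alpha> else \<beta>))"

definition bushes_law :: "nat pmf \<Rightarrow> nat pmf \<Rightarrow> (int \<Rightarrow> nat list \<Rightarrow> nat) measure" where
  "bushes_law \<alpha> \<beta> = (\<Pi>\<^sub>M i\<in>UNIV. bush_law \<alpha> \<beta>)"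

definition joined_bushes ::
    "(int \<Rightarrow> nat list \<Rightarrow> nat) \<Rightarrow> int \<times> nat list \<Rightarrow> (int \<times> nat list) rooted_digraph" where
  "joined_bushes d v =
     \<lparr>vertices = (SIGMA i:UNIV. bush_vertices (d i)),
      edges = {((i, k # u), (i, u)) | i k u. k # u \<in> bush_vertices (d i)} \<union>
              {((i, []), (i + 1, [])) | i. True},
      origin = v\<rparr>"

definition unimodularised_EKT :: "nat pmf \<Rightarrow> nat pmf \<Rightarrow> ftree measure" where
  "unimodularised_EKT \<alpha> \<beta> = measure_of UNIV (sets borel)
     (\<lambda>A. (\<integral>\<^sup>+d. (\<integral>\<^sup>+u. indicator A (iso_class (joined_bushes d (0, u)))
                    \<partial>count_space (bush_vertices (d 0))) \<partial>bushes_law \<alpha> \<beta>) /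
          (\<integral>\<^sup>+d. emeasure (count_space UNIV) (bush_vertices (d 0)) \<partial>bushes_law \<alpha> \<beta>))"

end

theory Submission
  imports Defs
begin

text \<open>In a record graph the descendants of \<open>i\<close> are read off the walk to the left of \<open>i\<close>, and the preorder
  of a finite subtree is the decreasing order of the integers: its increments, read from right to
  left, are the Lukasiewicz code (numbers of children minus one) of the subtree. Call \<open>a\<close> a spine point
  if no backward sum ending at \<open>a\<close> is negative; by skip-freeness the other points are exactly those
  immediately preceded by the code of a finite tree, so \<open>a\<close> is on the spine with probability \<open>1 - c\<close>.
  Between consecutive spine points lies the code of a bush whose last letter is only required to
  be at least the number \<open>k\<close> of root children. A tree code has probability \<open>c\<close> times its
  Galton--Watson probability for \<open>pitilde\<close>, hence a bush has probability
  \<open>pibar k\<close> times those of its subtrees, and a window of consecutive bushes ending at a given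
  point occurs with probability \<open>1 - c\<close> times the product of the bush weights. Summing over all
  positions of the origin in its bush gives the unimodularised law, because \<open>1 - c\<close> is the inverse of
  the mean bush size. The latter is pure algebra once that mean is finite, and it is finite because the
  window events are disjoint; it also shows that almost surely every window exists.\<close>

section \<open>Local topology and measurability\<close>

text \<open>The finite windows are dictated by the topology: an event decided by the ball of radius
  \<open>m\<close> sees at most the bushes with spine index between \<open>-m\<close> and
  \<open>m\<close>, and such events form an intersection-stable generator of the Borel sets. The
  slack in the last letter has a combinatorial origin. The increment left of a spine point
  \<open>a\<close> announces \<open>x (a - 1) + 1\<close> subtrees; the first \<open>k\<close> turn
  out to be finite, the next one is infinite and its root is the next spine point to the left, so
  the remaining ones are never read and only \<open>k <= x (a - 1)\<close> is visible. Finiteness of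
  the mean has to come before the algebra because the recursions for mean sizes are solved by
  infinity as well. The constant \<open>c\<close> starts out as the total weight of finite trees, a
  fixed point of the generating function of the increment plus one. Since 1 is another fixed point,
  positive drift has to be used to place \<open>c\<close> below 1, and the fixed-point equation is
  what gives \<open>pitilde\<close> and \<open>pibar\<close> total mass 1.\<close>

lemma rooted_isomorphicI:
  assumes "bij_betw f (vertices G) (vertices H)" "f (origin G) = origin H"
    "\<And>u v. u \<in> vertices G \<Longrightarrow> v \<in> vertices G \<Longrightarrow> (u, v) \<in> edges G \<longleftrightarrow> (f u, f v) \<in> edges H"
  shows "rooted_isomorphic G H"
  using assms unfolding rooted_isomorphic_def by blast

text \<open>Balls inherit this much of \<open>family_tree\<close> trivially, so the isomorphism
  lemmas apply both to whole trees and to their balls.\<close>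

definition well_formed :: "'v rooted_digraph \<Rightarrow> bool" where
  "well_formed G \<longleftrightarrow> edges G \<subseteq> vertices G \<times> vertices G \<and> origin G \<in> vertices G"

lemma family_tree_well_formed: "family_tree G \<Longrightarrow> well_formed G"
  by (simp add: family_tree_def well_formed_def)

lemma well_formed_adjacency: "well_formed G \<Longrightarrow> (u, v) \<in> adjacency G \<Longrightarrow> u \<in> vertices G \<and> v \<in> vertices G"
  by (auto simp: well_formed_def adjacency_def)

lemma relpow_adjacency_vertices:
  assumes "well_formed G" "(origin G, v) \<in> adjacency G ^^ k"
  shows "v \<in> vertices G"
  using assms(2)
proof (cases k)
  case 0 with assms show ?thesis by (simp add: well_formed_def)
next
  case (Suc n)
  with assms show ?thesis by (auto dest: well_formed_adjacency)
qed

lemma ball_simps [simp]: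
  "vertices (ball_around_origin G r) = {v. \<exists>k\<le>r. (origin G, v) \<in> adjacency G ^^ k}"
  "edges (ball_around_origin G r) = edges G \<inter> vertices (ball_around_origin G r) \<times> vertices (ball_around_origin G r)"
  "origin (ball_around_origin G r) = origin G"
  by (auto simp: ball_around_origin_def Let_def)

lemma well_formed_ball: "well_formed (ball_around_origin G r)"
  unfolding well_formed_def by (auto intro: exI[of _ 0])

text \<open>An isomorphism preserves adjacency, hence walks of each length from the root;
  well-formedness keeps every such walk among the vertices where the isomorphism is
  specified.\<close>

lemma rooted_isomorphic_ball:
  assumes G: "well_formed G" and H: "well_formed H" and "rooted_isomorphic G H"
  shows "rooted_isomorphic (ball_around_origin G r) (ball_around_origin H r)"
proof -
  from assms(3) obtain f where f: "bij_betw f (vertices G) (vertices H)" "f (origin G) = origin H"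
    and e: "\<And>u v. u \<in> vertices G \<Longrightarrow> v \<in> vertices G \<Longrightarrow> (u, v) \<in> edges G \<longleftrightarrow> (f u, f v) \<in> edges H"
    unfolding rooted_isomorphic_def by blast
  have adj: "(u, v) \<in> adjacency G \<longleftrightarrow> (f u, f v) \<in> adjacency H" if "u \<in> vertices G" "v \<in> vertices G" for u v
    using e that by (auto simp: adjacency_def)
  have reach: "(origin G, v) \<in> adjacency G ^^ k \<longleftrightarrow> (origin H, f v) \<in> adjacency H ^^ k"
    if "v \<in> vertices G" for v k
    using that
  proof (induction k arbitrary: v)
    case 0
    then show ?case using f G bij_betw_imp_inj_on[OF f(1)] by (auto simp: well_formed_def dest: inj_onD)
  next
    case (Suc k)
    show ?case
    proof
      assume "(origin G, v) \<in> adjacency G ^^ Suc k"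
      then obtain u where "(origin G, u) \<in> adjacency G ^^ k" "(u, v) \<in> adjacency G" by auto
      moreover from this have "u \<in> vertices G" using well_formed_adjacency[OF G] by blast
      ultimately show "(origin H, f v) \<in> adjacency H ^^ Suc k"
        using Suc adj by auto
    next
      assume "(origin H, f v) \<in> adjacency H ^^ Suc k"
      then obtain w where w: "(origin H, w) \<in> adjacency H ^^ k" "(w, f v) \<in> adjacency H" by auto
      moreover from this have "w \<in> vertices H" using well_formed_adjacency[OF H] by blast
      then obtain u where "u \<in> vertices G" "w = f u"
        using f(1) by (auto simp: bij_betw_def)
      ultimately show "(origin G, v) \<in> adjacency G ^^ Suc k"
        using Suc adj by auto
    qed
  qed
  let ?B = "vertices (ball_around_origin G r)" and ?C = "vertices (ball_around_origin H r)"
  have sub: "?B \<subseteq> vertices G" using relpow_adjacency_vertices[OF G] by auto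
  have "f ` ?B = ?C"
  proof
    show "f ` ?B \<subseteq> ?C" using reach relpow_adjacency_vertices[OF G] by fastforce
    show "?C \<subseteq> f ` ?B"
    proof
      fix w assume w: "w \<in> ?C"
      then have "w \<in> vertices H" using relpow_adjacency_vertices[OF H] by auto
      then obtain u where "u \<in> vertices G" "w = f u" using f(1) by (auto simp: bij_betw_def)
      then show "w \<in> f ` ?B" using w reach by auto
    qed
  qed
  then have "bij_betw f ?B ?C"
    using f(1) sub by (auto simp: bij_betw_def inj_on_subset)
  then show ?thesis
  proof (rule rooted_isomorphicI)
    fix u v assume uv: "u \<in> ?B" "v \<in> ?B"
    then have "f u \<in> ?C" "f v \<in> ?C" using \<open>f ` ?B = ?C\<close> by blast+
    moreover have "(u, v) \<in> edges G \<longleftrightarrow> (f u, f v) \<in> edges H" using uv sub e by blast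
    ultimately show "(u, v) \<in> edges (ball_around_origin G r) \<longleftrightarrow> (f u, f v) \<in> edges (ball_around_origin H r)"
      using uv unfolding ball_simps(2) by blast
  qed (use f in simp)
qed

text \<open>A walk of length at most \<open>s\<close> from the root runs inside the ball of radius
  \<open>s\<close>, so restricting to that ball destroys none of the shorter walks.\<close>

lemma ball_ball:
  assumes "r \<le> s"
  shows "ball_around_origin (ball_around_origin G s) r = ball_around_origin G r"
proof -
  have reach: "(origin G, v) \<in> adjacency (ball_around_origin G s) ^^ k \<longleftrightarrow> (origin G, v) \<in> adjacency G ^^ k"
    if "k \<le> s" for v k
    using that
  proof (induction k arbitrary: v)
    case (Suc k)
    have "(u, v) \<in> adjacency (ball_around_origin G s) \<longleftrightarrow> (u, v) \<in> adjacency G"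
      if "(origin G, u) \<in> adjacency G ^^ k" for u
    proof
      assume "(u, v) \<in> adjacency G"
      then have "(origin G, v) \<in> adjacency G ^^ Suc k" using that by auto
      then have "u \<in> vertices (ball_around_origin G s)" "v \<in> vertices (ball_around_origin G s)"
        using that Suc.prems Suc_leD unfolding ball_simps by blast+
      then show "(u, v) \<in> adjacency (ball_around_origin G s)"
        using \<open>(u, v) \<in> adjacency G\<close> unfolding adjacency_def ball_simps(2) by blast
    qed (auto simp: adjacency_def)
    then show ?case using Suc by (auto 0 3)
  qed simp
  have "vertices (ball_around_origin (ball_around_origin G s) r) = vertices (ball_around_origin G r)"
    using reach assms order_trans by fastforce
  moreover have "vertices (ball_around_origin G r) \<subseteq> vertices (ball_around_origin G s)"
    using assms order_trans by fastforce
  ultimately show ?thesis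
    by (intro rooted_digraph.equality) (simp_all only: ball_simps(2,3) old.unit.exhaust, auto)
qed

lemma finite_ball:
  assumes "family_tree G"
  shows "finite (vertices (ball_around_origin G r))"
proof -
  have "finite {v. (origin G, v) \<in> adjacency G ^^ k}" for k
  proof (induction k)
    case (Suc k)
    have "{v. (origin G, v) \<in> adjacency G ^^ Suc k} =
      (\<Union>u\<in>{v. (origin G, v) \<in> adjacency G ^^ k}. {v. (u, v) \<in> adjacency G})" by auto
    moreover have "finite {v. (u, v) \<in> adjacency G}" if "(origin G, u) \<in> adjacency G ^^ k" for u
      using assms relpow_adjacency_vertices[OF family_tree_well_formed[OF assms] that]
      by (auto simp: family_tree_def)
    ultimately show ?case using Suc by simp
  qed simp
  moreover have "vertices (ball_around_origin G r) = (\<Union>k\<in>{..r}. {v. (origin G, v) \<in> adjacency G ^^ k})"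
    by auto
  ultimately show ?thesis by simp
qed

definition relabel :: "('v \<Rightarrow> 'w) \<Rightarrow> 'v rooted_digraph \<Rightarrow> 'w rooted_digraph" where
  "relabel f G = \<lparr>vertices = f ` vertices G, edges = map_prod f f ` edges G, origin = f (origin G)\<rparr>"

lemma rooted_isomorphic_relabel: "inj f \<Longrightarrow> rooted_isomorphic G (relabel f G)"
  by (rule rooted_isomorphicI[of f])
    (auto simp: relabel_def bij_betw_def inj_on_def)

text \<open>Applied to \<open>to_nat\<close>, this moves a tree on a countable vertex type to the
  natural numbers, the vertex type behind \<open>ftree\<close>.\<close>

lemma family_tree_relabel:
  assumes f: "inj f" and G: "family_tree G"
  shows "family_tree (relabel f G)"
proof -
  let ?H = "relabel f G"
  have adj: "adjacency ?H = map_prod f f ` adjacency G"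
    by (auto simp: adjacency_def relabel_def image_Un)
  have star: "(f u, f v) \<in> (adjacency ?H)\<^sup>*" if "(u, v) \<in> (adjacency G)\<^sup>*" for u v
    using that
    by induction (auto simp: adj intro: rtrancl_into_rtrancl)
  have "\<not> undirected_cycle ?H vs" for vs
  proof
    assume c: "undirected_cycle ?H vs"
    define ws where "ws = map (inv f) vs"
    have adjvs: "(vs ! i, vs ! (Suc i mod length vs)) \<in> adjacency ?H" if "i < length vs" for i
      using c that by (auto simp: undirected_cycle_def)
    have "distinct ws" unfolding ws_def distinct_map
    proof
      \<comment> \<open>Each vertex of the cycle is an endpoint of an edge of the image, so the
        cycle can be pulled back along \<open>f\<close>.\<close>
      have "set vs \<subseteq> range f" using adjvs by (fastforce simp: adj in_set_conv_nth)
      then show "inj_on (inv f) (set vs)" by (metis inj_on_inv_into)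
    qed (use c in \<open>simp add: undirected_cycle_def\<close>)
    moreover have "(ws ! i, ws ! (Suc i mod length ws)) \<in> adjacency G" if "i < length ws" for i
    proof -
      have "Suc i mod length vs < length vs" using that by (auto simp: ws_def intro: mod_less_divisor)
      then show ?thesis using adjvs[of i] that f by (auto simp: ws_def adj)
    qed
    ultimately have "undirected_cycle G ws" using c by (auto simp: undirected_cycle_def ws_def)
    then show False using G by (auto simp: family_tree_def)
  qed
  moreover have "finite {u. (f v, u) \<in> adjacency ?H}" if "v \<in> vertices G" for v
  proof -
    have "{u. (f v, u) \<in> adjacency ?H} = f ` {u. (v, u) \<in> adjacency G}"
      using f by (auto simp: adj dest: injD)
    then show ?thesis using G that by (auto simp: family_tree_def)
  qed
  moreover have "asym (edges ?H)"
  proof (rule asymI)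
    fix p q assume "(p, q) \<in> edges ?H"
    then obtain u v where "p = f u" "q = f v" "(u, v) \<in> edges G" by (auto simp: relabel_def)
    moreover from this have "(v, u) \<notin> edges G" using G by (auto simp: family_tree_def dest: asymD)
    ultimately show "(q, p) \<notin> edges ?H" using f by (auto simp: relabel_def dest: injD)
  qed
  moreover have "single_valued (edges ?H)"
  proof (rule single_valuedI)
    fix p q q' assume "(p, q) \<in> edges ?H" "(p, q') \<in> edges ?H"
    from this(1) obtain u v where "p = f u" "q = f v" "(u, v) \<in> edges G" by (auto simp: relabel_def)
    moreover from \<open>(p, q') \<in> edges ?H\<close> obtain u' v' where "p = f u'" "q' = f v'" "(u', v') \<in> edges G"
      by (auto simp: relabel_def)
    moreover have "single_valued (edges G)" using G by (simp add: family_tree_def)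
    ultimately show "q = q'" using f by (metis injD single_valuedD)
  qed
  moreover have "edges ?H \<subseteq> vertices ?H \<times> vertices ?H"
    using G by (auto simp: family_tree_def relabel_def)
  ultimately show ?thesis
    using G star unfolding family_tree_def by (auto simp: relabel_def)
qed

lemma family_tree_rep: "family_tree (rep_ftree T)"
  using Quotient3_rep_reflp[OF Quotient3_ftree] by blast

lemma iso_class_abs:
  fixes G :: "'v::countable rooted_digraph"
  assumes "family_tree G"
  obtains H where "family_tree H" "rooted_isomorphic G H" "iso_class G = abs_ftree H"
proof -
  have "\<exists>H::nat rooted_digraph. family_tree H \<and> rooted_isomorphic G H"
    using family_tree_relabel[OF inj_to_nat assms] rooted_isomorphic_relabel[OF inj_to_nat] by blast
  from someI_ex[OF this] show ?thesis using that unfolding iso_class_def by blast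
qed

lemma rooted_isomorphic_rep_iso_class:
  fixes G :: "'v::countable rooted_digraph"
  assumes "family_tree G"
  shows "rooted_isomorphic G (rep_ftree (iso_class G))"
proof -
  obtain H where H: "family_tree H" "rooted_isomorphic G H" "iso_class G = abs_ftree H"
    using iso_class_abs[OF assms] .
  have "rooted_isomorphic H H" by (rule rooted_isomorphicI[of id]) auto
  then have "rooted_isomorphic H (rep_ftree (abs_ftree H))"
    using H(1) Quotient3_rep_abs[OF Quotient3_ftree, of H] rooted_isomorphic_sym
    by (metis family_tree_def)
  then show ?thesis using H rooted_isomorphic_trans by metis
qed

lemma iso_class_cong:
  fixes G :: "'v::countable rooted_digraph" and H :: "'w::countable rooted_digraph"
  assumes "family_tree G" "family_tree H" "rooted_isomorphic G H"
  shows "iso_class G = iso_class H"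
proof -
  obtain G' where G: "family_tree G'" "rooted_isomorphic G G'" "iso_class G = abs_ftree G'"
    using iso_class_abs[OF assms(1)] .
  obtain H' where H: "family_tree H'" "rooted_isomorphic H H'" "iso_class H = abs_ftree H'"
    using iso_class_abs[OF assms(2)] .
  have "rooted_isomorphic G' H'"
    using rooted_isomorphic_trans rooted_isomorphic_sym G H assms unfolding family_tree_def by metis
  then show ?thesis using G H Quotient3_rel_abs[OF Quotient3_ftree, of G' H'] by simp
qed

section \<open>Cylinders and the Borel sets of the local topology\<close>

definition cyl :: "ftree \<Rightarrow> nat \<Rightarrow> ftree set" where
  "cyl S r = {T. rooted_isomorphic (ball_around_origin (rep_ftree S) r)
                                    (ball_around_origin (rep_ftree T) r)}"

lemma cyl_self: "S \<in> cyl S r"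
  unfolding cyl_def by (auto intro: rooted_isomorphicI[of id])

lemma cyl_antimono:
  assumes "r \<le> s" shows "cyl S s \<subseteq> cyl S r"
proof
  fix T assume "T \<in> cyl S s"
  then show "T \<in> cyl S r"
    using rooted_isomorphic_ball[OF well_formed_ball well_formed_ball, of "rep_ftree S" s "rep_ftree T" s r]
    by (simp add: cyl_def ball_ball[OF assms])
qed

text \<open>Having isomorphic balls of radius \<open>r\<close> is an equivalence relation, so for a
  fixed radius the cylinders partition the space.\<close>

lemma cyl_eq: assumes "T \<in> cyl S r" shows "cyl T r = cyl S r"
proof -
  have "rooted_isomorphic (ball_around_origin (rep_ftree T) r) (ball_around_origin (rep_ftree S) r)"
    using assms rooted_isomorphic_sym well_formed_ball unfolding cyl_def well_formed_def by blast
  then show ?thesis using assms rooted_isomorphic_trans unfolding cyl_def by blast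
qed

lemma countable_finite_digraphs: "countable {G :: 'v::countable rooted_digraph. finite (vertices G) \<and> finite (edges G)}"
proof -
  have "countable ((\<lambda>(V, E, w). \<lparr>vertices = V, edges = E, origin = w :: 'v\<rparr>) `
      ({V. finite V} \<times> {E. finite E} \<times> UNIV))"
    by (intro countable_image countable_SIGMA) (auto simp: countable_Collect_finite)
  moreover have "{G :: 'v rooted_digraph. finite (vertices G) \<and> finite (edges G)} \<subseteq> 
     ((\<lambda>(V, E, w). \<lparr>vertices = V, edges = E, origin = w :: 'v\<rparr>) ` ({V. finite V} \<times> {E. finite E} \<times> UNIV))"
  proof
    fix G :: "'v rooted_digraph" assume "G \<in> {G. finite (vertices G) \<and> finite (edges G)}"
    then show "G \<in> (\<lambda>(V, E, w). \<lparr>vertices = V, edges = E, origin = w\<rparr>) ` ({V. finite V} \<times> {E. finite E} \<times> UNIV)"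
      by (intro image_eqI[of _ _ "(vertices G, edges G, origin G)"]) auto
  qed
  ultimately show ?thesis by (rule countable_subset[rotated])
qed

lemma finite_ball_digraph:
  assumes "family_tree G"
  shows "finite (vertices (ball_around_origin G r)) \<and> finite (edges (ball_around_origin G r))"
  using finite_ball[OF assms] by (simp add: finite_subset[of _ "_ \<times> _"] del: ball_simps(1))

text \<open>A cylinder is fixed by its radius and one finite graph on the naturals. Countability is
  what turns an open set into a countable union of cylinders.\<close>

lemma countable_cyl: "countable (range (\<lambda>(S, r). cyl S r))"
proof -
  have "range (\<lambda>(S, r). cyl S r) \<subseteq> (\<lambda>(K, r). {T. rooted_isomorphic (K :: nat rooted_digraph) (ball_around_origin (rep_ftree T) r)}) `
      ({G. finite (vertices G) \<and> finite (edges G)} \<times> UNIV)" (is "_ \<subseteq> ?f ` ?K")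
  proof
    fix A assume "A \<in> range (\<lambda>(S, r). cyl S r)"
    then obtain S r where "A = cyl S r" by auto
    then have "A = ?f (ball_around_origin (rep_ftree S) r, r)" by (simp add: cyl_def)
    moreover have "(ball_around_origin (rep_ftree S) r, r) \<in> ?K"
      using finite_ball_digraph[OF family_tree_rep] by (simp del: ball_simps)
    ultimately show "A \<in> ?f ` ?K" by (rule image_eqI)
  qed
  then show ?thesis
    by (rule countable_subset) (intro countable_image countable_SIGMA countable_finite_digraphs, simp)
qed

definition local_events :: "ftree set set" where
  "local_events = {A. \<exists>r. \<forall>T\<in>A. cyl T r \<subseteq> A}"

lemma Int_stable_local_events: "Int_stable local_events"
proof (rule Int_stableI)
  fix A B assume "A \<in> local_events" "B \<in> local_events"
  then obtain r s where "\<forall>T\<in>A. cyl T r \<subseteq> A" "\<forall>T\<in>B. cyl T s \<subseteq> B" by (auto simp: local_events_def)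
  then have "\<forall>T\<in>A \<inter> B. cyl T (max r s) \<subseteq> A \<inter> B"
    using cyl_antimono[of r "max r s"] cyl_antimono[of s "max r s"] by (auto; blast)
  then show "A \<inter> B \<in> local_events" by (auto simp: local_events_def)
qed

lemma cyl_local: "cyl S r \<in> local_events"
  unfolding local_events_def using cyl_eq by blast

lemma open_cyl: "open (cyl S r)"
  unfolding open_ftree_def cyl_def
  by (rule generate_topology.Basis) auto

text \<open>Cylinders around a tree are nested, so finite intersections only call for the larger
  radius: the generating sets form a base.\<close>

lemma open_ftree_iff: "open U \<longleftrightarrow> (\<forall>T\<in>U. \<exists>r. cyl T r \<subseteq> U)"
proof
  assume "open U"
  then have "generate_topology (range (\<lambda>(S, r). cyl S r)) U"
    by (simp add: open_ftree_def cyl_def)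
  then show "\<forall>T\<in>U. \<exists>r. cyl T r \<subseteq> U"
  proof induction
    case (Int a b)
    show ?case
    proof
      fix T assume "T \<in> a \<inter> b"
      then obtain r s where "cyl T r \<subseteq> a" "cyl T s \<subseteq> b" using Int by blast
      then have "cyl T (max r s) \<subseteq> a \<inter> b"
        using cyl_antimono[of r "max r s"] cyl_antimono[of s "max r s"] by (auto; blast)
      then show "\<exists>r. cyl T r \<subseteq> a \<inter> b" ..
    qed
  next
    case (UN K) then show ?case by blast
  next
    case (Basis s) then show ?case using cyl_eq by fastforce
  qed simp
next
  assume *: "\<forall>T\<in>U. \<exists>r. cyl T r \<subseteq> U"
  have "open (\<Union>{A. \<exists>T r. A = cyl T r \<and> A \<subseteq> U})" by (rule open_Union) (auto intro: open_cyl)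
  moreover have "U = \<Union>{A. \<exists>T r. A = cyl T r \<and> A \<subseteq> U}"
  proof (intro equalityI subsetI)
    fix T assume "T \<in> U"
    then obtain r where "cyl T r \<subseteq> U" using * by blast
    then show "T \<in> \<Union>{A. \<exists>T r. A = cyl T r \<and> A \<subseteq> U}" using cyl_self[of T r] by blast
  qed blast
  ultimately show "open U" by simp
qed

lemma borel_ftree: "sets (borel :: ftree measure) = sigma_sets UNIV local_events"
proof -
  have "sigma_sets UNIV {S::ftree set. open S} = sigma_sets UNIV local_events"
  proof (rule sigma_sets_eqI)
    fix A assume "A \<in> local_events"
    then have "open A" unfolding local_events_def open_ftree_iff by blast
    then show "A \<in> sigma_sets UNIV {S. open S}" by auto
  next
    fix U :: "ftree set" assume "U \<in> {S. open S}"
    then have U: "U = \<Union>(range (\<lambda>(S, r). cyl S r) \<inter> Pow U)"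
    proof (intro equalityI subsetI)
      fix T assume "T \<in> U"
      then obtain r where "cyl T r \<subseteq> U" using \<open>U \<in> _\<close> open_ftree_iff[of U] by auto
      then show "T \<in> \<Union>(range (\<lambda>(S, r). cyl S r) \<inter> Pow U)"
        using cyl_self[of T r] by (intro UnionI[of "cyl T r"]) auto
    qed auto
    have "\<Union>(range (\<lambda>(S, r). cyl S r) \<inter> Pow U) \<in> sigma_sets UNIV local_events"
      by (rule sigma_sets_UNION) (use countable_cyl cyl_local in auto)
    then show "U \<in> sigma_sets UNIV local_events" using U by simp
  qed
  then show ?thesis by (simp add: borel_def)
qed

lemma local_event_iso_class:
  fixes G :: "'v::countable rooted_digraph" and H :: "'w::countable rooted_digraph"
  assumes A: "\<forall>T\<in>A. cyl T r \<subseteq> A" and G: "family_tree G" and H: "family_tree H"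
    and "rooted_isomorphic (ball_around_origin G r) (ball_around_origin H r)"
    and mem: "iso_class G \<in> A"
  shows "iso_class H \<in> A"
proof -
  have G': "rooted_isomorphic (ball_around_origin G r) (ball_around_origin (rep_ftree (iso_class G)) r)"
    by (rule rooted_isomorphic_ball[OF family_tree_well_formed[OF G] family_tree_well_formed[OF family_tree_rep]
          rooted_isomorphic_rep_iso_class[OF G]])
  have H': "rooted_isomorphic (ball_around_origin H r) (ball_around_origin (rep_ftree (iso_class H)) r)"
    by (rule rooted_isomorphic_ball[OF family_tree_well_formed[OF H] family_tree_well_formed[OF family_tree_rep]
          rooted_isomorphic_rep_iso_class[OF H]])
  have "rooted_isomorphic (ball_around_origin (rep_ftree (iso_class G)) r) (ball_around_origin G r)"
    by (rule rooted_isomorphic_sym[OF _ G']) (use well_formed_ball[of G r] in \<open>simp only: well_formed_def\<close>)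
  then have "rooted_isomorphic (ball_around_origin (rep_ftree (iso_class G)) r) (ball_around_origin (rep_ftree (iso_class H)) r)"
    using assms(4) H' by (blast intro: rooted_isomorphic_trans)
  then show ?thesis using A mem by (auto simp: cyl_def)
qed

text \<open>Only countably many finite graphs can occur as balls of radius \<open>r\<close>, and the
  event that a given one occurs is a countable condition on edges. Fixing the root \<open>w\<close>
  lets the walks from it be treated by induction on their length.\<close>

lemma measurable_iso_class:
  fixes G :: "'a \<Rightarrow> 'v::countable rooted_digraph"
  assumes ft: "\<And>\<omega>. \<omega> \<in> space M \<Longrightarrow> family_tree (G \<omega>)"
    and o: "\<And>\<omega>. \<omega> \<in> space M \<Longrightarrow> origin (G \<omega>) = w"
    and e [measurable]: "\<And>u v. Measurable.pred M (\<lambda>\<omega>. (u, v) \<in> edges (G \<omega>))"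
  shows "(\<lambda>\<omega>. iso_class (G \<omega>)) \<in> M \<rightarrow>\<^sub>M borel"
proof -
  have [measurable]: "Measurable.pred M (\<lambda>\<omega>. (u, v) \<in> adjacency (G \<omega>))" for u v
    unfolding adjacency_def Un_iff converse_iff by measurable
  have reach [measurable]: "Measurable.pred M (\<lambda>\<omega>. (w, v) \<in> adjacency (G \<omega>) ^^ k)" for v k
  proof (induction k arbitrary: v)
    case (Suc k)
    note Suc [measurable]
    have "(\<lambda>\<omega>. (w, v) \<in> adjacency (G \<omega>) ^^ Suc k) = (\<lambda>\<omega>. \<exists>u. (w, u) \<in> adjacency (G \<omega>) ^^ k \<and> (u, v) \<in> adjacency (G \<omega>))"
      by auto
    moreover have "Measurable.pred M (\<lambda>\<omega>. \<exists>u. (w, u) \<in> adjacency (G \<omega>) ^^ k \<and> (u, v) \<in> adjacency (G \<omega>))"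
      by measurable
    ultimately show ?case by (simp only:)
  qed simp
  have ball: "{\<omega>\<in>space M. ball_around_origin (G \<omega>) r = K} \<in> sets M" for r K
  proof -
    have "{\<omega>\<in>space M. ball_around_origin (G \<omega>) r = K} =
      {\<omega>\<in>space M. (\<forall>v. v \<in> vertices K \<longleftrightarrow> (\<exists>k\<le>r. (w, v) \<in> adjacency (G \<omega>) ^^ k)) \<and>
        (\<forall>u v. (u, v) \<in> edges K \<longleftrightarrow> (u, v) \<in> edges (G \<omega>) \<and> u \<in> vertices K \<and> v \<in> vertices K) \<and> w = origin K}"
      (is "?L = ?R")
    proof (intro set_eqI iffI)
      fix \<omega> assume "\<omega> \<in> ?L" then show "\<omega> \<in> ?R" using o by auto
    next
      fix \<omega> assume \<omega>: "\<omega> \<in> ?R"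
      then have "vertices (ball_around_origin (G \<omega>) r) = vertices K" using o by auto
      moreover from this \<omega> have "edges (ball_around_origin (G \<omega>) r) = edges K"
        unfolding ball_simps(2) by auto
      ultimately show "\<omega> \<in> ?L" using o \<omega> by (auto intro!: rooted_digraph.equality simp del: ball_simps(1,2))
    qed
    also have "\<dots> \<in> sets M" by measurable
    finally show ?thesis .
  qed
  show ?thesis
  proof (rule measurable_sigma_sets[OF borel_ftree])
    fix A assume "A \<in> local_events"
    then obtain r where r: "\<forall>T\<in>A. cyl T r \<subseteq> A" by (auto simp: local_events_def)
    \<comment> \<open>All finite graphs that are the ball of some tree belonging to
      \<open>A\<close>; by locality the ball alone decides membership.\<close>
    let ?K = "{K :: 'v rooted_digraph. finite (vertices K) \<and> finite (edges K)} \<inter>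
        {K. \<exists>H. family_tree H \<and> iso_class H \<in> A \<and> ball_around_origin H r = K}"
    have "(\<lambda>\<omega>. iso_class (G \<omega>)) -` A \<inter> space M = (\<Union>K\<in>?K. {\<omega>\<in>space M. ball_around_origin (G \<omega>) r = K})"
    proof (intro set_eqI iffI)
      fix \<omega> assume \<omega>: "\<omega> \<in> (\<lambda>\<omega>. iso_class (G \<omega>)) -` A \<inter> space M"
      then have "ball_around_origin (G \<omega>) r \<in> ?K" using ft[of \<omega>] finite_ball_digraph[of "G \<omega>" r] by (auto simp del: ball_simps)
      then show "\<omega> \<in> (\<Union>K\<in>?K. {\<omega>\<in>space M. ball_around_origin (G \<omega>) r = K})" using \<omega> by blast
    next
      fix \<omega> assume "\<omega> \<in> (\<Union>K\<in>?K. {\<omega>\<in>space M. ball_around_origin (G \<omega>) r = K})"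
      then obtain H where "\<omega> \<in> space M" "family_tree H" "iso_class H \<in> A" "ball_around_origin H r = ball_around_origin (G \<omega>) r"
        by auto
      moreover have "rooted_isomorphic (ball_around_origin (G \<omega>) r) (ball_around_origin (G \<omega>) r)"
        by (rule rooted_isomorphicI[of id]) auto
      ultimately show "\<omega> \<in> (\<lambda>\<omega>. iso_class (G \<omega>)) -` A \<inter> space M"
        using local_event_iso_class[OF r _ ft, of H] by auto
    qed
    also have "\<dots> \<in> sets M"
      by (intro sets.countable_UN'' ball countable_Int1 countable_finite_digraphs)
    finally show "(\<lambda>\<omega>. iso_class (G \<omega>)) -` A \<inter> space M \<in> sets M" .
  qed auto
qed


section \<open>Record components and joined bushes as Family Trees\<close>

lemma family_treeI_acyclic:
  assumes "edges G \<subseteq> vertices G \<times> vertices G" "origin G \<in> vertices G"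
    "\<And>u v. u \<in> vertices G \<Longrightarrow> v \<in> vertices G \<Longrightarrow> (u, v) \<in> (adjacency G)\<^sup>*"
    and ac: "acyclic (edges G)" and sv: "single_valued (edges G)"
    and "\<And>v. v \<in> vertices G \<Longrightarrow> finite {u. (u, v) \<in> edges G}"
  shows "family_tree G"
proof -
  have "\<not> undirected_cycle G vs" for vs
  proof
    assume c: "undirected_cycle G vs"
    let ?n = "length vs"
    have n: "3 \<le> ?n" "distinct vs" using c by (auto simp: undirected_cycle_def)
    let ?E = "edges G \<inter> set vs \<times> set vs"
    have "vs ! 0 \<in> set vs" using n by (intro nth_mem) linarith
    \<comment> \<open>On the finite cycle some vertex \<open>w\<close> receives no edge from cycle
      vertices. Both cycle neighbours of \<open>w\<close> are then its parents, hence equal, which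
      is impossible with three or more vertices.\<close>
    have "wf ?E" using ac by (intro finite_acyclic_wf) (auto intro: acyclic_subset)
    then obtain w where w: "w \<in> set vs" "\<And>y. (y, w) \<in> ?E \<Longrightarrow> y \<notin> set vs"
      using \<open>vs ! 0 \<in> set vs\<close> by (rule wfE_min) blast
    then obtain i where i: "i < ?n" "w = vs ! i" by (auto simp: in_set_conv_nth)
    define j where "j = (if i = 0 then ?n - 1 else i - 1)"
    have j: "j < ?n" "Suc j mod ?n = i"
      using i n by (auto simp: j_def)
    have a: "(w, vs ! (Suc i mod ?n)) \<in> adjacency G" "(vs ! j, w) \<in> adjacency G"
      using c i j by (auto simp: undirected_cycle_def)
    have "Suc i mod ?n < ?n" using n by (intro mod_less_divisor) linarith
    then have "(w, vs ! (Suc i mod ?n)) \<in> edges G" "(w, vs ! j) \<in> edges G"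
      using a w(2)[of "vs ! (Suc i mod ?n)"] w(2)[of "vs ! j"] w(1) j(1)
      by (auto simp: adjacency_def)
    then have "vs ! (Suc i mod ?n) = vs ! j" using sv by (auto dest: single_valuedD)
    then have "Suc i mod ?n = j" using n \<open>Suc i mod ?n < ?n\<close> j(1) by (simp add: nth_eq_iff_index_eq)
    then have "(i + 2) mod ?n = i" using j(2) by (metis add_2_eq_Suc' mod_Suc_eq)
    moreover have "(i + 2) mod ?n = (if i + 2 < ?n then i + 2 else i + 2 - ?n)"
      using i n by (simp add: le_mod_geq)
    ultimately show False using i n by (simp split: if_splits)
  qed
  moreover have "asym (edges G)"
  proof (rule asymI)
    fix u v assume "(u, v) \<in> edges G"
    then show "(v, u) \<notin> edges G" using ac unfolding acyclic_def by (meson trancl.simps)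
  qed
  moreover have "finite {u. (v, u) \<in> adjacency G}" if "v \<in> vertices G" for v
  proof -
    have "{u. (v, u) \<in> adjacency G} = {u. (v, u) \<in> edges G} \<union> {u. (u, v) \<in> edges G}"
      by (auto simp: adjacency_def)
    moreover have "finite {u. (v, u) \<in> edges G}"
    proof (cases "\<exists>w. (v, w) \<in> edges G")
      case True
      then obtain w where "(v, w) \<in> edges G" ..
      then have "{u. (v, u) \<in> edges G} \<subseteq> {w}" using sv by (auto dest: single_valuedD)
      then show ?thesis by (rule finite_subset) simp
    qed simp
    ultimately show ?thesis using assms(6)[OF that] by simp
  qed
  ultimately show ?thesis using assms by (simp add: family_tree_def)
qed

lemma record_map_eqI:
  assumes "i < j" "0 \<le> (\<Sum>l=i..<j. x l)" "\<And>k. i < k \<Longrightarrow> k < j \<Longrightarrow> (\<Sum>l=i..<k. x l) < 0"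
  shows "record_map x i = j"
proof -
  have "Inf {j. i < j \<and> 0 \<le> (\<Sum>l=i..<j. x l)} = j"
    using assms by (intro cInf_eq_minimum) (auto simp: not_le[symmetric])
  then show ?thesis using assms by (auto simp: record_map_def)
qed

lemma record_map_cases:
  obtains "record_map x i = i" | "i < record_map x i" "0 \<le> (\<Sum>l=i..<record_map x i. x l)"
    "\<And>k. i < k \<Longrightarrow> k < record_map x i \<Longrightarrow> (\<Sum>l=i..<k. x l) < 0"
proof (cases "\<exists>j>i. 0 \<le> (\<Sum>l=i..<j. x l)")
  case True
  then obtain j where j: "i < j" "0 \<le> (\<Sum>l=i..<j. x l)" by auto
  \<comment> \<open>The infimum of a set of integers is evaluated through its least element, found
    by a search over natural distances from \<open>i\<close>.\<close>
  define m where "m = (LEAST m. 0 < m \<and> 0 \<le> (\<Sum>l=i..<i + int m. x l))"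
  have "0 < nat (j - i) \<and> 0 \<le> (\<Sum>l=i..<i + int (nat (j - i)). x l)" using j by simp
  then have m: "0 < m" "0 \<le> (\<Sum>l=i..<i + int m. x l)" unfolding m_def by (metis (mono_tags, lifting) LeastI)+
  have less: "(\<Sum>l=i..<k. x l) < 0" if "i < k" "k < i + int m" for k
    using that not_less_Least[of "nat (k - i)" "\<lambda>m. 0 < m \<and> 0 \<le> (\<Sum>l=i..<i + int m. x l)"]
    unfolding m_def[symmetric] by force
  have "record_map x i = i + int m"
    using m less by (intro record_map_eqI) auto
  then show ?thesis using that(2) m less by simp
qed (auto simp: record_map_def intro: that(1))

lemma finite_record_children: "finite {i. (i, j) \<in> record_edges x}"
proof -
  let ?C = "{i. (i, j) \<in> record_edges x}" and ?h = "\<lambda>i. \<Sum>l=i..<j. x l"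
  have C: "i < j" "0 \<le> ?h i" "\<And>k. i < k \<Longrightarrow> k < j \<Longrightarrow> (\<Sum>l=i..<k. x l) < 0" if "i \<in> ?C" for i
    using that record_map_cases[of x i "i < j"] record_map_cases[of x i "0 \<le> ?h i"]
       record_map_cases[of x i "\<forall>k. i < k \<longrightarrow> k < j \<longrightarrow> (\<Sum>l=i..<k. x l) < 0"]
    by (auto simp: record_edges_def)
  have "?h i \<le> x (j - 1)" if "i \<in> ?C" for i
  proof -
    have "{i..<j} = insert (j - 1) {i..<j - 1}" using C(1)[OF that] by auto
    then have "?h i = x (j - 1) + (\<Sum>l=i..<j - 1. x l)" by simp
    \<comment> \<open>Before the record at \<open>j\<close> all sums are negative; for
      \<open>i = j - 1\<close> the sum is empty.\<close>
    moreover have "(\<Sum>l=i..<j - 1. x l) \<le> 0"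
      using C(3)[OF that, of "j - 1"] C(1)[OF that] by (cases "i < j - 1") auto
    ultimately show ?thesis by simp
  qed
  then have "?h ` ?C \<subseteq> {0..x (j - 1)}" using C(2) by auto
  then have "finite (?h ` ?C)" by (rule finite_subset) simp
  moreover have "?h i < ?h k" if "i \<in> ?C" "k \<in> ?C" "i < k" for i k
  proof -
    have "{i..<j} = {i..<k} \<union> {k..<j}" using C(1)[OF that(2)] that(3) by auto
    then have "?h i = (\<Sum>l=i..<k. x l) + ?h k" by (simp add: sum.union_disjoint)
    then show ?thesis using C(3)[OF that(1,3)] C(1)[OF that(2)] by simp
  qed
  then have "inj_on ?h ?C" by (intro linorder_inj_onI) (fastforce, auto)
  ultimately show ?thesis by (rule finite_imageD)
qed

lemma record_edges_less: "(i, j) \<in> record_edges x \<Longrightarrow> i < j"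
  using record_map_cases[of x i "i < record_map x i"] by (auto simp: record_edges_def)

lemma rtrancl_restrict_component:
  assumes "(a, b) \<in> r\<^sup>*"
  shows "(a, b) \<in> (r \<inter> {c. (a, c) \<in> r\<^sup>*} \<times> {c. (a, c) \<in> r\<^sup>*})\<^sup>*"
  using assms
proof induction
  case (step b c)
  then have "(a, c) \<in> r\<^sup>*" by (rule_tac rtrancl_into_rtrancl)
  then have "(b, c) \<in> r \<inter> {c. (a, c) \<in> r\<^sup>*} \<times> {c. (a, c) \<in> r\<^sup>*}" using step by blast
  with step.IH show ?case by (rule rtrancl_into_rtrancl)
qed simp

lemma record_component_simps:
  "vertices (record_component x i) = {j. (i, j) \<in> (record_edges x \<union> (record_edges x)\<inverse>)\<^sup>*}"
  "edges (record_component x i) = record_edges x \<inter> vertices (record_component x i) \<times> vertices (record_component x i)"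
  "origin (record_component x i) = i"
  by (simp_all add: record_component_def Let_def)

lemma family_tree_record_component: "family_tree (record_component x i)"
proof (rule family_treeI_acyclic)
  let ?G = "record_component x i" and ?r = "record_edges x \<union> (record_edges x)\<inverse>"
  have "adjacency ?G = ?r \<inter> vertices ?G \<times> vertices ?G"
    unfolding adjacency_def record_component_simps(2) by auto
  then have star: "(i, j) \<in> (adjacency ?G)\<^sup>*" if "j \<in> vertices ?G" for j
    using rtrancl_restrict_component[of i j ?r] that
    by (simp add: record_component_simps(1))
  have "sym ((adjacency ?G)\<^sup>*)" by (intro sym_rtrancl) (simp add: adjacency_def sym_Un_converse)
  then show "(u, v) \<in> (adjacency ?G)\<^sup>*" if "u \<in> vertices ?G" "v \<in> vertices ?G" for u v
    using star[OF that(1)] star[OF that(2)] by (meson rtrancl_trans symD)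
  show "acyclic (edges ?G)"
    by (rule acyclicI_order[of _ uminus]) (auto simp: record_component_simps(2) dest: record_edges_less)
  show "single_valued (edges ?G)"
    by (auto simp: single_valued_def record_component_simps(2) record_edges_def)
  show "finite {u. (u, v) \<in> edges ?G}" for v
    by (rule finite_subset[OF _ finite_record_children[of v x]]) (auto simp: record_component_simps(2))
qed (auto simp: record_component_simps)

lemma joined_bushes_simps [simp]:
  "vertices (joined_bushes d v) = (SIGMA i:UNIV. bush_vertices (d i))"
  "origin (joined_bushes d v) = v"
  by (simp_all add: joined_bushes_def)

lemma edges_joined_bushes:
  "(p, q) \<in> edges (joined_bushes d v) \<longleftrightarrow>
     (\<exists>i k u. p = (i, k # u) \<and> q = (i, u) \<and> k # u \<in> bush_vertices (d i)) \<or> (\<exists>i. p = (i, []) \<and> q = (i + 1, []))"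
  by (auto simp: joined_bushes_def)

lemma bush_vertices_Cons: "k # u \<in> bush_vertices d \<longleftrightarrow> u \<in> bush_vertices d \<and> k < d u"
  by (subst bush_vertices.simps) auto

lemma family_tree_joined_bushes:
  assumes "u \<in> bush_vertices (d i)"
  shows "family_tree (joined_bushes d (i, u))"
proof (rule family_treeI_acyclic)
  let ?G = "joined_bushes d (i, u)"
  have "sym ((adjacency ?G)\<^sup>*)" by (intro sym_rtrancl) (simp add: adjacency_def sym_Un_converse)
  have up: "((j, w), (j, [])) \<in> (adjacency ?G)\<^sup>*" if "w \<in> bush_vertices (d j)" for j w
    using that
  proof induction
    case (child w k)
    then have "((j, k # w), (j, w)) \<in> adjacency ?G"
      by (auto simp: adjacency_def edges_joined_bushes intro: bush_vertices.child)
    then show ?case using child.IH by (rule converse_rtrancl_into_rtrancl)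
  qed simp
  have spine: "((j, []), (j + int n, [])) \<in> (adjacency ?G)\<^sup>*" for j n
  proof (induction n)
    case (Suc n)
    have "((j + int n, []), (j + int (Suc n), [])) \<in> adjacency ?G"
      by (auto simp: adjacency_def edges_joined_bushes)
    then show ?case by (rule rtrancl_into_rtrancl[OF Suc])
  qed simp
  have "((j, []), (k, [])) \<in> (adjacency ?G)\<^sup>*" for j k
    using spine[of j "nat (k - j)"] spine[of k "nat (j - k)"] \<open>sym ((adjacency ?G)\<^sup>*)\<close>
    by (cases "j \<le> k") (auto dest: symD)
  then show "(p, q) \<in> (adjacency ?G)\<^sup>*" if "p \<in> vertices ?G" "q \<in> vertices ?G" for p q
    using up[of "snd p" "fst p"] up[of "snd q" "fst q"] that \<open>sym ((adjacency ?G)\<^sup>*)\<close>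
    by (auto simp: mem_Sigma_iff) (meson rtrancl_trans symD)
  show "acyclic (edges ?G)"
  \<comment> \<open>Along an edge to the parent the depth falls within a bush and the spine index
    rises between bushes; both make this value smaller.\<close>
  proof (rule acyclicI_order[of _ "\<lambda>(j, w). - real_of_int j - inverse (1 + real (length w))"])
    show "(\<lambda>(j, w). - real_of_int j - inverse (1 + real (length w))) q < (\<lambda>(j, w). - real_of_int j - inverse (1 + real (length w))) p"
      if "(p, q) \<in> edges ?G" for p q
      using that by (auto simp: edges_joined_bushes field_simps)
  qed
  show "single_valued (edges ?G)"
    by (auto simp: single_valued_def edges_joined_bushes)
  show "finite {p. (p, q) \<in> edges ?G}" if "q \<in> vertices ?G" for q
  proof (rule finite_subset)
    show "{p. (p, q) \<in> edges ?G} \<subseteq> insert (fst q - 1, []) ((\<lambda>k. (fst q, k # snd q)) ` {..<d (fst q) (snd q)})"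
      by (auto simp: edges_joined_bushes bush_vertices_Cons)
  qed simp
qed (use assms in \<open>auto simp: edges_joined_bushes bush_vertices_Cons bush_vertices.root\<close>)

text \<open>One step changes the spine index by at most one, so the ball of radius \<open>r\<close>
  never leaves the bushes with index between \<open>-r\<close> and \<open>r\<close>. Only the vertex
  sets of these bushes are compared: degrees at addresses outside a bush leave no trace in the
  graph.\<close>

lemma ball_joined_bushes_cong:
  assumes "\<And>i. \<bar>i\<bar> \<le> int r \<Longrightarrow> bush_vertices (d i) = bush_vertices (d' i)"
  shows "ball_around_origin (joined_bushes d (0, u)) r = ball_around_origin (joined_bushes d' (0, u)) r"
proof -
  let ?A = "\<lambda>d. adjacency (joined_bushes d (0, u))"
  have step: "\<bar>fst q\<bar> \<le> \<bar>fst p\<bar> + 1" if "(p, q) \<in> ?A d" for d p q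
    using that by (auto simp: adjacency_def edges_joined_bushes)
  have edge: "(p, q) \<in> edges (joined_bushes d (0, u)) \<longleftrightarrow> (p, q) \<in> edges (joined_bushes d' (0, u))"
    if "\<bar>fst p\<bar> \<le> int r \<or> \<bar>fst q\<bar> \<le> int r" for p q
    using that assms by (auto simp: edges_joined_bushes)
  \<comment> \<open>Both claims go through one induction: the index bound at length \<open>k\<close>
    is what allows the edges of the next step to be compared.\<close>
  have reach: "((0, u), q) \<in> ?A d ^^ k \<longleftrightarrow> ((0, u), q) \<in> ?A d' ^^ k" 
    "((0, u), q) \<in> ?A d ^^ k \<Longrightarrow> \<bar>fst q\<bar> \<le> int k" if "k \<le> r" for k q
    using that
  proof (induction k arbitrary: q)
    case (Suc k)
    { case 1
      have "(p, q) \<in> ?A d \<longleftrightarrow> (p, q) \<in> ?A d'" if "\<bar>fst p\<bar> \<le> int k" for p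
        using edge[of p q] edge[of q p] that 1 by (auto simp: adjacency_def)
      moreover have "((0, u), p) \<in> ?A d ^^ k \<longleftrightarrow> ((0, u), p) \<in> ?A d' ^^ k" "((0, u), p) \<in> ?A d ^^ k \<Longrightarrow> \<bar>fst p\<bar> \<le> int k" for p
        using Suc.IH[of p] 1 by auto
      ultimately show ?case by (simp only: relpow.simps relcomp_unfold mem_Collect_eq) blast
    next
      case 2
      then obtain p where "((0, u), p) \<in> ?A d ^^ k" "(p, q) \<in> ?A d" by auto
      then show ?case using Suc.IH(2)[of p] 2 step[of p q d] by simp
    }
  qed auto
  have V: "vertices (ball_around_origin (joined_bushes d (0, u)) r) = vertices (ball_around_origin (joined_bushes d' (0, u)) r)"
    using reach(1) by auto
  have "\<bar>fst q\<bar> \<le> int r" if "q \<in> vertices (ball_around_origin (joined_bushes d (0, u)) r)" for q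
  proof -
    from that obtain k where "k \<le> r" "((0, u), q) \<in> ?A d ^^ k" by auto
    then show ?thesis using reach(2)[of k q] by simp
  qed
  then have "edges (ball_around_origin (joined_bushes d (0, u)) r) = edges (ball_around_origin (joined_bushes d' (0, u)) r)"
    using edge unfolding ball_simps(2) V[symmetric] by (auto simp del: ball_simps)
  then show ?thesis using V by (intro rooted_digraph.equality) simp_all
qed

section \<open>Trees, preorder codes and windows of bushes\<close>

text \<open>Plane trees: the preorder code depends on the order of the children, which is forgotten
  only when \<open>iso_class\<close> is taken.\<close>

datatype ptree = Node (children: "ptree list")

instance ptree :: countable by countable_datatype

primrec psize :: "ptree \<Rightarrow> nat" where
  "psize (Node ts) = Suc (sum_list (map psize ts))"

primrec pre :: "ptree \<Rightarrow> int list" where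
  "pre (Node ts) = (int (length ts) - 1) # concat (map pre ts)"

definition fsize :: "ptree list \<Rightarrow> nat" where "fsize ts = sum_list (map psize ts)"

definition forest :: "ptree list \<Rightarrow> int list" where "forest ts = concat (map pre ts)"

lemma fsize_simps [simp]: "fsize [] = 0" "fsize (t # ts) = psize t + fsize ts" "fsize (ts @ us) = fsize ts + fsize us"
  by (simp_all add: fsize_def)

lemma forest_simps [simp]: "forest [] = []" "forest (t # ts) = pre t @ forest ts" "forest (ts @ us) = forest ts @ forest us"
  by (simp_all add: forest_def)

lemma psize_children: "psize t = Suc (fsize (children t))"
  by (cases t) (simp add: fsize_def)

lemma pre_children: "pre t = (int (length (children t)) - 1) # forest (children t)"
  by (cases t) (simp add: forest_def)

declare psize.simps [simp del] pre.simps [simp del]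

lemma psize_pos [simp]: "0 < psize t" by (simp add: psize_children)

lemma length_pre [simp]: "length (pre t) = psize t"
proof (induction t)
  case (Node ts)
  then have "map (length \<circ> pre) ts = map psize ts" by simp
  then show ?case by (simp add: psize.simps pre.simps length_concat del: map_eq_conv)
qed

lemma length_forest [simp]: "length (forest ts) = fsize ts"
  by (induction ts) auto

lemma sum_pre [simp]: "sum_list (pre t) = - 1"
proof (induction t)
  case (Node ts)
  then have "sum_list (concat (map pre ts)) = - int (length ts)" by (induction ts) auto
  then show ?case by (simp add: pre.simps)
qed

lemma sum_forest [simp]: "sum_list (forest ts) = - int (length ts)"
  by (induction ts) auto

text \<open>A suffix is the end of one code followed by whole codes, and a nonempty whole code is a
  suffix of itself. Since codes are read from right to left, suffixes are what the walk sums when it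
  starts at the left end.\<close>

lemma suffix_negative_concat:
  assumes "\<And>w n. w \<in> set ws \<Longrightarrow> n < length w \<Longrightarrow> sum_list (drop n w) < (0::int)" "n < length (concat ws)"
  shows "sum_list (drop n (concat ws)) < 0"
  using assms
proof (induction ws arbitrary: n)
  case (Cons w ws)
  have rest: "sum_list (drop k (concat ws)) \<le> 0" for k
    using Cons.IH[of k] Cons.prems(1) by (cases "k < length (concat ws)") auto
  show ?case
  proof (cases "n < length w")
    case True
    then show ?thesis using Cons.prems(1)[of w n] rest[of 0] by simp
  next
    case False
    then show ?thesis using Cons.IH[of "n - length w"] Cons.prems by simp
  qed
qed simp

lemma suffix_negative_pre: "n < psize t \<Longrightarrow> sum_list (drop n (pre t)) < 0"
proof (induction t arbitrary: n)
  case (Node ts)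
  show ?case
  proof (cases n)
    case 0 then show ?thesis by simp
  next
    case (Suc k)
    then have "k < length (concat (map pre ts))"
      using Node.prems by (simp add: forest_def[symmetric] psize_children)
    then have "sum_list (drop k (concat (map pre ts))) < 0"
      using Node.IH by (intro suffix_negative_concat) auto
    then show ?thesis using Suc by (simp add: pre.simps)
  qed
qed

lemma suffix_negative_forest: "n < fsize ts \<Longrightarrow> sum_list (drop n (forest ts)) < 0"
  unfolding forest_def by (rule suffix_negative_concat) (auto simp: suffix_negative_pre forest_def[symmetric])

text \<open>Read \<open>k\<close> as the number of trees still to be decoded. A letter
  \<open>v\<close> opens a root with \<open>v + 1\<close> children and changes this number to
  \<open>k - 1 + (v + 1)\<close>; the condition on prefixes says that it does not vanish before the
  end.\<close>

lemma forest_decode: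
  assumes "\<And>v. v \<in> set w \<Longrightarrow> - 1 \<le> v" "sum_list w = - int k"
    "\<And>n. n < length w \<Longrightarrow> - int k < sum_list (take n w)"
  shows "\<exists>ts. length ts = k \<and> w = forest ts"
  using assms
proof (induction w arbitrary: k)
  case Nil
  then show ?case by (intro exI[of _ "[]"]) auto
next
  case (Cons v w)
  have k: "0 < k" using Cons.prems(3)[of 0] by simp
  define j where "j = nat (v + 1)"
  have j: "int j = v + 1" using Cons.prems(1)[of v] by (simp add: j_def)
  have "\<exists>ts. length ts = k - 1 + j \<and> w = forest ts"
  proof (rule Cons.IH)
    show "sum_list w = - int (k - 1 + j)" using Cons.prems(2) j k by simp
    show "- int (k - 1 + j) < sum_list (take n w)" if "n < length w" for n
      using Cons.prems(3)[of "Suc n"] that j k by simp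
  qed (use Cons.prems in auto)
  then obtain ts where ts: "length ts = k - 1 + j" "w = forest ts" by blast
  have "v # w = forest (Node (take j ts) # drop j ts)"
    using ts j by (simp add: pre_children flip: forest_simps(3))
  moreover have "length (Node (take j ts) # drop j ts) = k" using ts k by simp
  ultimately show ?case by blast
qed

text \<open>The first tree can be opened, placing its children in front of the remaining trees; this
  removes one letter and keeps the numbers of trees equal. The arbitrary tails \<open>r\<close> and
  \<open>s\<close> make the codes prefix-free.\<close>

lemma forest_unique:
  "length ts = length us \<Longrightarrow> forest ts @ r = forest us @ s \<Longrightarrow> ts = us \<and> r = s"
proof (induction "fsize ts" arbitrary: ts us rule: less_induct)
  case less
  show ?case
  proof (cases ts)
    case Nil
    then show ?thesis using less.prems by simp
  next
    case (Cons t ts')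
    with less.prems obtain u us' where us: "us = u # us'" by (cases us) auto
    have eq: "length (children t) = length (children u)"
      "forest (children t @ ts') @ r = forest (children u @ us') @ s"
      using less.prems Cons us by (simp_all add: pre_children)
    have "children t @ ts' = children u @ us' \<and> r = s"
      using Cons us less.prems eq by (intro less.hyps) (simp_all add: psize_children)
    then show ?thesis using eq Cons us by (auto simp: ptree.expand)
  qed
qed

lemma pre_unique: "pre t @ r = pre u @ s \<Longrightarrow> t = u"
  using forest_unique[of "[t]" "[u]" r s] by simp

section \<open>Reading a trajectory from right to left\<close>

definition word :: "(int \<Rightarrow> int) \<Rightarrow> int \<Rightarrow> nat \<Rightarrow> int list" where
  "word x a n = map (\<lambda>m. x (a - 1 - int m)) [0..<n]"

text \<open>Reading starts with \<open>x (a - 1)\<close>: the increment just left of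
  \<open>a\<close> is the letter of \<open>a\<close> itself. Patterns consist of sets because the
  letter of a bush root is constrained only from below.\<close>

definition match :: "(int \<Rightarrow> int) \<Rightarrow> int \<Rightarrow> int set list \<Rightarrow> bool" where
  "match x a w \<longleftrightarrow> (\<forall>m<length w. x (a - 1 - int m) \<in> w ! m)"

definition singles :: "int list \<Rightarrow> int set list" where "singles w = map (\<lambda>v. {v}) w"

definition block :: "ptree \<Rightarrow> int set list" where
  "block t = {int (length (children t))..} # singles (forest (children t))"

definition spine :: "(int \<Rightarrow> int) \<Rightarrow> int \<Rightarrow> bool" where
  "spine x a \<longleftrightarrow> (\<forall>n. 0 \<le> sum_list (word x a n))"

lemma length_singles [simp]: "length (singles w) = length w" by (simp add: singles_def)

lemma length_block [simp]: "length (block t) = psize t" by (simp add: block_def psize_children)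

lemma singles_append [simp]: "singles (v @ w) = singles v @ singles w" by (simp add: singles_def)

lemma word_Suc: "word x a (Suc n) = word x a n @ [x (a - 1 - int n)]" by (simp add: word_def)

lemma length_word [simp]: "length (word x a n) = n" by (simp add: word_def)

lemma word_add: "word x a (m + n) = word x a m @ word x (a - int m) n"
proof (induction n)
  case (Suc n)
  have "a - 1 - int (m + n) = a - int m - 1 - int n" by simp
  then show ?case using Suc by (simp only: add_Suc_right word_Suc append_assoc)
qed (simp add: word_def)

lemma match_Nil [simp]: "match x a []" by (simp add: match_def)

lemma match_Cons: "match x a (V # w) \<longleftrightarrow> x (a - 1) \<in> V \<and> match x (a - 1) w"
proof -
  have "match x a (V # w) \<longleftrightarrow> (\<forall>m<Suc (length w). x (a - 1 - int m) \<in> (V # w) ! m)" by (simp add: match_def)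
  also have "\<dots> \<longleftrightarrow> x (a - 1) \<in> V \<and> (\<forall>m<length w. x (a - 1 - int (Suc m)) \<in> w ! m)"
    by (subst All_less_Suc2) simp
  finally show ?thesis by (simp add: match_def diff_diff_eq)
qed

lemma match_append: "match x a (v @ w) \<longleftrightarrow> match x a v \<and> match x (a - int (length v)) w"
  by (induction v arbitrary: a) (simp_all add: match_Cons diff_diff_eq)

lemma match_singles: "match x a (singles w) \<longleftrightarrow> word x a (length w) = w"
proof -
  have "word x a (length w) = w \<longleftrightarrow> (\<forall>m<length w. word x a (length w) ! m = w ! m)"
    by (simp add: list_eq_iff_nth_eq)
  then show ?thesis by (simp add: match_def singles_def word_def)
qed

lemma sum_word: "(\<Sum>l=a - int n..<a. x l) = sum_list (word x a n)"
proof (induction n)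
  case (Suc n)
  have "{a - int (Suc n)..<a} = insert (a - 1 - int n) {a - int n..<a}" by auto
  then show ?case using Suc by (simp add: word_Suc)
qed (simp add: word_def)

lemma not_spine_iff:
  assumes x: "\<And>l. - 1 \<le> x l"
  shows "\<not> spine x a \<longleftrightarrow> (\<exists>t. match x a (singles (pre t)))"
proof
  assume "\<exists>t. match x a (singles (pre t))"
  then obtain t where "word x a (psize t) = pre t" by (auto simp: match_singles)
  then show "\<not> spine x a" unfolding spine_def by (metis sum_pre not_le neg_less_0_iff_less zero_less_one)
next
  assume "\<not> spine x a"
  then have ex: "\<exists>n. sum_list (word x a n) < 0" by (auto simp: spine_def not_le)
  define n where "n = (LEAST n. sum_list (word x a n) < 0)"
  have n: "sum_list (word x a n) < 0" unfolding n_def using ex by (rule LeastI_ex)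
  have least: "0 \<le> sum_list (word x a m)" if "m < n" for m
    using not_less_Least[of m "\<lambda>n. sum_list (word x a n) < 0"] that by (simp add: n_def not_less)
  obtain k where k: "n = Suc k" using n by (cases n) (auto simp: word_def)
  \<comment> \<open>The previous sum is at least zero and a step loses at most one.\<close>
  have s: "sum_list (word x a n) = - 1" using n least[of k] x[of "a - 1 - int k"] by (simp add: k word_Suc)
  have "\<exists>ts. length ts = 1 \<and> word x a n = forest ts"
  proof (rule forest_decode)
    show "- int 1 < sum_list (take m (word x a n))" if "m < length (word x a n)" for m
      using least[of m] that word_add[of x a m "n - m"] by simp
  qed (use x s in \<open>auto simp: word_def\<close>)
  then obtain t where t: "word x a n = pre t" by (auto simp: length_Suc_conv)
  then have "n = psize t" using length_word[of x a n] by simp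
  then show "\<exists>t. match x a (singles (pre t))" using t by (auto simp: match_singles)
qed

text \<open>Of two codes read from the same point one is a prefix of the other, and codes are
  prefix-free. This makes the events of different trees disjoint, so that their probabilities add
  up.\<close>

lemma match_pre_unique:
  assumes "match x a (singles (pre t))" "match x a (singles (pre u))"
  shows "t = u"
proof -
  have *: "t = u" if t: "word x a (psize t) = pre t" and u: "word x a (psize u) = pre u"
    and le: "psize t \<le> psize u" for t u
  proof (rule pre_unique)
    have "word x a (psize u) = word x a (psize t) @ word x (a - int (psize t)) (psize u - psize t)"
      using word_add[of x a "psize t" "psize u - psize t"] by (simp only: le_add_diff_inverse[OF le])
    then show "pre t @ word x (a - int (psize t)) (psize u - psize t) = pre u @ []"
      by (simp only: t u append_Nil2)
  qed
  have w: "word x a (psize t) = pre t" "word x a (psize u) = pre u"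
    using assms by (simp_all only: match_singles length_pre)
  show ?thesis using *[OF w] *[OF w(2,1)] by (cases "psize t \<le> psize u") auto
qed

lemma sum_partial_forest:
  assumes m: "match x a (singles (forest ts))" and "a - int (fsize ts) < j" "j \<le> a"
  shows "(\<Sum>l=a - int (fsize ts)..<j. x l) < 0"
proof -
  define n where "n = nat (a - j)"
  have n: "j = a - int n" "n < fsize ts" using assms(2,3) by (auto simp: n_def)
  have "word x a (n + (fsize ts - n)) = forest ts" using m n by (simp add: match_singles)
  then have "word x j (fsize ts - n) = drop n (forest ts)" unfolding word_add n(1) by (metis append_eq_conv_conj length_word)
  then have "sum_list (word x j (fsize ts - n)) < 0" using suffix_negative_forest[OF n(2)] by simp
  moreover have "a - int (fsize ts) = j - int (fsize ts - n)" using n by simp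
  ultimately show ?thesis by (simp add: sum_word)
qed

text \<open>Going right from the point just left of the forest, the sums stay negative until the
  letter of \<open>y\<close> is added, and then equal \<open>x (y - 1) - length ts\<close>. With
  \<open>ts\<close> an initial part of the list of subtrees of \<open>y\<close>, that point is the
  next child of \<open>y\<close>.\<close>

lemma record_map_forest:
  assumes m: "match x (y - 1) (singles (forest ts))" and ge: "int (length ts) \<le> x (y - 1)"
  shows "record_map x (y - 1 - int (fsize ts)) = y"
proof (rule record_map_eqI)
  show "0 \<le> (\<Sum>l=y - 1 - int (fsize ts)..<y. x l)"
  proof -
    have "word x (y - 1) (fsize ts) = forest ts" using m by (simp add: match_singles)
    moreover have "word x y (1 + fsize ts) = x (y - 1) # word x (y - 1) (fsize ts)"
      unfolding word_add by (simp add: word_def)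
    ultimately have "sum_list (word x y (1 + fsize ts)) = x (y - 1) - int (length ts)" by simp
    moreover have "y - 1 - int (fsize ts) = y - int (1 + fsize ts)" by simp
    ultimately show ?thesis using ge by (simp only: sum_word)
  qed
qed (use sum_partial_forest[OF m] in auto)

section \<open>Vertex addresses, preorder indices and records inside a bush\<close>

primrec sub :: "ptree \<Rightarrow> nat list \<Rightarrow> ptree" where
  "sub t [] = t"
| "sub t (k # u) = children (sub t u) ! k"

definition deg :: "ptree \<Rightarrow> nat list \<Rightarrow> nat" where "deg t u = length (children (sub t u))"

text \<open>The preorder index of the vertex with the (reversed) address \<open>u\<close>.\<close>

primrec pos :: "ptree \<Rightarrow> nat list \<Rightarrow> nat" where
  "pos t [] = 0"
| "pos t (k # u) = pos t u + 1 + fsize (take k (children (sub t u)))"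

text \<open>In a reversed address the step taken at the root stands last. Structural induction on
  trees therefore splits addresses at their end, whereas children are added at the front.\<close>

lemma sub_snoc: "sub (Node ts) (u @ [k]) = sub (ts ! k) u"
  by (induction u) auto

lemma deg_snoc: "deg (Node ts) (u @ [k]) = deg (ts ! k) u"
  by (simp add: deg_def sub_snoc)

lemma pos_snoc: "pos (Node ts) (u @ [k]) = Suc (fsize (take k ts)) + pos (ts ! k) u"
  by (induction u) (auto simp: sub_snoc)

lemma deg_Nil [simp]: "deg (Node ts) [] = length ts" by (simp add: deg_def)

lemma bush_snoc: "u @ [k] \<in> bush_vertices (deg (Node ts)) \<longleftrightarrow> k < length ts \<and> u \<in> bush_vertices (deg (ts ! k))"
  by (induction u) (auto simp: bush_vertices_Cons deg_snoc bush_vertices.root)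

lemma bush_Node: "bush_vertices (deg (Node ts)) = insert [] (\<Union>k<length ts. (\<lambda>u. u @ [k]) ` bush_vertices (deg (ts ! k)))"
proof (rule set_eqI)
  fix u
  show "u \<in> bush_vertices (deg (Node ts)) \<longleftrightarrow> u \<in> insert [] (\<Union>k<length ts. (\<lambda>u. u @ [k]) ` bush_vertices (deg (ts ! k)))"
    by (cases u rule: rev_cases) (auto simp: bush_snoc bush_vertices.root)
qed

lemma finite_bush: "finite (bush_vertices (deg t))"
proof (induction t)
  case (Node ts) then show ?case by (simp add: bush_Node)
qed

lemma fsize_take_Suc: "k < length ts \<Longrightarrow> fsize (take (Suc k) ts) = fsize (take k ts) + psize (ts ! k)"
  by (simp add: take_Suc_conv_app_nth)

lemma fsize_take_mono: "j \<le> k \<Longrightarrow> fsize (take j ts) \<le> fsize (take k ts)"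
  by (metis fsize_simps(3) le_add1 le_add_diff_inverse take_add)

lemma fsize_locate:
  "m < fsize ts \<Longrightarrow> \<exists>k<length ts. fsize (take k ts) \<le> m \<and> m < fsize (take k ts) + psize (ts ! k)"
proof (induction ts arbitrary: m)
  case (Cons t ts)
  show ?case
  proof (cases "m < psize t")
    case False
    then obtain k where "k < length ts" "fsize (take k ts) \<le> m - psize t" "m - psize t < fsize (take k ts) + psize (ts ! k)"
      using Cons.IH[of "m - psize t"] Cons.prems False by force
    then show ?thesis using False by (intro exI[of _ "Suc k"]) auto
  qed (auto intro: exI[of _ 0])
qed simp

text \<open>The root has index 0 and the subtrees occupy consecutive intervals, the one of child
  \<open>k\<close> starting at \<open>Suc (fsize (take k ts))\<close>. Later this exchanges a sum
  over positions of the origin for a sum over vertices.\<close>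

lemma bij_pos: "bij_betw (pos t) (bush_vertices (deg t)) {..<psize t}"
proof (induction t)
  case (Node ts)
  then have IH: "bij_betw (pos (ts ! k)) (bush_vertices (deg (ts ! k))) {..<psize (ts ! k)}" if "k < length ts" for k
    using that by simp
  have upper: "pos (ts ! k) u < psize (ts ! k)" if "k < length ts" "u \<in> bush_vertices (deg (ts ! k))" for k u
    using bij_betwE[OF IH[OF that(1)]] that(2) by auto
  have less: "pos (Node ts) (u @ [k]) < pos (Node ts) (v @ [l])"
    if "k < l" "l < length ts" "u \<in> bush_vertices (deg (ts ! k))" for k l u v
    using upper[of k u] that fsize_take_mono[of "Suc k" l ts] fsize_take_Suc[of k ts] by (simp add: pos_snoc)
  have "inj_on (pos (Node ts)) (bush_vertices (deg (Node ts)))"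
  proof (rule inj_onI)
    fix u v assume uv: "u \<in> bush_vertices (deg (Node ts))" "v \<in> bush_vertices (deg (Node ts))" "pos (Node ts) u = pos (Node ts) v"
    show "u = v"
    proof (cases u rule: rev_cases)
      case Nil then show ?thesis using uv by (cases v rule: rev_cases) (auto simp: pos_snoc)
    next
      case u: (snoc u' k)
      show ?thesis
      proof (cases v rule: rev_cases)
        case Nil then show ?thesis using uv u by (auto simp: pos_snoc)
      next
        case v: (snoc v' l)
        have "k = l" using uv less[of k l u' v'] less[of l k v' u']
          by (cases k l rule: linorder_cases) (auto simp: u v bush_snoc)
        moreover have "pos (ts ! k) u' = pos (ts ! k) v'" using uv \<open>k = l\<close> by (simp add: u v pos_snoc)
        ultimately show ?thesis using uv IH[of k] by (auto simp: u v bush_snoc bij_betw_def dest: inj_onD)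
      qed
    qed
  qed
  moreover have "pos (Node ts) ` bush_vertices (deg (Node ts)) = {..<psize (Node ts)}"
  proof (intro equalityI subsetI)
    fix m assume "m \<in> pos (Node ts) ` bush_vertices (deg (Node ts))"
    then obtain u where u: "u \<in> bush_vertices (deg (Node ts))" "m = pos (Node ts) u" by blast
    show "m \<in> {..<psize (Node ts)}"
    proof (cases u rule: rev_cases)
      case (snoc v k)
      then show ?thesis using u upper[of k v] fsize_take_mono[of "Suc k" "length ts" ts] fsize_take_Suc[of k ts]
        by (auto simp: bush_snoc pos_snoc psize_children)
    qed (use u in simp)
  next
    fix m assume m: "m \<in> {..<psize (Node ts)}"
    show "m \<in> pos (Node ts) ` bush_vertices (deg (Node ts))"
    proof (cases m)
      case 0
      then show ?thesis by (intro image_eqI[of _ _ "[]"]) (auto intro: bush_vertices.root)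
    next
      case (Suc n)
      then have "n < fsize ts" using m by (simp add: psize_children)
      then obtain k where k: "k < length ts" "fsize (take k ts) \<le> n" "n < fsize (take k ts) + psize (ts ! k)"
        using fsize_locate by blast
      then have "n - fsize (take k ts) \<in> pos (ts ! k) ` bush_vertices (deg (ts ! k))"
        using IH[OF k(1)] by (auto simp: bij_betw_def)
      then obtain u where "u \<in> bush_vertices (deg (ts ! k))" "n - fsize (take k ts) = pos (ts ! k) u" by blast
      then show ?thesis using k Suc by (intro image_eqI[of _ _ "u @ [k]"]) (auto simp: pos_snoc bush_snoc)
    qed
  qed
  ultimately show ?case by (simp add: bij_betw_def)
qed

text \<open>Equal degrees at the root, and recursively below it, leave no room for further vertices
  in \<open>u\<close>. This is what makes the events \<open>tree_event\<close> disjoint.\<close>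

lemma deg_determines:
  "(\<And>v. v \<in> bush_vertices (deg t) \<Longrightarrow> deg t v = deg u v) \<Longrightarrow> t = u"
proof (induction t arbitrary: u)
  case (Node ts)
  obtain us where u: "u = Node us" by (cases u)
  have l: "length ts = length us" using Node.prems[of "[]"] by (simp add: u bush_vertices.root)
  have "ts ! k = us ! k" if "k < length ts" for k
  proof (rule Node.IH)
    show "deg (ts ! k) v = deg (us ! k) v" if "v \<in> bush_vertices (deg (ts ! k))" for v
      using Node.prems[of "v @ [k]"] that \<open>k < length ts\<close> by (simp add: u bush_snoc deg_snoc)
  qed (use that in simp)
  then show ?case using l by (auto simp: u intro: nth_equalityI)
qed

lemma match_forest_nth:
  assumes "match x b (singles (forest ts))" "k < length ts"
  shows "match x b (singles (forest (take k ts)))"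
    "match x (b - int (fsize (take k ts))) (singles (pre (ts ! k)))"
proof -
  have "forest ts = forest (take k ts) @ pre (ts ! k) @ forest (drop (Suc k) ts)"
    by (subst id_take_nth_drop[OF assms(2)]) simp
  then have "match x b (singles (forest (take k ts) @ pre (ts ! k) @ forest (drop (Suc k) ts)))"
    using assms(1) by (simp only:)
  then show "match x b (singles (forest (take k ts)))"
    "match x (b - int (fsize (take k ts))) (singles (pre (ts ! k)))"
    by (simp_all add: match_append)
qed

text \<open>Descending to a child skips the codes of its elder siblings and then reads one letter.
  The root is exempt from the exact value because a block only bounds its letter from below.\<close>

lemma match_descendant:
  assumes "match x (a - 1) (singles (forest (children t)))" "u \<in> bush_vertices (deg t)"
  shows "match x (a - 1 - int (pos t u)) (singles (forest (children (sub t u)))) \<and>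
    (u \<noteq> [] \<longrightarrow> x (a - 1 - int (pos t u)) = int (deg t u) - 1)"
  using assms(2)
proof induction
  case (child u k)
  let ?s = "sub t u" and ?b = "a - 1 - int (pos t u)"
  have "match x (?b - int (fsize (take k (children ?s)))) (singles (pre (children ?s ! k)))"
    using child by (intro match_forest_nth) (auto simp: deg_def)
  moreover have "?b - int (fsize (take k (children ?s))) = a - int (pos t (k # u))" by simp
  ultimately have "match x (a - int (pos t (k # u))) (singles (pre (sub t (k # u))))" by (simp only: sub.simps)
  then show ?case
    unfolding pre_children by (simp add: singles_def match_Cons deg_def diff_diff_eq add.commute)
qed (use assms in simp)

text \<open>Between a vertex and its child number \<open>k\<close> lie exactly the subtrees of the
  \<open>k\<close> elder siblings, so \<open>record_map_forest\<close> applies to these; as the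
  child exists, the letter of the parent is at least \<open>k\<close>.\<close>

lemma record_map_child:
  assumes m: "match x a (block t)" and u: "k # u \<in> bush_vertices (deg t)"
  shows "record_map x (a - int (pos t (k # u))) = a - int (pos t u)"
proof -
  have u': "u \<in> bush_vertices (deg t)" "k < deg t u" using u by (auto simp: bush_vertices_Cons)
  have root: "match x (a - 1) (singles (forest (children t)))" "int (length (children t)) \<le> x (a - 1)"
    using m by (simp_all add: block_def match_Cons)
  let ?y = "a - int (pos t u)" and ?ts = "take k (children (sub t u))"
  have eq: "a - 1 - int (pos t u) = ?y - 1" by simp
  note d = match_descendant[OF root(1) u'(1), unfolded eq]
  have "record_map x (?y - 1 - int (fsize ?ts)) = ?y"
  proof (rule record_map_forest)
    show "match x (?y - 1) (singles (forest ?ts))"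
      using d u' by (intro match_forest_nth) (auto simp: deg_def)
    show "int (length ?ts) \<le> x (?y - 1)"
      using d u' root(2) by (cases "u = []") (auto simp: deg_def)
  qed
  moreover have "?y - 1 - int (fsize ?ts) = a - int (pos t (k # u))" by simp
  ultimately show ?thesis by (simp only:)
qed

text \<open>The case of all root subtrees: the point left of the whole block is one more child of
  \<open>a\<close>, which is how records link consecutive spine points.\<close>

lemma record_map_root:
  assumes "match x a (block t)"
  shows "record_map x (a - int (psize t)) = a"
proof -
  have "record_map x (a - 1 - int (fsize (children t))) = a"
    using assms by (intro record_map_forest) (simp_all add: block_def match_Cons)
  then show ?thesis by (simp add: psize_children diff_diff_eq)
qed

lemma sum_partial_block:
  assumes "match x a (block t)" "a - int (psize t) < j" "j < a"
  shows "(\<Sum>l=a - int (psize t)..<j. x l) < 0"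
proof -
  have "(\<Sum>l=a - 1 - int (fsize (children t))..<j. x l) < 0"
    using assms by (intro sum_partial_forest) (auto simp: block_def match_Cons psize_children)
  then show ?thesis by (simp add: psize_children diff_diff_eq)
qed

lemma sum_block:
  assumes "match x a (block t)"
  shows "0 \<le> sum_list (word x a (psize t))"
proof -
  have "word x a (psize t) = x (a - 1) # word x (a - 1) (fsize (children t))"
    unfolding psize_children using word_add[of x a 1] by (simp add: word_def)
  then show ?thesis using assms by (simp add: block_def match_Cons match_singles)
qed

lemma spine_sum: "spine x a \<longleftrightarrow> (\<forall>j\<le>a. 0 \<le> (\<Sum>l=j..<a. x l))"
proof
  assume s: "spine x a"
  show "\<forall>j\<le>a. 0 \<le> (\<Sum>l=j..<a. x l)"
  proof (intro allI impI)
    fix j assume "j \<le> a"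
    then have "j = a - int (nat (a - j))" by simp
    then show "0 \<le> (\<Sum>l=j..<a. x l)" using s sum_word[of x a "nat (a - j)"] by (simp add: spine_def)
  qed
qed (auto simp: spine_def simp flip: sum_word)

lemma sum_split:
  fixes x :: "int \<Rightarrow> int"
  assumes "i \<le> j" "j \<le> k" shows "(\<Sum>l=i..<k. x l) = (\<Sum>l=i..<j. x l) + (\<Sum>l=j..<k. x l)"
proof -
  have "{i..<k} = {i..<j} \<union> {j..<k}" using assms by auto
  then show ?thesis by (simp add: sum.union_disjoint)
qed

text \<open>A backward sum that ends inside the block omits a left part of it with negative sum, so
  it exceeds the sum of the block; one that reaches further adds a sum that the spine property at
  the left end keeps nonnegative. Hence a window asks for the spine property at its leftmost point
  alone.\<close>

lemma spine_block:
  assumes m: "match x a (block t)" and s: "spine x (a - int (psize t))"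
  shows "spine x a"
  unfolding spine_sum
proof (intro allI impI)
  let ?s = "a - int (psize t)"
  fix j assume "j \<le> a"
  have b: "0 \<le> (\<Sum>l=?s..<a. x l)" using sum_block[OF m] by (simp add: sum_word)
  consider "j \<le> ?s" | "?s < j" "j < a" | "j = a" using \<open>j \<le> a\<close> by linarith
  then show "0 \<le> (\<Sum>l=j..<a. x l)"
  proof cases
    case 1
    then show ?thesis using b s sum_split[of j ?s a x] by (simp add: spine_sum)
  next
    case 2
    then show ?thesis using b sum_partial_block[OF m 2] sum_split[of ?s j a x] by simp
  qed simp
qed

lemma not_spine_inside_block:
  assumes "match x a (block t)" "a - int (psize t) < j" "j < a"
  shows "\<not> spine x j"
  using sum_partial_block[OF assms] assms(2) unfolding spine_sum by (metis less_imp_le not_le)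

text \<open>Equal size is essential: dropping the last root subtrees gives a smaller block that
  matches as well, because the root letter is bounded only from below. In a window the sizes are
  fixed by the spine points.\<close>

lemma block_unique:
  assumes m: "match x a (block t)" "match x a (block u)" and size: "psize t = psize u"
  shows "t = u"
proof -
  have f: "fsize (children t) = fsize (children u)" using size by (simp add: psize_children)
  have "word x (a - 1) (fsize (children t)) = forest (children t)"
    "word x (a - 1) (fsize (children u)) = forest (children u)"
    using m by (simp_all add: block_def match_Cons match_singles)
  then have "forest (children t) = forest (children u)" by (simp only: f)
  moreover from this have "length (children t) = length (children u)"
    by (metis sum_forest neg_equal_iff_equal of_nat_eq_iff)
  ultimately have "children t = children u" using forest_unique[of "children t" "children u" "[]" "[]"] by simp
  then show ?thesis by (simp add: ptree.expand)
qed

text \<open>\<open>\<sigma> i\<close> is the spine point at the right end of bush \<open>i\<close>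
  and \<open>\<tau> i\<close> the shape of that bush; the inequalities number the bushes so that the
  origin lies in bush 0. There are \<open>2 * m + 1\<close> bushes but one more spine point, at
  index \<open>- m - 1\<close>.\<close>

definition window :: "(int \<Rightarrow> int) \<Rightarrow> nat \<Rightarrow> (int \<Rightarrow> int) \<Rightarrow> (int \<Rightarrow> ptree) \<Rightarrow> bool" where
  "window x m \<sigma> \<tau> \<longleftrightarrow> spine x (\<sigma> (- int m - 1)) \<and> \<sigma> (- 1) < 0 \<and> 0 \<le> \<sigma> 0 \<and>
     (\<forall>i\<in>{- int m..int m}. \<sigma> (i - 1) = \<sigma> i - int (psize (\<tau> i)) \<and> match x (\<sigma> i) (block (\<tau> i)))"

lemma window_spine:
  assumes w: "window x m \<sigma> \<tau>" and "i \<in> {- int m - 1..int m}"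
  shows "spine x (\<sigma> i)"
proof -
  have "n \<le> 2 * m + 1 \<longrightarrow> spine x (\<sigma> (- int m - 1 + int n))" for n
  proof (induction n)
    case 0
    have "spine x (\<sigma> (- int m - 1))" using w unfolding window_def by blast
    then show ?case by (simp only: of_nat_0 add_0_right simp_thms)
  next
    case (Suc n)
    show ?case
    proof
      assume n: "Suc n \<le> 2 * m + 1"
      let ?i = "- int m - 1 + int (Suc n)"
      have i: "?i \<in> {- int m..int m}" "?i - 1 = - int m - 1 + int n" using n by auto
      have "\<sigma> (?i - 1) = \<sigma> ?i - int (psize (\<tau> ?i))" and m: "match x (\<sigma> ?i) (block (\<tau> ?i))"
        using w i(1) unfolding window_def by blast+
      moreover have "spine x (\<sigma> (- int m - 1 + int n))" using Suc n by linarith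
      ultimately have "spine x (\<sigma> ?i - int (psize (\<tau> ?i)))" by (simp only: i(2))
      then show "spine x (\<sigma> ?i)" by (rule spine_block[OF m])
    qed
  qed
  from this[of "nat (i + int m + 1)"] have "spine x (\<sigma> (- int m - 1 + int (nat (i + int m + 1))))"
    using assms(2) by (elim mp) auto
  moreover have "- int m - 1 + int (nat (i + int m + 1)) = i" using assms(2) by simp
  ultimately show ?thesis by (simp only:)
qed

text \<open>The \<open>\<sigma> i\<close> are spine points with no spine points in between, so they
  enumerate the spine consecutively; the sign condition makes \<open>\<sigma> 0\<close> the first
  one at or right of the origin.\<close>

lemma window_unique:
  assumes w: "window x m \<sigma> \<tau>" and w': "window x m \<sigma>' \<tau>'"
  shows "(\<forall>i\<in>{- int m - 1..int m}. \<sigma> i = \<sigma>' i) \<and> (\<forall>i\<in>{- int m..int m}. \<tau> i = \<tau>' i)"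
proof -
  note step = w[unfolded window_def] w'[unfolded window_def]
  have gap: "\<not> spine x j" if "window x m \<sigma> \<tau>" "i \<in> {- int m..int m}" "\<sigma> (i - 1) < j" "j < \<sigma> i" for \<sigma> \<tau> i j
    using that not_spine_inside_block[of x "\<sigma> i" "\<tau> i" j] unfolding window_def by auto
  have zero: "\<sigma> 0 \<le> \<sigma>' 0" if "window x m \<sigma> \<tau>" "window x m \<sigma>' \<tau>'" for \<sigma> \<tau> \<sigma>' \<tau>'
    using gap[OF that(1), of 0 "\<sigma>' 0"] window_spine[OF that(2), of 0] that unfolding window_def by force
  have up: "\<sigma> (i + 1) \<le> \<sigma>' (i + 1)"
    if "window x m \<sigma> \<tau>" "window x m \<sigma>' \<tau>'" "\<sigma> i = \<sigma>' i" "i + 1 \<in> {- int m..int m}" for \<sigma> \<tau> \<sigma>' \<tau>' i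
  proof (rule ccontr)
    assume "\<not> \<sigma> (i + 1) \<le> \<sigma>' (i + 1)"
    moreover have "\<sigma>' (i + 1 - 1) < \<sigma>' (i + 1)" using that(2,4) unfolding window_def by (metis diff_less_eq less_add_same_cancel1 of_nat_0_less_iff psize_pos)
    ultimately show False
      using gap[OF that(1,4), of "\<sigma>' (i + 1)"] window_spine[OF that(2), of "i + 1"] that(3,4) by auto
  qed
  have down: "\<sigma> (i - 1) \<le> \<sigma>' (i - 1)"
    if "window x m \<sigma> \<tau>" "window x m \<sigma>' \<tau>'" "\<sigma> i = \<sigma>' i" "i \<in> {- int m..int m}" for \<sigma> \<tau> \<sigma>' \<tau>' i
  proof (rule ccontr)
    assume "\<not> \<sigma> (i - 1) \<le> \<sigma>' (i - 1)"
    moreover have "\<sigma> (i - 1) < \<sigma> i" using that(1,4) unfolding window_def by (metis diff_less_eq less_add_same_cancel1 of_nat_0_less_iff psize_pos)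
    ultimately show False
      using gap[OF that(2,4), of "\<sigma> (i - 1)"] window_spine[OF that(1), of "i - 1"] that(3,4) by auto
  qed
  have s0: "\<sigma> 0 = \<sigma>' 0" using zero[OF w w'] zero[OF w' w] by simp
  have pos: "n \<le> m \<longrightarrow> \<sigma> (int n) = \<sigma>' (int n)" for n
  proof (induction n)
    case (Suc n)
    show ?case
    proof
      assume "Suc n \<le> m"
      then have "\<sigma> (int n) = \<sigma>' (int n)" "int n + 1 \<in> {- int m..int m}" using Suc by auto
      then have "\<sigma> (int n + 1) = \<sigma>' (int n + 1)"
        using up[OF w w', of "int n"] up[OF w' w, of "int n"] by simp
      then show "\<sigma> (int (Suc n)) = \<sigma>' (int (Suc n))" by (simp add: add.commute)
    qed
  qed (use s0 in simp)
  have neg: "n \<le> Suc m \<longrightarrow> \<sigma> (- int n) = \<sigma>' (- int n)" for n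
  proof (induction n)
    case (Suc n)
    show ?case
    proof
      assume "Suc n \<le> Suc m"
      then have "\<sigma> (- int n) = \<sigma>' (- int n)" "- int n \<in> {- int m..int m}" using Suc by auto
      then have "\<sigma> (- int n - 1) = \<sigma>' (- int n - 1)"
        using down[OF w w', of "- int n"] down[OF w' w, of "- int n"] by simp
      moreover have "- int (Suc n) = - int n - 1" by simp
      ultimately show "\<sigma> (- int (Suc n)) = \<sigma>' (- int (Suc n))" by (simp only:)
    qed
  qed (use s0 in simp)
  have eq: "\<sigma> i = \<sigma>' i" if "i \<in> {- int m - 1..int m}" for i
    using pos[of "nat i"] neg[of "nat (- i)"] that by (cases "0 \<le> i") auto
  moreover have "\<tau> i = \<tau>' i" if i: "i \<in> {- int m..int m}" for i
  proof (rule block_unique)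
    show "match x (\<sigma> i) (block (\<tau> i))" using w i by (simp add: window_def)
    show "match x (\<sigma> i) (block (\<tau>' i))" using w' i eq[of i] by (simp add: window_def)
    have "\<sigma> (i - 1) = \<sigma> i - int (psize (\<tau> i))" "\<sigma>' (i - 1) = \<sigma>' i - int (psize (\<tau>' i))"
      using w w' i by (simp_all add: window_def)
    then show "psize (\<tau> i) = psize (\<tau>' i)" using eq[of i] eq[of "i - 1"] i by simp
  qed
  ultimately show ?thesis by blast
qed

lemma window_mono:
  assumes w: "window x n \<sigma> \<tau>" and "m \<le> n"
  shows "window x m \<sigma> \<tau>"
proof -
  have "spine x (\<sigma> (- int m - 1))" using assms by (intro window_spine[OF w]) auto
  then show ?thesis using assms by (auto simp: window_def)
qed

lemma window_cong:
  assumes "window x m \<sigma> \<tau>" "\<And>i. i \<in> {- int m - 1..int m} \<Longrightarrow> \<sigma>' i = \<sigma> i"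
    "\<And>i. i \<in> {- int m..int m} \<Longrightarrow> \<tau>' i = \<tau> i"
  shows "window x m \<sigma>' \<tau>'"
  using assms unfolding window_def by auto

lemma window_limit:
  assumes "\<And>m. \<exists>\<sigma> \<tau>. window x m \<sigma> \<tau>"
  shows "\<exists>\<sigma> \<tau>. \<forall>m. window x m \<sigma> \<tau>"
proof -
  obtain \<Sigma> \<T> where w: "\<And>m. window x m (\<Sigma> m) (\<T> m)" using assms by metis
  \<comment> \<open>Uniqueness makes the chosen windows consistent, so each index may be read off
    the window whose radius is its absolute value.\<close>
  define \<sigma> where "\<sigma> i = \<Sigma> (nat \<bar>i\<bar>) i" for i
  define \<tau> where "\<tau> i = \<T> (nat \<bar>i\<bar>) i" for i
  have "window x m \<sigma> \<tau>" for m
  proof (rule window_mono[OF window_cong])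
    \<comment> \<open>Comparison is made with level \<open>Suc m\<close> because the window of level
      \<open>m\<close> also uses the index \<open>- m - 1\<close>.\<close>
    have *: "\<sigma> i = \<Sigma> (Suc m) i \<and> \<tau> i = \<T> (Suc m) i" if "\<bar>i\<bar> \<le> int (Suc m)" for i
    proof -
      have "nat \<bar>i\<bar> \<le> Suc m" "i \<in> {- int (nat \<bar>i\<bar>) - 1..int (nat \<bar>i\<bar>)}" "i \<in> {- int (nat \<bar>i\<bar>)..int (nat \<bar>i\<bar>)}"
        using that by auto
      then show ?thesis
        using window_unique[OF w[of "nat \<bar>i\<bar>"] window_mono[OF w[of "Suc m"]]] unfolding \<sigma>_def \<tau>_def by blast
    qed
    show "window x m (\<Sigma> (Suc m)) (\<T> (Suc m))" by (rule window_mono[OF w]) simp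
    show "\<sigma> i = \<Sigma> (Suc m) i" if "i \<in> {- int m - 1..int m}" for i using * that by auto
    show "\<tau> i = \<T> (Suc m) i" if "i \<in> {- int m..int m}" for i using * that by auto
  qed simp
  then show ?thesis by blast
qed

text \<open>The intervals from \<open>\<sigma> (i - 1)\<close> (excluded) to
  \<open>\<sigma> i\<close> partition the integers, and preorder fills each of them from right to
  left, so every integer is numbered once. Each vertex has its parent at its record; since the
  joined bushes are connected, the component of 0 consists of all integers.\<close>

lemma record_component_isomorphic:
  assumes step: "\<And>i. \<sigma> (i - 1) = \<sigma> i - int (psize (\<tau> i))"
    and m: "\<And>i. match x (\<sigma> i) (block (\<tau> i))"
    and u: "u \<in> bush_vertices (deg (\<tau> 0))" "\<sigma> 0 = int (pos (\<tau> 0) u)"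
  shows "rooted_isomorphic (joined_bushes (\<lambda>i. deg (\<tau> i)) (0, u)) (record_component x 0)"
proof -
  let ?J = "joined_bushes (\<lambda>i. deg (\<tau> i)) (0, u)" and ?R = "record_component x 0"
  define f where "f = (\<lambda>(i, v). \<sigma> i - int (pos (\<tau> i) v))"
  have incr: "\<sigma> (i - 1) < \<sigma> i" for i using step[of i] by simp
  have mono: "\<sigma> i + int n \<le> \<sigma> (i + int n)" for i n
  proof (induction n)
    case (Suc n)
    have "i + int (Suc n) - 1 = i + int n" by simp
    then show ?case using Suc incr[of "i + int (Suc n)"] by simp
  qed simp
  have less: "\<sigma> i < \<sigma> j" if "i < j" for i j
    using mono[of i "nat (j - i)"] that by simp
  have range: "\<sigma> (i - 1) < f (i, v) \<and> f (i, v) \<le> \<sigma> i" if "v \<in> bush_vertices (deg (\<tau> i))" for i v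
    using bij_betwE[OF bij_pos, of "\<tau> i"] that step[of i] by (auto simp: f_def)
  have index: "i = j" if "\<sigma> (i - 1) < z" "z \<le> \<sigma> i" "\<sigma> (j - 1) < z" "z \<le> \<sigma> j" for i j z
  proof (rule ccontr)
    assume "i \<noteq> j"
    then consider "i \<le> j - 1" | "j \<le> i - 1" by linarith
    then show False
    proof cases
      case 1 then have "\<sigma> i \<le> \<sigma> (j - 1)" using less[of i "j - 1"] by (cases "i = j - 1") auto
      then show False using that by simp
    next
      case 2 then have "\<sigma> j \<le> \<sigma> (i - 1)" using less[of j "i - 1"] by (cases "j = i - 1") auto
      then show False using that by simp
    qed
  qed
  have inj: "inj_on f (vertices ?J)"
  proof (rule inj_onI)
    fix p q assume pq: "p \<in> vertices ?J" "q \<in> vertices ?J" "f p = f q"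
    obtain i v j w where ij: "p = (i, v)" "q = (j, w)" by (cases p, cases q)
    then have "i = j" using index[of i "f p" j] range[of v i] range[of w j] pq by simp
    moreover from this have "pos (\<tau> i) v = pos (\<tau> i) w" using pq ij by (simp add: f_def)
    ultimately show "p = q" using pq ij bij_betw_imp_inj_on[OF bij_pos, of "\<tau> i"] by (auto dest: inj_onD)
  qed
  have surj: "\<exists>p\<in>vertices ?J. f p = z" for z
  proof -
    \<comment> \<open>\<open>\<sigma>\<close> grows by at least one per index, so moving back this
      many indices leads below \<open>z\<close>; the bush containing \<open>z\<close> is then found
      by a least-index search.\<close>
    define n0 where "n0 = nat (\<sigma> 0 - z) + 1"
    define i0 where "i0 = - int n0"
    have "\<sigma> i0 + int n0 \<le> \<sigma> 0" using mono[of i0 n0] by (simp add: i0_def)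
    moreover have "\<sigma> 0 - z < int n0" unfolding n0_def by linarith
    ultimately have "\<sigma> i0 < z" by linarith
    define n where "n = (LEAST n. z \<le> \<sigma> (i0 + int n))"
    have "z \<le> \<sigma> (i0 + int (nat (z - \<sigma> i0)))" using mono[of i0 "nat (z - \<sigma> i0)"] \<open>\<sigma> i0 < z\<close> by simp
    then have n: "z \<le> \<sigma> (i0 + int n)" unfolding n_def by (rule LeastI)
    then obtain k where k: "n = Suc k" using \<open>\<sigma> i0 < z\<close> by (cases n) auto
    then have "\<sigma> (i0 + int k) < z" using not_less_Least[of k "\<lambda>n. z \<le> \<sigma> (i0 + int n)"] by (simp add: n_def)
    define i where "i = i0 + int n"
    have i: "z \<le> \<sigma> i" "\<sigma> (i - 1) < z" using n \<open>\<sigma> (i0 + int k) < z\<close> k by (simp_all add: i_def)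
    then have "nat (\<sigma> i - z) \<in> pos (\<tau> i) ` bush_vertices (deg (\<tau> i))"
      using bij_betw_imp_surj_on[OF bij_pos, of "\<tau> i"] step[of i] by auto
    then obtain v where "v \<in> bush_vertices (deg (\<tau> i))" "nat (\<sigma> i - z) = pos (\<tau> i) v" by blast
    then show ?thesis using i by (intro bexI[of _ "(i, v)"]) (auto simp: f_def)
  qed
  have parent: "record_map x (f p) = f q" if "(p, q) \<in> edges ?J" for p q
  proof -
    from that consider i k w where "p = (i, k # w)" "q = (i, w)" "k # w \<in> bush_vertices (deg (\<tau> i))"
      | i where "p = (i, [])" "q = (i + 1, [])" by (auto simp: edges_joined_bushes)
    then show ?thesis
    proof cases
      case 1
      then show ?thesis using record_map_child[OF m 1(3)] by (simp add: f_def)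
    next
      case 2
      then show ?thesis using record_map_root[OF m, of "i + 1"] step[of "i + 1"] by (simp add: f_def)
    qed
  qed
  have J: "family_tree ?J" by (rule family_tree_joined_bushes) (rule u(1))
  then have J_edges: "edges ?J \<subseteq> vertices ?J \<times> vertices ?J" by (simp add: family_tree_def)
  have edge: "(f p, f q) \<in> record_edges x" if "(p, q) \<in> edges ?J" for p q
  proof -
    have "p \<noteq> q" using that J by (auto simp: family_tree_def dest: asymD)
    then have "f p \<noteq> f q" using inj_onD[OF inj, of p q] that J_edges by blast
    then show ?thesis using parent[OF that] by (auto simp: record_edges_def intro!: exI[of _ "f p"])
  qed
  have path: "(f p, f q) \<in> (record_edges x \<union> (record_edges x)\<inverse>)\<^sup>*" if "(p, q) \<in> (adjacency ?J)\<^sup>*" for p q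
    using that
  proof induction
    case (step q r)
    then have "(f q, f r) \<in> record_edges x \<union> (record_edges x)\<inverse>" using edge[of q r] edge[of r q] unfolding adjacency_def by blast
    with step.IH show ?case by (rule rtrancl_into_rtrancl)
  qed simp
  have root: "f (0, u) = 0" using u(2) by (simp add: f_def)
  have V: "vertices ?R = UNIV"
  proof -
    have "z \<in> vertices ?R" for z
    proof -
      obtain p where p: "p \<in> vertices ?J" "f p = z" using surj by blast
      have "((0, u), p) \<in> (adjacency ?J)\<^sup>*"
      proof -
        have "(0, u) \<in> vertices ?J" using u(1) by simp
        then show ?thesis using J p(1) unfolding family_tree_def by blast
      qed
      from path[OF this] show ?thesis using p root by (simp add: record_component_simps(1))
    qed
    then show ?thesis by blast
  qed
  show ?thesis
  proof (rule rooted_isomorphicI)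
    show "bij_betw f (vertices ?J) (vertices ?R)"
    proof -
      have "f ` vertices ?J = UNIV"
      proof (intro equalityI subsetI)
        fix z show "z \<in> f ` vertices ?J" using surj[of z] by (auto simp del: joined_bushes_simps)
      qed simp
      then show ?thesis using inj V by (simp add: bij_betw_def del: joined_bushes_simps)
    qed
    show "f (origin ?J) = origin ?R" using root by (simp add: record_component_simps(3))
    show "(p, q) \<in> edges ?J \<longleftrightarrow> (f p, f q) \<in> edges ?R" if pq: "p \<in> vertices ?J" "q \<in> vertices ?J" for p q
    proof
      assume "(p, q) \<in> edges ?J"
      then show "(f p, f q) \<in> edges ?R" using edge by (simp add: record_component_simps(2) V)
    next
      assume "(f p, f q) \<in> edges ?R"
      then have "record_map x (f p) = f q" by (auto simp: record_component_simps(2) record_edges_def)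
      \<comment> \<open>Every vertex of the joined bushes has an outgoing edge, and its image is the
        only record edge that leaves the image point; so every record edge comes from the
        bushes.\<close>
      moreover have "\<exists>r. (p, r) \<in> edges ?J"
      proof (cases "snd p")
        case Nil
        then show ?thesis by (cases p) (auto simp: edges_joined_bushes)
      next
        case (Cons k w)
        then show ?thesis using pq(1) by (cases p) (auto simp: edges_joined_bushes)
      qed
      then obtain r where r: "(p, r) \<in> edges ?J" ..
      ultimately have "f q = f r" using parent by simp
      then have "q = r" using inj_onD[OF inj, of q r] r pq J_edges by blast
      then show "(p, q) \<in> edges ?J" using r by simp
    qed
  qed
qed

text \<open>The trees of a window are listed from right to left, the tree containing the origin being in the
  middle; \<open>a\<close> is the distance from the origin to the next spine vertex on its right.\<close>

definition list_event :: "(int \<Rightarrow> int) \<Rightarrow> nat \<Rightarrow> nat \<Rightarrow> ptree list \<Rightarrow> bool" where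
  "list_event x m a ts \<longleftrightarrow> length ts = 2 * m + 1 \<and> a < psize (ts ! m) \<and>
     match x (int a + int (fsize (take m ts))) (concat (map block ts)) \<and>
     spine x (int a + int (fsize (take m ts)) - int (fsize ts))"

lemma length_concat_block [simp]: "length (concat (map block ts)) = fsize ts"
  by (induction ts) auto

lemma match_blocks:
  "match x e (concat (map block ts)) \<longleftrightarrow> (\<forall>j<length ts. match x (e - int (fsize (take j ts))) (block (ts ! j)))"
proof (induction ts arbitrary: e)
  case (Cons t ts)
  show ?case by (simp add: match_append Cons All_less_Suc2 diff_diff_eq)
qed simp

text \<open>List position \<open>j\<close> carries the spine index \<open>m - j\<close>, and the
  spine points are obtained by subtracting partial sums of sizes from the right end.\<close>

lemma list_event_window:
  assumes "list_event x m a ts"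
  shows "window x m (\<lambda>i. int a + int (fsize (take m ts)) - int (fsize (take (nat (int m - i)) ts)))
    (\<lambda>i. ts ! nat (int m - i))"
proof -
  have l: "length ts = 2 * m + 1" and a: "a < psize (ts ! m)"
    using assms by (simp_all add: list_event_def)
  have m: "match x (int a + int (fsize (take m ts)) - int (fsize (take j ts))) (block (ts ! j))" if "j < 2 * m + 1" for j
    using assms that by (simp_all add: list_event_def match_blocks)
  have "nat (int m - (- int m - 1)) = length ts" using l by simp
  then have spine: "spine x (int a + int (fsize (take m ts)) - int (fsize (take (nat (int m - (- int m - 1))) ts)))"
    using assms by (simp only: list_event_def take_all order_refl)
  have step: "int (fsize (take (nat (int m - (i - 1))) ts)) = int (fsize (take (nat (int m - i)) ts)) + int (psize (ts ! nat (int m - i)))"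
    if "i \<in> {- int m..int m}" for i
  proof -
    have "nat (int m - (i - 1)) = Suc (nat (int m - i))" "nat (int m - i) < length ts" using that l by auto
    then show ?thesis by (simp only: fsize_take_Suc of_nat_add)
  qed
  show ?thesis
    unfolding window_def
  proof (intro conjI ballI)
    show "int a + int (fsize (take m ts)) - int (fsize (take (nat (int m - - 1)) ts)) < 0"
      using step[of 0] a by simp
    fix i assume i: "i \<in> {- int m..int m}"
    show "int a + int (fsize (take m ts)) - int (fsize (take (nat (int m - (i - 1))) ts)) =
       int a + int (fsize (take m ts)) - int (fsize (take (nat (int m - i)) ts)) - int (psize (ts ! nat (int m - i)))"
      using step[OF i] by simp
    show "match x (int a + int (fsize (take m ts)) - int (fsize (take (nat (int m - i)) ts))) (block (ts ! nat (int m - i)))"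
      using i by (intro m) auto
  qed (use spine in simp_all)
qed

lemma list_event_unique:
  assumes e: "list_event x m a ts" and e': "list_event x m a' ts'"
  shows "a = a' \<and> ts = ts'"
proof -
  note u = window_unique[OF list_event_window[OF e] list_event_window[OF e']]
  have "a = a'" using u by (auto dest!: bspec[of _ _ 0])
  moreover have "ts = ts'"
  proof (rule nth_equalityI)
    show "length ts = length ts'" using e e' by (simp add: list_event_def)
    fix j assume "j < length ts"
    then have "int m - int j \<in> {- int m..int m}" using e by (auto simp: list_event_def)
    then show "ts ! j = ts' ! j" using u by (auto dest!: bspec[of _ _ "int m - int j"])
  qed
  ultimately show ?thesis ..
qed

text \<open>Windows of all sizes supply the infinite sequence of bushes; the single event given at
  level \<open>m\<close> determines its middle part and the root, which is all that an event of
  radius \<open>m\<close> can see.\<close>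

lemma record_component_list_event:
  assumes all: "\<And>m. \<exists>a ts. list_event x m a ts" and e: "list_event x m a ts"
  shows "\<exists>\<tau> u. (\<forall>i. \<bar>i\<bar> \<le> int m \<longrightarrow> \<tau> i = ts ! nat (int m - i)) \<and> u \<in> bush_vertices (deg (ts ! m)) \<and>
    pos (ts ! m) u = a \<and> rooted_isomorphic (joined_bushes (\<lambda>i. deg (\<tau> i)) (0, u)) (record_component x 0)"
proof -
  have "\<exists>\<sigma> \<tau>. window x m \<sigma> \<tau>" for m using all[of m] list_event_window by blast
  then obtain \<sigma> \<tau> where w: "\<And>m. window x m \<sigma> \<tau>" using window_limit by blast
  note u = window_unique[OF w[of m] list_event_window[OF e]]
  have \<tau>: "\<tau> i = ts ! nat (int m - i)" if "\<bar>i\<bar> \<le> int m" for i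
  proof -
    have "i \<in> {- int m..int m}" using that by auto
    then show ?thesis using u by blast
  qed
  have "0 \<in> {- int m - 1..int m}" by simp
  then have "\<sigma> 0 = int a" using u by (auto dest!: bspec[of _ _ 0])
  have "\<tau> 0 = ts ! m" using \<tau>[of 0] by simp
  have "a < psize (ts ! m)" using e by (simp add: list_event_def)
  then obtain v where v: "v \<in> bush_vertices (deg (ts ! m))" "pos (ts ! m) v = a"
    using bij_betw_imp_surj_on[OF bij_pos, of "ts ! m"] by (metis imageE lessThan_iff)
  have "\<sigma> (i - 1) = \<sigma> i - int (psize (\<tau> i))" "match x (\<sigma> i) (block (\<tau> i))" for i
  proof -
    have "i \<in> {- int (nat \<bar>i\<bar>)..int (nat \<bar>i\<bar>)}" by auto
    then show "\<sigma> (i - 1) = \<sigma> i - int (psize (\<tau> i))" "match x (\<sigma> i) (block (\<tau> i))"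
      using w[of "nat \<bar>i\<bar>"] unfolding window_def by blast+
  qed
  then have "rooted_isomorphic (joined_bushes (\<lambda>i. deg (\<tau> i)) (0, v)) (record_component x 0)"
    by (rule record_component_isomorphic) (use v \<open>\<tau> 0 = _\<close> \<open>\<sigma> 0 = _\<close> in simp_all)
  then show ?thesis using \<tau> v by blast
qed

section \<open>Tree weights and generating functions\<close>

lemma nn_integral_ptree:
  "(\<integral>\<^sup>+t. F t \<partial>count_space UNIV) = (\<integral>\<^sup>+ts. F (Node ts) \<partial>count_space UNIV)"
proof (rule nn_integral_bij_count_space[symmetric])
  show "bij_betw Node UNIV UNIV"
    by (intro bij_betwI[of _ _ _ children]) (auto intro: ptree.collapse)
qed

text \<open>An \<open>n\<close>-fold sum, written over lists because lists of trees index the window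
  events.\<close>

definition sum_lists :: "nat \<Rightarrow> ('a list \<Rightarrow> ennreal) \<Rightarrow> ennreal" where
  "sum_lists n F = (\<integral>\<^sup>+ts. F ts * indicator {ts. length ts = n} ts \<partial>count_space UNIV)"

lemma sum_lists_cong: "(\<And>ts. length ts = n \<Longrightarrow> F ts = G ts) \<Longrightarrow> sum_lists n F = sum_lists n G"
  unfolding sum_lists_def by (intro nn_integral_cong) (auto split: split_indicator)

lemma sum_lists_cmult: "sum_lists n (\<lambda>ts. r * F ts) = r * sum_lists n F"
  unfolding sum_lists_def by (simp add: mult.assoc nn_integral_cmult)

lemma sum_lists_add: "sum_lists n (\<lambda>ts. F ts + G ts) = sum_lists n F + sum_lists n G"
  unfolding sum_lists_def by (simp add: distrib_right nn_integral_add)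

lemma sum_lists_0:
  fixes F :: "'a list \<Rightarrow> ennreal"
  shows "sum_lists 0 F = F []"
proof -
  have "sum_lists 0 F = (\<integral>\<^sup>+ts. F [] * indicator {[] :: 'a list} ts \<partial>count_space UNIV)"
    unfolding sum_lists_def by (intro nn_integral_cong) (auto split: split_indicator)
  then show ?thesis by (simp add: nn_integral_cmult_indicator)
qed

lemma sum_lists_Suc:
  fixes F :: "'a list \<Rightarrow> ennreal"
  shows "sum_lists (Suc n) F = (\<integral>\<^sup>+t. sum_lists n (\<lambda>ts. F (t # ts)) \<partial>count_space UNIV)"
proof -
  let ?H = "\<lambda>ts. F ts * indicator {ts. length ts = Suc n} ts"
  have "sum_lists (Suc n) F = (\<integral>\<^sup>+ts. ?H ts \<partial>count_space {ts. ts \<noteq> []})"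
    unfolding sum_lists_def nn_integral_count_space_indicator[of "{ts. ts \<noteq> []}", simplified]
    by (intro nn_integral_cong) (auto split: split_indicator)
  also have "\<dots> = (\<integral>\<^sup>+p. ?H (case p of (t, ts) \<Rightarrow> t # ts) \<partial>count_space UNIV)"
  proof (rule nn_integral_bij_count_space[symmetric])
    show "bij_betw (\<lambda>(t, ts). t # ts) (UNIV :: ('a \<times> 'a list) set) {ts. ts \<noteq> []}"
      by (intro bij_betwI[of _ _ _ "\<lambda>ts. (hd ts, tl ts)"]) auto
  qed
  also have "\<dots> = (\<integral>\<^sup>+t. \<integral>\<^sup>+ts. ?H (t # ts) \<partial>count_space UNIV \<partial>count_space UNIV)"
    by (subst nn_integral_fst_count_space[symmetric]) simp
  also have "\<dots> = (\<integral>\<^sup>+t. sum_lists n (\<lambda>ts. F (t # ts)) \<partial>count_space UNIV)"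
    unfolding sum_lists_def by (intro nn_integral_cong) (auto split: split_indicator)
  finally show ?thesis .
qed

lemma sum_lists_prod:
  "sum_lists n (\<lambda>ts. \<Prod>j<n. g j (ts ! j)) = (\<Prod>j<n. \<integral>\<^sup>+t. g j t \<partial>count_space UNIV)"
proof (induction n arbitrary: g)
  case (Suc n)
  have "sum_lists (Suc n) (\<lambda>ts. \<Prod>j<Suc n. g j (ts ! j)) =
    (\<integral>\<^sup>+t. sum_lists n (\<lambda>ts. g 0 t * (\<Prod>j<n. g (Suc j) (ts ! j))) \<partial>count_space UNIV)"
    unfolding sum_lists_Suc by (simp add: prod.lessThan_Suc_shift del: prod.lessThan_Suc)
  also have "\<dots> = (\<integral>\<^sup>+t. g 0 t \<partial>count_space UNIV) * (\<Prod>j<n. \<integral>\<^sup>+t. g (Suc j) t \<partial>count_space UNIV)"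
    by (simp add: sum_lists_cmult Suc.IH[of "\<lambda>j. g (Suc j)"] nn_integral_multc)
  finally show ?case by (simp add: prod.lessThan_Suc_shift del: prod.lessThan_Suc)
qed (simp add: sum_lists_0)

lemma prod_list_nth_lessThan: "prod_list (map g ts) = (\<Prod>j<length ts. g (ts ! j))"
  by (induction ts) (simp_all add: prod.lessThan_Suc_shift del: prod.lessThan_Suc)

lemma sum_lists_prod_list:
  "sum_lists n (\<lambda>ts. prod_list (map g ts)) = (\<integral>\<^sup>+t. g t \<partial>count_space UNIV) ^ n"
proof -
  have "sum_lists n (\<lambda>ts. prod_list (map g ts)) = sum_lists n (\<lambda>ts. \<Prod>j<n. g (ts ! j))"
    by (intro sum_lists_cong) (simp add: prod_list_nth_lessThan)
  then show ?thesis using sum_lists_prod[of n "\<lambda>_. g"] by simp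
qed

lemma nn_integral_lists:
  "(\<integral>\<^sup>+ts. F ts \<partial>count_space UNIV) = (\<integral>\<^sup>+n. sum_lists n F \<partial>count_space UNIV)"
proof -
  let ?H = "\<lambda>(n, ts). F ts * indicator {ts. length ts = n} ts"
  have "(\<integral>\<^sup>+n. sum_lists n F \<partial>count_space UNIV) =
     (\<integral>\<^sup>+n. \<integral>\<^sup>+ts. ?H (n, ts) \<partial>count_space UNIV \<partial>count_space UNIV)"
    by (simp add: sum_lists_def)
  also have "\<dots> = (\<integral>\<^sup>+ts. \<integral>\<^sup>+n. ?H (n, ts) \<partial>count_space UNIV \<partial>count_space UNIV)"
    by (simp only: nn_integral_fst_count_space nn_integral_snd_count_space)
  also have "\<dots> = (\<integral>\<^sup>+ts. F ts \<partial>count_space UNIV)"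
  proof (rule nn_integral_cong)
    fix ts
    have "(\<integral>\<^sup>+n. ?H (n, ts) \<partial>count_space UNIV) = (\<integral>\<^sup>+n. F ts * indicator {length ts} n \<partial>count_space UNIV)"
      by (intro nn_integral_cong) (auto split: split_indicator)
    then show "(\<integral>\<^sup>+n. ?H (n, ts) \<partial>count_space UNIV) = F ts" by (simp add: nn_integral_cmult_indicator)
  qed
  finally show ?thesis ..
qed

text \<open>Sizes add along the list while all the other factors sum to one, so every position
  contributes the same mean.\<close>

lemma sum_lists_fsize:
  assumes "(\<integral>\<^sup>+t. g t \<partial>count_space UNIV) = 1"
  shows "sum_lists n (\<lambda>ts. of_nat (fsize ts) * prod_list (map g ts)) =
    of_nat n * (\<integral>\<^sup>+t. of_nat (psize t) * g t \<partial>count_space UNIV)"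
proof (induction n)
  case (Suc n)
  let ?M = "\<integral>\<^sup>+t. of_nat (psize t) * g t \<partial>count_space UNIV"
  have "sum_lists (Suc n) (\<lambda>ts. of_nat (fsize ts) * prod_list (map g ts)) =
    (\<integral>\<^sup>+t. sum_lists n (\<lambda>ts. (of_nat (psize t) * g t) * prod_list (map g ts) +
       g t * (of_nat (fsize ts) * prod_list (map g ts))) \<partial>count_space UNIV)"
    unfolding sum_lists_Suc by (simp add: algebra_simps)
  also have "\<dots> = (\<integral>\<^sup>+t. of_nat (psize t) * g t + g t * (of_nat n * ?M) \<partial>count_space UNIV)"
    by (simp only: sum_lists_add sum_lists_cmult sum_lists_prod_list assms Suc power_one mult_1_right)
  also have "\<dots> = ?M + 1 * (of_nat n * ?M)"
    by (subst nn_integral_add) (simp_all add: nn_integral_multc assms)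
  finally show ?case by (simp add: algebra_simps)
qed (simp add: sum_lists_0)

text \<open>Splitting at the root turns a sum over trees into the generating function of
  \<open>h\<close>, evaluated at the total of \<open>g\<close>.\<close>

lemma nn_integral_ptree_weight:
  "(\<integral>\<^sup>+t. h (length (children t)) * prod_list (map g (children t)) \<partial>count_space UNIV) =
    (\<integral>\<^sup>+k. h k * (\<integral>\<^sup>+t. g t \<partial>count_space UNIV) ^ k \<partial>count_space UNIV)"
proof -
  have "sum_lists n (\<lambda>ts. h (length ts) * prod_list (map g ts)) = h n * (\<integral>\<^sup>+t. g t \<partial>count_space UNIV) ^ n" for n
  proof -
    have "sum_lists n (\<lambda>ts. h (length ts) * prod_list (map g ts)) = sum_lists n (\<lambda>ts. h n * prod_list (map g ts))"
      by (rule sum_lists_cong) simp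
    then show ?thesis by (simp add: sum_lists_cmult sum_lists_prod_list)
  qed
  then show ?thesis by (subst nn_integral_ptree) (simp add: nn_integral_lists)
qed

text \<open>The summand 1 counts the root, and each root subtree contributes the mean size under
  \<open>g\<close>. Infinite values are allowed.\<close>

lemma nn_integral_ptree_size:
  assumes "(\<integral>\<^sup>+t. g t \<partial>count_space UNIV) = 1" "(\<integral>\<^sup>+k. h k \<partial>count_space UNIV) = 1"
  shows "(\<integral>\<^sup>+t. of_nat (psize t) * (h (length (children t)) * prod_list (map g (children t))) \<partial>count_space UNIV) =
    1 + (\<integral>\<^sup>+k. of_nat k * h k \<partial>count_space UNIV) * (\<integral>\<^sup>+t. of_nat (psize t) * g t \<partial>count_space UNIV)"
proof -
  let ?M = "\<integral>\<^sup>+t. of_nat (psize t) * g t \<partial>count_space UNIV"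
  have *: "sum_lists n (\<lambda>ts. of_nat (psize (Node ts)) * (h (length ts) * prod_list (map g ts))) = h n + of_nat n * h n * ?M" for n
  proof -
    have "sum_lists n (\<lambda>ts. of_nat (psize (Node ts)) * (h (length ts) * prod_list (map g ts))) =
      sum_lists n (\<lambda>ts. h n * prod_list (map g ts) + h n * (of_nat (fsize ts) * prod_list (map g ts)))"
      by (rule sum_lists_cong) (simp add: psize_children algebra_simps)
    then show ?thesis
      by (simp add: sum_lists_add sum_lists_cmult sum_lists_prod_list sum_lists_fsize assms mult_ac)
  qed
  have "(\<integral>\<^sup>+t. of_nat (psize t) * (h (length (children t)) * prod_list (map g (children t))) \<partial>count_space UNIV) =
    (\<integral>\<^sup>+k. h k + of_nat k * h k * ?M \<partial>count_space UNIV)"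
    by (subst nn_integral_ptree) (simp add: nn_integral_lists *)
  then show ?thesis by (simp add: nn_integral_add nn_integral_multc assms)
qed

section \<open>Total tree weight of a supercritical law\<close>

lemma nn_integral_pmf_count_space:
  "(\<integral>\<^sup>+k. f k \<partial>measure_pmf Q) = (\<integral>\<^sup>+k. ennreal (pmf Q k) * f k \<partial>count_space UNIV)"
  by (simp add: nn_integral_measure_pmf)

text \<open>The generating function has slope greater than 1 at 1, so it runs below the diagonal
  just left of 1. Truncation at \<open>N\<close> keeps the slope above 1 and makes it a finite sum,
  which also covers an infinite mean.\<close>

lemma subcritical_point:
  assumes "1 < (\<integral>\<^sup>+k. ennreal (real k) \<partial>measure_pmf Q)"
  shows "\<exists>s. 0 < s \<and> s < 1 \<and> (\<integral>\<^sup>+k. ennreal (s ^ k) \<partial>measure_pmf Q) \<le> ennreal s"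
proof -
  have "(\<integral>\<^sup>+k. ennreal (real k) \<partial>measure_pmf Q) = (\<Sum>k. ennreal (pmf Q k * real k))"
    by (simp add: nn_integral_pmf_count_space nn_integral_count_space_nat ennreal_mult)
  with assms have "1 < (SUP N. \<Sum>k<N. ennreal (pmf Q k * real k))"
    by (simp add: suminf_eq_SUP)
  then obtain N where "1 < (\<Sum>k<N. ennreal (pmf Q k * real k))" by (auto simp: less_SUP_iff)
  then have N: "1 < (\<Sum>k<N. pmf Q k * real k)"
    by (simp add: sum_ennreal)
  \<comment> \<open>\<open>(1 - s) * h s\<close> is the expectation of \<open>1 - s ^ k\<close>
    truncated to \<open>k < N\<close>; thus \<open>h\<close> is a difference quotient at 1 whose
    value there is the truncated mean.\<close>
  define h where "h s = (\<Sum>k<N. pmf Q k * (\<Sum>j<k. s ^ j))" for s :: real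
  have "isCont h 1" unfolding h_def by (intro continuous_intros)
  then have "(h \<longlongrightarrow> h 1) (at_left 1)" by (simp add: isCont_def filterlim_at_split)
  moreover have "1 < h 1" using N by (simp add: h_def)
  ultimately have "eventually (\<lambda>s. 1 < h s) (at_left 1)" by (rule order_tendstoD)
  moreover have "eventually (\<lambda>s. s \<in> {0<..<1::real}) (at_left 1)" by (rule eventually_at_leftI[of 0]) auto
  ultimately have "eventually (\<lambda>s. 1 < h s \<and> 0 < s \<and> s < 1) (at_left 1)" by eventually_elim auto
  then obtain s where s: "1 < h s" "0 < s" "s < 1"
    using eventually_happens'[OF trivial_limit_at_left_real] by blast
  let ?D = "\<lambda>k. indicator {..<N} k * (1 - s ^ k)"
  have pow: "0 \<le> s ^ k" "s ^ k \<le> 1" for k using s by (auto intro: power_le_one)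
  have int: "integrable (measure_pmf Q) (\<lambda>k. s ^ k)" "integrable (measure_pmf Q) ?D"
    by (intro measure_pmf.integrable_const_bound[where B = 1]; use pow in \<open>auto split: split_indicator\<close>)+
  have "measure_pmf.expectation Q ?D = (\<Sum>k<N. pmf Q k * (1 - s ^ k))"
  proof -
    have "measure_pmf.expectation Q ?D = (\<Sum>k\<in>{..<N}. pmf Q k *\<^sub>R ?D k)"
      by (rule integral_measure_pmf) (auto simp: indicator_def split: if_splits)
    then show ?thesis by simp
  qed
  also have "\<dots> = (1 - s) * h s"
    by (simp add: h_def sum_distrib_left one_diff_power_eq mult_ac)
  finally have "1 - s \<le> measure_pmf.expectation Q ?D" using s by simp
  moreover have "measure_pmf.expectation Q (\<lambda>k. s ^ k + ?D k) \<le> measure_pmf.expectation Q (\<lambda>k. 1)"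
    using int pow by (intro integral_mono) (auto split: split_indicator)
  ultimately have "measure_pmf.expectation Q (\<lambda>k. s ^ k) \<le> s" using int by simp
  then have "(\<integral>\<^sup>+k. ennreal (s ^ k) \<partial>measure_pmf Q) \<le> ennreal s"
    using int pow by (subst nn_integral_eq_integral) (auto intro: ennreal_leI)
  then show ?thesis using s by blast
qed

text \<open>\<open>weight Q t\<close> is the probability that the walk starts with the preorder code of \<open>t\<close>.\<close>

primrec weight :: "nat pmf \<Rightarrow> ptree \<Rightarrow> ennreal" where
  "weight Q (Node ts) = ennreal (pmf Q (length ts)) * prod_list (map (weight Q) ts)"

lemma weight_children: "weight Q t = ennreal (pmf Q (length (children t))) * prod_list (map (weight Q) (children t))"
  by (cases t) simp

text \<open>The weight restricted to trees of height less than \<open>n\<close>; its total is the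
  \<open>n\<close>-th iterate of the generating function from 0.\<close>

primrec weight_upto :: "nat pmf \<Rightarrow> nat \<Rightarrow> ptree \<Rightarrow> ennreal" where
  "weight_upto Q 0 t = 0"
| "weight_upto Q (Suc n) t = ennreal (pmf Q (length (children t))) * prod_list (map (weight_upto Q n) (children t))"

lemma eventually_weight_upto: "eventually (\<lambda>n. weight_upto Q n t = weight Q t) sequentially"
proof (induction t)
  case (Node ts)
  then have "eventually (\<lambda>n. \<forall>t\<in>set ts. weight_upto Q n t = weight Q t) sequentially"
    by (intro eventually_ball_finite) auto
  then have "eventually (\<lambda>n. weight_upto Q (Suc n) (Node ts) = weight Q (Node ts)) sequentially"
  proof eventually_elim
    case (elim n)
    then have "map (weight_upto Q n) ts = map (weight Q) ts" by simp
    then show ?case by (simp only: weight_upto.simps weight.simps ptree.sel)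
  qed
  then show ?case by (subst (asm) eventually_sequentially_Suc)
qed

lemma weight_total:
  "(\<integral>\<^sup>+t. weight Q t \<partial>count_space UNIV) =
    (\<integral>\<^sup>+k. (\<integral>\<^sup>+t. weight Q t \<partial>count_space UNIV) ^ k \<partial>measure_pmf Q)"
  unfolding nn_integral_pmf_count_space
  by (subst (1) weight_children) (rule nn_integral_ptree_weight)

text \<open>The fixed-point equation \<open>weight_total\<close> is solved by 1 too, so it cannot
  decide the matter. The height-restricted totals start at 0 and stay below a point \<open>s\<close>
  that the generating function does not raise; Fatou's lemma passes this bound to the limit.\<close>

lemma weight_total_less_1:
  assumes "1 < (\<integral>\<^sup>+k. ennreal (real k) \<partial>measure_pmf Q)"
  shows "(\<integral>\<^sup>+t. weight Q t \<partial>count_space UNIV) < 1"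
proof -
  obtain s where s: "0 < s" "s < 1" "(\<integral>\<^sup>+k. ennreal (s ^ k) \<partial>measure_pmf Q) \<le> ennreal s"
    using subcritical_point[OF assms] by blast
  have "(\<integral>\<^sup>+t. weight_upto Q n t \<partial>count_space UNIV) \<le> ennreal s" for n
  proof (induction n)
    case (Suc n)
    have "(\<integral>\<^sup>+t. weight_upto Q (Suc n) t \<partial>count_space UNIV) =
       (\<integral>\<^sup>+k. (\<integral>\<^sup>+t. weight_upto Q n t \<partial>count_space UNIV) ^ k \<partial>measure_pmf Q)"
      unfolding nn_integral_pmf_count_space weight_upto.simps by (rule nn_integral_ptree_weight)
    also have "\<dots> \<le> (\<integral>\<^sup>+k. ennreal (s ^ k) \<partial>measure_pmf Q)"
      using Suc s by (intro nn_integral_mono) (auto simp flip: ennreal_power intro: power_mono)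
    finally show ?case using s(3) by simp
  qed simp
  then have bound: "liminf (\<lambda>n. \<integral>\<^sup>+t. weight_upto Q n t \<partial>count_space UNIV) \<le> ennreal s"
    by (intro Liminf_le) auto
  have "weight Q t = liminf (\<lambda>n. weight_upto Q n t)" for t
    using tendsto_eventually[OF eventually_weight_upto] by (intro lim_imp_Liminf[symmetric]) auto
  then have "(\<integral>\<^sup>+t. weight Q t \<partial>count_space UNIV) \<le> liminf (\<lambda>n. \<integral>\<^sup>+t. weight_upto Q n t \<partial>count_space UNIV)"
    by (simp only:) (rule nn_integral_liminf, simp)
  also note bound
  also have "ennreal s < 1" using s by (metis ennreal_1 ennreal_lessI zero_less_one)
  finally show ?thesis .
qed

text \<open>An interchange of summation. It rewrites sums against the tails in \<open>bar\<close> as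
  expectations under \<open>Q\<close>.\<close>

lemma nn_integral_tail:
  fixes f :: "nat \<Rightarrow> real"
  assumes f: "\<And>k. 0 \<le> f k"
  shows "(\<integral>\<^sup>+k. ennreal (f k * measure_pmf.prob Q {k<..}) \<partial>count_space UNIV) =
    (\<integral>\<^sup>+j. ennreal (\<Sum>k<j. f k) \<partial>measure_pmf Q)"
proof -
  let ?H = "\<lambda>(k, j). ennreal (pmf Q j) * (ennreal (f k) * indicator {k<..} j)"
  have "(\<integral>\<^sup>+k. ennreal (f k * measure_pmf.prob Q {k<..}) \<partial>count_space UNIV) =
     (\<integral>\<^sup>+k. \<integral>\<^sup>+j. ?H (k, j) \<partial>count_space UNIV \<partial>count_space UNIV)"
  proof (rule nn_integral_cong)
    fix k
    have "ennreal (f k * measure_pmf.prob Q {k<..}) = ennreal (f k) * emeasure (measure_pmf Q) {k<..}"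
      by (simp add: ennreal_mult f measure_pmf.emeasure_eq_measure)
    also have "\<dots> = (\<integral>\<^sup>+j. ennreal (f k) * indicator {k<..} j \<partial>measure_pmf Q)"
      by (simp add: nn_integral_cmult_indicator)
    finally show "ennreal (f k * measure_pmf.prob Q {k<..}) = (\<integral>\<^sup>+j. ?H (k, j) \<partial>count_space UNIV)"
      by (simp add: nn_integral_pmf_count_space)
  qed
  also have "\<dots> = (\<integral>\<^sup>+j. \<integral>\<^sup>+k. ?H (k, j) \<partial>count_space UNIV \<partial>count_space UNIV)"
    by (simp only: nn_integral_fst_count_space nn_integral_snd_count_space)
  also have "\<dots> = (\<integral>\<^sup>+j. ennreal (pmf Q j) * ennreal (\<Sum>k<j. f k) \<partial>count_space UNIV)"
  proof (rule nn_integral_cong)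
    fix j
    have "(\<integral>\<^sup>+k. ?H (k, j) \<partial>count_space UNIV) = ennreal (pmf Q j) * (\<integral>\<^sup>+k. ennreal (f k) * indicator {k<..} j \<partial>count_space UNIV)"
      by (simp add: nn_integral_cmult)
    also have "(\<integral>\<^sup>+k. ennreal (f k) * indicator {k<..} j \<partial>count_space UNIV) = (\<integral>\<^sup>+k. ennreal (f k) * indicator {..<j} k \<partial>count_space UNIV)"
      by (intro nn_integral_cong) (auto split: split_indicator)
    also have "\<dots> = (\<integral>\<^sup>+k. ennreal (f k) \<partial>count_space {..<j})"
      by (simp add: nn_integral_count_space_indicator)
    also have "\<dots> = ennreal (\<Sum>k<j. f k)" by (simp add: nn_integral_count_space_finite sum_ennreal f)
    finally show "(\<integral>\<^sup>+k. ?H (k, j) \<partial>count_space UNIV) = ennreal (pmf Q j) * ennreal (\<Sum>k<j. f k)" .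
  qed
  finally show ?thesis by (simp add: nn_integral_pmf_count_space)
qed

section \<open>The two offspring laws and the mean bush size\<close>

definition block_weight :: "nat pmf \<Rightarrow> nat pmf \<Rightarrow> ptree \<Rightarrow> ennreal" where
  "block_weight \<alpha> \<beta> t = ennreal (pmf \<alpha> (length (children t))) * prod_list (map (weight \<beta>) (children t))"

definition mean_pmf :: "nat pmf \<Rightarrow> ennreal" where
  "mean_pmf \<alpha> = (\<integral>\<^sup>+k. ennreal (real k) \<partial>measure_pmf \<alpha>)"

lemma mean_pmf_count_space: "mean_pmf \<alpha> = (\<integral>\<^sup>+k. of_nat k * ennreal (pmf \<alpha> k) \<partial>count_space UNIV)"
  by (simp add: mean_pmf_def nn_integral_pmf_count_space mult.commute flip: ennreal_of_nat_eq_real_of_nat)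

lemma ennreal_cancel: "0 < r \<Longrightarrow> ennreal r * a = ennreal r * b \<Longrightarrow> a = b"
  by (subst (asm) ennreal_mult_cancel_left) auto

text \<open>\<open>Q\<close> stands for the law of the increment plus one, so \<open>pmf_0\<close>
  says that the value \<open>-1\<close> is taken and \<open>mean\<close> that the drift is
  positive.\<close>

locale offspring =
  fixes Q :: "nat pmf"
  assumes pmf_0: "0 < pmf Q 0" and mean: "1 < mean_pmf Q"
begin

text \<open>Introduced as the total weight of finite trees, which is available without a walk;
  \<open>prob_hitting\<close> identifies it with the probability of reaching
  \<open>-1\<close>.\<close>

definition c :: real where "c = enn2real (\<integral>\<^sup>+t. weight Q t \<partial>count_space UNIV)"

lemma ennreal_c: "ennreal c = (\<integral>\<^sup>+t. weight Q t \<partial>count_space UNIV)"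
  unfolding c_def using weight_total_less_1[OF mean[unfolded mean_pmf_def]]
  by (intro ennreal_enn2real) (auto intro: less_trans simp: less_top[symmetric])

lemma c_less_1: "c < 1"
  using weight_total_less_1[OF mean[unfolded mean_pmf_def]] ennreal_c
  by (metis c_def enn2real_nonneg ennreal_1 ennreal_less_iff)

lemma c_pos: "0 < c"
proof -
  have "weight Q (Node []) \<le> (\<integral>\<^sup>+t. weight Q t \<partial>count_space UNIV)"
    by (rule nn_integral_ge_point) simp
  then have "ennreal (pmf Q 0) \<le> ennreal c" by (simp add: ennreal_c)
  then show ?thesis using pmf_0 by (simp add: c_def ennreal_le_iff2)
qed

lemma expectation_power: "(\<integral>\<^sup>+k. ennreal (c ^ k) \<partial>measure_pmf Q) = ennreal c"
  using weight_total[of Q] c_pos by (simp add: ennreal_c[symmetric] ennreal_power)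

definition tilde :: "nat \<Rightarrow> real" where "tilde k = c powi (int k - 1) * pmf Q k"

definition bar :: "nat \<Rightarrow> real" where "bar k = c ^ k * measure_pmf.prob Q {k<..}"

lemma tilde_eq: "c * tilde k = pmf Q k * c ^ k"
  using c_pos by (simp add: tilde_def power_int_diff)

lemma tilde_nonneg: "0 \<le> tilde k" using c_pos by (simp add: tilde_def)

lemma bar_nonneg: "0 \<le> bar k" using c_pos by (simp add: bar_def)

text \<open>This is the fixed-point equation \<open>expectation_power\<close> divided by
  \<open>c\<close>.\<close>

lemma total_tilde: "(\<integral>\<^sup>+k. ennreal (tilde k) \<partial>count_space UNIV) = 1"
proof -
  have "ennreal c * (\<integral>\<^sup>+k. ennreal (tilde k) \<partial>count_space UNIV) = (\<integral>\<^sup>+k. ennreal (c * tilde k) \<partial>count_space UNIV)"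
    using c_pos tilde_nonneg by (simp add: nn_integral_cmult ennreal_mult)
  also have "\<dots> = ennreal c * 1"
    using expectation_power c_pos by (simp add: tilde_eq nn_integral_pmf_count_space ennreal_mult)
  finally show ?thesis by (rule ennreal_cancel[OF c_pos])
qed

text \<open>By \<open>nn_integral_tail\<close> the total is the expectation of a geometric sum, that
  is of \<open>(1 - c ^ j) / (1 - c)\<close>, and \<open>expectation_power\<close> turns it into
  1.\<close>

lemma total_bar: "(\<integral>\<^sup>+k. ennreal (bar k) \<partial>count_space UNIV) = 1"
proof -
  let ?S = "\<integral>\<^sup>+j. ennreal (\<Sum>k<j. c ^ k) \<partial>measure_pmf Q"
  have "ennreal (1 - c) * ?S + ennreal c = (\<integral>\<^sup>+j. ennreal (1 - c) * ennreal (\<Sum>k<j. c ^ k) + ennreal (c ^ j) \<partial>measure_pmf Q)"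
    by (simp add: nn_integral_add nn_integral_cmult expectation_power)
  also have "\<dots> = (\<integral>\<^sup>+j. 1 \<partial>measure_pmf Q)"
  proof (rule nn_integral_cong)
    fix j
    have "(1 - c) * (\<Sum>k<j. c ^ k) + c ^ j = 1" by (simp add: one_diff_power_eq[symmetric])
    then show "ennreal (1 - c) * ennreal (\<Sum>k<j. c ^ k) + ennreal (c ^ j) = 1"
      using c_pos c_less_1 by (simp add: sum_nonneg flip: ennreal_mult ennreal_plus)
  qed
  also have "\<dots> = ennreal (1 - c) * 1 + ennreal c"
    using c_pos c_less_1 by (simp flip: ennreal_plus)
  finally have "ennreal (1 - c) * ?S = ennreal (1 - c) * 1"
    using ennreal_add_left_cancel[of "ennreal c"] by (simp add: add.commute)
  then have "?S = 1" by (rule ennreal_cancel[rotated]) (use c_less_1 in simp)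
  then show ?thesis using nn_integral_tail[of "\<lambda>k. c ^ k" Q] c_pos by (simp add: bar_def)
qed

definition \<beta> :: "nat pmf" where "\<beta> = embed_pmf tilde"
definition \<alpha> :: "nat pmf" where "\<alpha> = embed_pmf bar"

lemma pmf_\<beta>: "pmf \<beta> = tilde"
  unfolding \<beta>_def by (intro ext pmf_embed_pmf tilde_nonneg total_tilde)

lemma pmf_\<alpha>: "pmf \<alpha> = bar"
  unfolding \<alpha>_def by (intro ext pmf_embed_pmf bar_nonneg total_bar)

text \<open>The expectation under \<open>Q\<close> of the elementary identity \<open>alg\<close> for
  finite sums. It replaces differentiating the generating function at \<open>c\<close>; it shows
  that the mean of \<open>\<alpha>\<close> is finite and, once that mean is known to be positive,
  that the mean of \<open>\<beta>\<close> is below 1.\<close>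

lemma mean_identity: "ennreal (1 - c) * mean_pmf \<alpha> + ennreal c * mean_pmf \<beta> = ennreal c"
proof -
  have a: "mean_pmf \<alpha> = (\<integral>\<^sup>+j. ennreal (\<Sum>k<j. real k * c ^ k) \<partial>measure_pmf Q)"
    using nn_integral_tail[of "\<lambda>k. real k * c ^ k" Q] c_pos
    by (simp add: mean_pmf_count_space pmf_\<alpha> bar_def ennreal_of_nat_eq_real_of_nat mult.assoc flip: ennreal_mult)
  have b: "ennreal c * mean_pmf \<beta> = (\<integral>\<^sup>+j. ennreal (real j * c ^ j) \<partial>measure_pmf Q)"
  proof -
    have "ennreal c * mean_pmf \<beta> = (\<integral>\<^sup>+k. ennreal c * (of_nat k * ennreal (pmf \<beta> k)) \<partial>count_space UNIV)"
      by (simp add: mean_pmf_count_space nn_integral_cmult)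
    also have "\<dots> = (\<integral>\<^sup>+k. ennreal (pmf Q k) * ennreal (real k * c ^ k) \<partial>count_space UNIV)"
    proof (rule nn_integral_cong)
      fix k
      have "c * (real k * pmf \<beta> k) = pmf Q k * (real k * c ^ k)"
        using tilde_eq[of k] by (simp add: pmf_\<beta> mult_ac)
      then show "ennreal c * (of_nat k * ennreal (pmf \<beta> k)) = ennreal (pmf Q k) * ennreal (real k * c ^ k)"
        using c_pos by (simp add: ennreal_of_nat_eq_real_of_nat flip: ennreal_mult)
    qed
    finally show ?thesis by (simp add: nn_integral_pmf_count_space)
  qed
  have alg: "(1 - c) * (\<Sum>k<j. real k * c ^ k) + real j * c ^ j = c * (\<Sum>k<j. c ^ k)" for j
  proof (induction j)
    case (Suc j)
    have "(1 - c) * (\<Sum>k<Suc j. real k * c ^ k) + real (Suc j) * c ^ Suc j =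
      ((1 - c) * (\<Sum>k<j. real k * c ^ k) + real j * c ^ j) + c * c ^ j" by (simp add: algebra_simps)
    also have "\<dots> = c * (\<Sum>k<j. c ^ k) + c * c ^ j" by (simp only: Suc)
    finally show ?case by (simp only: sum.lessThan_Suc distrib_left)
  qed simp
  have "ennreal (1 - c) * mean_pmf \<alpha> + ennreal c * mean_pmf \<beta> =
    (\<integral>\<^sup>+j. ennreal (1 - c) * ennreal (\<Sum>k<j. real k * c ^ k) + ennreal (real j * c ^ j) \<partial>measure_pmf Q)"
    by (simp add: a b nn_integral_add nn_integral_cmult)
  also have "\<dots> = (\<integral>\<^sup>+j. ennreal c * ennreal (\<Sum>k<j. c ^ k) \<partial>measure_pmf Q)"
    using alg c_pos c_less_1 by (intro nn_integral_cong) (simp add: sum_nonneg flip: ennreal_mult ennreal_plus)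
  also have "\<dots> = ennreal c * 1"
    using nn_integral_tail[of "\<lambda>k. c ^ k" Q] c_pos total_bar by (simp add: nn_integral_cmult bar_def)
  finally show ?thesis by simp
qed

lemma mean_\<alpha>_finite: "mean_pmf \<alpha> < \<infinity>"
proof -
  have "ennreal (1 - c) * mean_pmf \<alpha> \<le> ennreal c" by (subst mean_identity[symmetric]) simp
  then have "ennreal (1 - c) * mean_pmf \<alpha> < top" using ennreal_less_top le_less_trans by blast
  then show ?thesis using c_less_1 by (auto simp: ennreal_mult_less_top)
qed

text \<open>A mean above 1 forces \<open>Q\<close> to charge values beyond 1, so
  \<open>bar 1\<close> is positive. Strictness here gives \<open>mean_\<beta>_less_1\<close> and the
  finiteness of \<open>M\<close> in \<open>bush_mean_eq\<close>.\<close>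

lemma mean_\<alpha>_pos: "0 < mean_pmf \<alpha>"
proof -
  have "0 < measure_pmf.prob Q {1<..}"
  proof (rule ccontr)
    assume "\<not> 0 < measure_pmf.prob Q {1<..}"
    then have "measure_pmf.prob Q {1<..} = 0" 
      using measure_nonneg[of "measure_pmf Q" "{1<..}"] by linarith
    then have "AE k in measure_pmf Q. k \<notin> {1<..}" by (simp add: measure_pmf_zero_iff AE_measure_pmf_iff disjoint_iff)
    then have "mean_pmf Q \<le> (\<integral>\<^sup>+k. 1 \<partial>measure_pmf Q)"
      unfolding mean_pmf_def by (intro nn_integral_mono_AE) (auto elim!: eventually_mono)
    then show False using mean by simp
  qed
  then have "0 < ennreal (pmf \<alpha> 1)" using c_pos by (simp add: pmf_\<alpha> bar_def)
  also have "ennreal (pmf \<alpha> 1) = of_nat 1 * ennreal (pmf \<alpha> 1)" by simp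
  also have "\<dots> \<le> mean_pmf \<alpha>" unfolding mean_pmf_count_space by (rule nn_integral_ge_point) simp
  finally show ?thesis .
qed

lemma mean_identity_real:
  obtains a b where "0 < a" "mean_pmf \<alpha> = ennreal a" "0 \<le> b" "mean_pmf \<beta> = ennreal b" "(1 - c) * a + c * b = c"
proof -
  obtain a where a: "0 \<le> a" "mean_pmf \<alpha> = ennreal a" using mean_\<alpha>_finite by (cases "mean_pmf \<alpha>") auto
  have "ennreal c * mean_pmf \<beta> \<le> ennreal c" by (subst (2) mean_identity[symmetric]) simp
  then have "ennreal c * mean_pmf \<beta> < top" using ennreal_less_top le_less_trans by blast
  then have "mean_pmf \<beta> < top" using c_pos by (auto simp: ennreal_mult_less_top)
  then obtain b where b: "0 \<le> b" "mean_pmf \<beta> = ennreal b" by (cases "mean_pmf \<beta>") auto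
  have "ennreal ((1 - c) * a + c * b) = ennreal c"
    using mean_identity a b c_pos c_less_1 by (simp add: ennreal_mult ennreal_plus)
  then have "(1 - c) * a + c * b = c"
    by (rule ennreal_inj[THEN iffD1, rotated 2]) (use a b c_pos c_less_1 in simp_all)
  moreover have "0 < a" using mean_\<alpha>_pos a by simp
  ultimately show thesis using a b by (intro that)
qed

lemma mean_\<beta>_less_1: "mean_pmf \<beta> < 1"
proof -
  obtain a b where ab: "0 < a" "mean_pmf \<alpha> = ennreal a" "0 \<le> b" "mean_pmf \<beta> = ennreal b" "(1 - c) * a + c * b = c"
    by (rule mean_identity_real)
  have "0 < (1 - c) * a" using ab c_less_1 by simp
  then have "c * b < c * 1" using ab(5) by simp
  then have "b < 1" using c_pos by (simp only: mult_less_cancel_left_pos)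
  then show ?thesis using ab by (simp add: ennreal_less_one_iff)
qed

text \<open>Over the vertices of a finite tree the exponents in \<open>tilde\<close>, numbers of
  children minus one, sum to \<open>-1\<close>, so all powers of \<open>c\<close> cancel except
  one.\<close>

lemma weight_eq: "weight Q t = ennreal c * weight \<beta> t"
proof (induction t)
  case (Node ts)
  then have "prod_list (map (weight Q) ts) = ennreal c ^ length ts * prod_list (map (weight \<beta>) ts)"
    by (induction ts) (simp_all add: mult_ac)
  moreover have "ennreal (pmf Q (length ts)) * ennreal c ^ length ts = ennreal c * ennreal (pmf \<beta> (length ts))"
    using c_pos tilde_eq[of "length ts"] tilde_nonneg by (simp add: pmf_\<beta> ennreal_power flip: ennreal_mult)
  ultimately show ?case by (simp add: mult.assoc[symmetric])
qed

lemma total_\<beta>: "(\<integral>\<^sup>+t. weight \<beta> t \<partial>count_space UNIV) = 1"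
proof -
  have "ennreal c * (\<integral>\<^sup>+t. weight \<beta> t \<partial>count_space UNIV) = ennreal c * 1"
    using ennreal_c by (simp add: weight_eq nn_integral_cmult)
  then show ?thesis using c_pos by (subst (asm) ennreal_mult_cancel_left) simp
qed

lemma total_pmf: "(\<integral>\<^sup>+k. ennreal (pmf p k) \<partial>count_space UNIV) = 1"
  using nn_integral_pmf_count_space[of p "\<lambda>_. 1"] by simp

lemma total_block: "(\<integral>\<^sup>+t. block_weight \<alpha> \<beta> t \<partial>count_space UNIV) = 1"
  unfolding block_weight_def
  by (subst nn_integral_ptree_weight) (simp add: total_\<beta> total_pmf)

definition bush_mean :: ennreal where
  "bush_mean = (\<integral>\<^sup>+t. of_nat (psize t) * block_weight \<alpha> \<beta> t \<partial>count_space UNIV)"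

text \<open>With \<open>M\<close> the mean Galton-Watson size,
  \<open>M = 1 + mean_pmf \<beta> * M\<close> and
  \<open>bush_mean = 1 + mean_pmf \<alpha> * M\<close>; infinite values satisfy both. The assumed
  bound makes \<open>M\<close> finite, after which \<open>mean_identity\<close> eliminates the
  means.\<close>

lemma bush_mean_eq:
  assumes "ennreal (1 - c) * bush_mean \<le> 1"
  shows "ennreal (1 - c) * bush_mean = 1"
proof -
  define M where "M = (\<integral>\<^sup>+t. of_nat (psize t) * weight \<beta> t \<partial>count_space UNIV)"
  have M: "M = 1 + mean_pmf \<beta> * M"
    unfolding M_def mean_pmf_count_space
    by (subst (1) weight_children) (rule nn_integral_ptree_size[OF total_\<beta> total_pmf])
  have Z: "bush_mean = 1 + mean_pmf \<alpha> * M"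
    unfolding M_def mean_pmf_count_space bush_mean_def block_weight_def
    by (rule nn_integral_ptree_size[OF total_\<beta> total_pmf])
  have "ennreal (1 - c) * bush_mean < top" using assms by (rule le_less_trans) simp
  then have "bush_mean < top" using c_less_1 by (auto simp: ennreal_mult_less_top)
  then have "mean_pmf \<alpha> * M < top" by (simp add: Z)
  then have "M < top" using mean_\<alpha>_pos by (auto simp: ennreal_mult_less_top)
  obtain a b where a: "0 < a" "mean_pmf \<alpha> = ennreal a" and b: "0 \<le> b" "mean_pmf \<beta> = ennreal b"
    and 1: "(1 - c) * a + c * b = c"
    by (rule mean_identity_real)
  obtain m where m: "0 \<le> m" "M = ennreal m" using \<open>M < top\<close> by (cases M) auto
  have "ennreal m = ennreal (1 + b * m)"
    using M b m by (simp add: ennreal_mult ennreal_plus)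
  then have 2: "m = 1 + b * m" by (rule ennreal_inj[THEN iffD1, rotated 2]) (use b m in simp_all)
  have "(1 - c) * (1 + a * m) = 1 - c + ((1 - c) * a) * m" by (simp add: algebra_simps)
  also have "(1 - c) * a = c * (1 - b)" using 1 by (simp add: algebra_simps)
  also have "1 - c + c * (1 - b) * m = 1 - c + c * (m - b * m)" by (simp add: algebra_simps)
  also have "\<dots> = 1" using 2 by simp
  finally have "ennreal ((1 - c) * (1 + a * m)) = 1" by simp
  then show ?thesis using a m c_less_1 by (simp add: Z ennreal_mult ennreal_plus)
qed

end

section \<open>The law of the bushes\<close>

lemma borel_measurable_nn_integral_countable:
  fixes f :: "'i::countable \<Rightarrow> 'a \<Rightarrow> ennreal"
  assumes "\<And>i. f i \<in> borel_measurable M"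
  shows "(\<lambda>x. \<integral>\<^sup>+i. f i x \<partial>count_space UNIV) \<in> borel_measurable M"
proof (rule sigma_finite_measure.borel_measurable_nn_integral)
  show "sigma_finite_measure (count_space (UNIV :: 'i set))"
    by (rule sigma_finite_measure_count_space_countable) simp
  have "(\<lambda>(i, x). f i x) \<in> borel_measurable (count_space (UNIV :: 'i set) \<Otimes>\<^sub>M M)"
    by (rule measurable_pair_measure_countable1) (use assms in auto)
  then show "(\<lambda>(x, i). f i x) \<in> borel_measurable (M \<Otimes>\<^sub>M count_space (UNIV :: 'i set))"
    using measurable_pair_swap_iff[of "\<lambda>(x, i). f i x" M "count_space UNIV" borel]
    by (simp add: case_prod_beta)
qed

text \<open>Both laws to be compared are evaluated with this: an event \<open>B i\<close> fixes a
  finite configuration, on which the integrand is constant.\<close>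

lemma nn_integral_countable_partition:
  fixes B :: "'i::countable \<Rightarrow> 'a set"
  assumes B: "\<And>i. B i \<in> sets M" and ae: "AE x in M. \<exists>i. x \<in> B i"
    and unique: "\<And>i j x. x \<in> B i \<Longrightarrow> x \<in> B j \<Longrightarrow> i = j"
    and F: "\<And>i x. x \<in> B i \<Longrightarrow> F x = \<phi> i"
  shows "(\<integral>\<^sup>+x. F x \<partial>M) = (\<integral>\<^sup>+i. \<phi> i * emeasure M (B i) \<partial>count_space UNIV)"
proof -
  have "(\<integral>\<^sup>+x. F x \<partial>M) = (\<integral>\<^sup>+x. \<integral>\<^sup>+i. \<phi> i * indicator (B i) x \<partial>count_space UNIV \<partial>M)"
  proof (rule nn_integral_cong_AE)
    show "AE x in M. F x = (\<integral>\<^sup>+i. \<phi> i * indicator (B i) x \<partial>count_space UNIV)"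
      using ae
    proof eventually_elim
      case (elim x)
      then obtain j where j: "x \<in> B j" by blast
      have "(\<integral>\<^sup>+i. \<phi> i * indicator (B i) x \<partial>count_space UNIV) = (\<integral>\<^sup>+i. \<phi> j * indicator {j} i \<partial>count_space UNIV)"
        using j unique by (intro nn_integral_cong) (auto split: split_indicator)
      then show ?case using F[OF j] by (simp add: nn_integral_cmult_indicator)
    qed
  qed
  also have "\<dots> = (\<integral>\<^sup>+i. \<integral>\<^sup>+x. \<phi> i * indicator (B i) x \<partial>M \<partial>count_space UNIV)"
    using B by (intro nn_integral_count_space_nn_integral) auto
  also have "\<dots> = (\<integral>\<^sup>+i. \<phi> i * emeasure M (B i) \<partial>count_space UNIV)"
    using B by (intro nn_integral_cong) (simp add: nn_integral_cmult_indicator)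
  finally show ?thesis .
qed

section \<open>Finite bushes as events of the product law\<close>

definition tree_event :: "ptree \<Rightarrow> (nat list \<Rightarrow> nat) set" where
  "tree_event t = {e. \<forall>u\<in>bush_vertices (deg t). e u = deg t u}"

lemma bush_vertices_cong:
  assumes "\<forall>u\<in>bush_vertices d. e u = d u"
  shows "bush_vertices e = bush_vertices d"
proof (intro equalityI subsetI)
  show "u \<in> bush_vertices d" if "u \<in> bush_vertices e" for u
    using that by induction (use assms in \<open>auto intro: bush_vertices.intros\<close>)
  show "u \<in> bush_vertices e" if "u \<in> bush_vertices d" for u
    using that by induction (use assms in \<open>auto intro: bush_vertices.intros\<close>)
qed

lemma bush_tree_event: "e \<in> tree_event t \<Longrightarrow> bush_vertices e = bush_vertices (deg t)"
  unfolding tree_event_def by (intro bush_vertices_cong) simp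

lemma tree_event_unique:
  assumes "e \<in> tree_event t" "e \<in> tree_event u"
  shows "t = u"
proof (rule deg_determines)
  fix v assume "v \<in> bush_vertices (deg t)"
  moreover have "bush_vertices (deg t) = bush_vertices (deg u)"
    using bush_tree_event[OF assms(1)] bush_tree_event[OF assms(2)] by simp
  ultimately show "deg t v = deg u v" using assms unfolding tree_event_def by fastforce
qed

lemma prod_bush_Node:
  fixes F :: "nat list \<Rightarrow> nat \<Rightarrow> 'b::comm_monoid_mult"
  shows "(\<Prod>u\<in>bush_vertices (deg (Node ts)). F u (deg (Node ts) u)) =
    F [] (length ts) * (\<Prod>k<length ts. \<Prod>u\<in>bush_vertices (deg (ts ! k)). F (u @ [k]) (deg (ts ! k) u))"
proof -
  let ?A = "\<lambda>k. (\<lambda>u. u @ [k]) ` bush_vertices (deg (ts ! k))"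
  have "(\<Prod>u\<in>bush_vertices (deg (Node ts)). F u (deg (Node ts) u)) =
    F [] (length ts) * (\<Prod>u\<in>(\<Union>k<length ts. ?A k). F u (deg (Node ts) u))"
    unfolding bush_Node by (subst prod.insert) (auto simp: finite_bush)
  also have "(\<Prod>u\<in>(\<Union>k<length ts. ?A k). F u (deg (Node ts) u)) = (\<Prod>k<length ts. \<Prod>u\<in>?A k. F u (deg (Node ts) u))"
    by (rule prod.UNION_disjoint) (auto simp: finite_bush)
  also have "\<dots> = (\<Prod>k<length ts. \<Prod>u\<in>bush_vertices (deg (ts ! k)). F (u @ [k]) (deg (ts ! k) u))"
  proof (rule prod.cong)
    fix k
    have "inj_on (\<lambda>u. u @ [k]) (bush_vertices (deg (ts ! k)))" by (simp add: inj_on_def)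
    then show "(\<Prod>u\<in>?A k. F u (deg (Node ts) u)) = (\<Prod>u\<in>bush_vertices (deg (ts ! k)). F (u @ [k]) (deg (ts ! k) u))"
      by (simp add: prod.reindex deg_snoc)
  qed simp
  finally show ?thesis .
qed

lemma weight_prod: "weight Q t = (\<Prod>u\<in>bush_vertices (deg t). ennreal (pmf Q (deg t u)))"
proof (induction t)
  case (Node ts)
  then show ?case
    using prod_bush_Node[of "\<lambda>u k. ennreal (pmf Q k)" ts] by (simp add: prod_list_nth_lessThan)
qed

lemma block_weight_prod:
  "block_weight \<alpha> \<beta> t = (\<Prod>u\<in>bush_vertices (deg t). ennreal (pmf (if u = [] then \<alpha> else \<beta>) (deg t u)))"
proof (cases t)
  case (Node ts)
  then show ?thesis
    using prod_bush_Node[of "\<lambda>u k. ennreal (pmf (if u = [] then \<alpha> else \<beta>) k)" ts]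
    by (simp add: block_weight_def prod_list_nth_lessThan weight_prod)
qed

lemma space_bush_law: "space (bush_law \<alpha> \<beta>) = UNIV"
  by (simp add: bush_law_def space_PiM)

lemma space_bushes_law: "space (bushes_law \<alpha> \<beta>) = UNIV"
  by (simp add: bushes_law_def space_PiM space_bush_law)

lemma prob_space_bush_law: "prob_space (bush_law \<alpha> \<beta>)"
  unfolding bush_law_def by (intro prob_space_PiM measure_pmf.prob_space_axioms)

lemma prob_space_bushes_law: "prob_space (bushes_law \<alpha> \<beta>)"
  unfolding bushes_law_def by (intro prob_space_PiM prob_space_bush_law)

lemma measurable_bush_degree [measurable]: "(\<lambda>e. e u) \<in> bush_law \<alpha> \<beta> \<rightarrow>\<^sub>M count_space UNIV"
proof -
  have "(\<lambda>e. e u) \<in> bush_law \<alpha> \<beta> \<rightarrow>\<^sub>M measure_pmf (if u = [] then \<alpha> else \<beta>)"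
    unfolding bush_law_def by (rule measurable_component_singleton) simp
  then show ?thesis by simp
qed

lemma measurable_bushes_component: "(\<lambda>d. d i) \<in> bushes_law \<alpha> \<beta> \<rightarrow>\<^sub>M bush_law \<alpha> \<beta>"
  unfolding bushes_law_def by (rule measurable_component_singleton) simp

lemma measurable_bushes_degree [measurable]: "(\<lambda>d. d i u) \<in> bushes_law \<alpha> \<beta> \<rightarrow>\<^sub>M count_space UNIV"
  using measurable_compose[OF measurable_bushes_component measurable_bush_degree] .

lemma tree_event_sets: "tree_event t \<in> sets (bush_law \<alpha> \<beta>)"
proof -
  have "{e\<in>space (bush_law \<alpha> \<beta>). \<forall>u\<in>bush_vertices (deg t). e u = deg t u} \<in> sets (bush_law \<alpha> \<beta>)"
    by measurable
  then show ?thesis by (simp add: tree_event_def space_bush_law)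
qed

lemma emeasure_tree_event: "emeasure (bush_law \<alpha> \<beta>) (tree_event t) = block_weight \<alpha> \<beta> t"
proof -
  interpret product_prob_space "\<lambda>u::nat list. measure_pmf (if u = [] then \<alpha> else \<beta>)" UNIV
    by (intro product_prob_spaceI measure_pmf.prob_space_axioms)
  have "emeasure (bush_law \<alpha> \<beta>) {e\<in>space (bush_law \<alpha> \<beta>). \<forall>u\<in>bush_vertices (deg t). e u \<in> {deg t u}} =
      (\<Prod>u\<in>bush_vertices (deg t). emeasure (measure_pmf (if u = [] then \<alpha> else \<beta>)) {deg t u})"
    unfolding bush_law_def by (rule emeasure_PiM_Collect) (auto simp: finite_bush)
  then show ?thesis by (simp add: tree_event_def space_bush_law emeasure_pmf_single block_weight_prod)
qed

text \<open>Positions run from right to left as in \<open>list_event\<close>, so one list of trees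
  indexes the same window in the walk and in the product space.\<close>

definition window_event :: "nat \<Rightarrow> ptree list \<Rightarrow> (int \<Rightarrow> nat list \<Rightarrow> nat) set" where
  "window_event m ts = {d. length ts = 2 * m + 1 \<and> (\<forall>j<2 * m + 1. d (int m - int j) \<in> tree_event (ts ! j))}"

lemma window_event_Collect:
  "length ts = 2 * m + 1 \<Longrightarrow> window_event m ts = {d\<in>space (bushes_law \<alpha> \<beta>).
     \<forall>i\<in>(\<lambda>j. int m - int j) ` {..<2 * m + 1}. d i \<in> tree_event (ts ! nat (int m - i))}"
  by (auto simp: window_event_def space_bushes_law)

lemma window_event_sets: "window_event m ts \<in> sets (bushes_law \<alpha> \<beta>)"
proof (cases "length ts = 2 * m + 1")
  case True
  have [measurable]: "Measurable.pred (bushes_law \<alpha> \<beta>) (\<lambda>d. d i \<in> tree_event t)" for i t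
    using measurable_sets[OF measurable_bushes_component tree_event_sets, of i] by (simp add: pred_def vimage_def Int_def conj_commute)
  show ?thesis unfolding window_event_Collect[OF True, of \<alpha> \<beta>] by measurable
qed (simp add: window_event_def)

lemma emeasure_window_event:
  "emeasure (bushes_law \<alpha> \<beta>) (window_event m ts) =
    prod_list (map (block_weight \<alpha> \<beta>) ts) * indicator {ts. length ts = 2 * m + 1} ts"
proof (cases "length ts = 2 * m + 1")
  case True
  interpret product_prob_space "\<lambda>i::int. bush_law \<alpha> \<beta>" UNIV
    by (intro product_prob_spaceI prob_space_bush_law)
  have "emeasure (bushes_law \<alpha> \<beta>) (window_event m ts) =
     (\<Prod>i\<in>(\<lambda>j. int m - int j) ` {..<2 * m + 1}. emeasure (bush_law \<alpha> \<beta>) (tree_event (ts ! nat (int m - i))))"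
    unfolding window_event_Collect[OF True, of \<alpha> \<beta>] unfolding bushes_law_def
    by (rule emeasure_PiM_Collect) (auto simp: tree_event_sets)
  also have "\<dots> = (\<Prod>j<2 * m + 1. block_weight \<alpha> \<beta> (ts ! j))"
    by (subst prod.reindex) (auto simp: inj_on_def emeasure_tree_event)
  finally show ?thesis using True by (simp add: prod_list_nth_lessThan)
qed (simp add: window_event_def)

lemma window_event_unique:
  assumes "d \<in> window_event m ts" "d \<in> window_event m us"
  shows "ts = us"
proof (rule nth_equalityI)
  show "length ts = length us" using assms by (simp add: window_event_def)
  fix j assume "j < length ts"
  then have "d (int m - int j) \<in> tree_event (ts ! j)" "d (int m - int j) \<in> tree_event (us ! j)"
    using assms by (auto simp: window_event_def)
  then show "ts ! j = us ! j" by (rule tree_event_unique)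
qed

definition window_degrees :: "nat \<Rightarrow> ptree list \<Rightarrow> int \<Rightarrow> nat list \<Rightarrow> nat" where
  "window_degrees m ts i = deg (ts ! nat (int m - i))"

lemma window_event_bush:
  assumes "d \<in> window_event m ts" "\<bar>i\<bar> \<le> int m"
  shows "bush_vertices (d i) = bush_vertices (window_degrees m ts i)"
proof -
  have "nat (int m - i) < 2 * m + 1" "int m - int (nat (int m - i)) = i" using assms(2) by auto
  then show ?thesis using assms(1) bush_tree_event unfolding window_event_def window_degrees_def by fastforce
qed

lemma local_event_joined_bushes_cong:
  assumes A: "\<forall>T\<in>A. cyl T m \<subseteq> A" and u: "u \<in> bush_vertices (d 0)"
    and eq: "\<And>i. \<bar>i\<bar> \<le> int m \<Longrightarrow> bush_vertices (d i) = bush_vertices (d' i)"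
  shows "iso_class (joined_bushes d (0, u)) \<in> A \<longleftrightarrow> iso_class (joined_bushes d' (0, u)) \<in> A"
proof -
  have b: "ball_around_origin (joined_bushes d (0, u)) m = ball_around_origin (joined_bushes d' (0, u)) m"
    by (rule ball_joined_bushes_cong) (rule eq)
  have "u \<in> bush_vertices (d' 0)" using u eq[of 0] by simp
  then have ft: "family_tree (joined_bushes d (0, u))" "family_tree (joined_bushes d' (0, u))"
    using u by (auto intro!: family_tree_joined_bushes)
  have "rooted_isomorphic (ball_around_origin (joined_bushes d' (0, u)) m) (ball_around_origin (joined_bushes d' (0, u)) m)"
    by (rule rooted_isomorphicI[of id]) auto
  then have iso: "rooted_isomorphic (ball_around_origin (joined_bushes d (0, u)) m) (ball_around_origin (joined_bushes d' (0, u)) m)"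
    "rooted_isomorphic (ball_around_origin (joined_bushes d' (0, u)) m) (ball_around_origin (joined_bushes d (0, u)) m)"
    by (simp_all only: b)
  show ?thesis
    using local_event_iso_class[OF A ft iso(1)] local_event_iso_class[OF A ft(2,1) iso(2)] by blast
qed

lemma measurable_bush_vertices [measurable]: "Measurable.pred (bushes_law \<alpha> \<beta>) (\<lambda>d. u \<in> bush_vertices (d i))"
proof (induction u)
  case (Cons k u)
  note Cons [measurable]
  show ?case unfolding bush_vertices_Cons by measurable
qed (simp add: bush_vertices.root)

lemma bush_vertices_const: "(\<forall>k\<in>set u. k < n) \<Longrightarrow> u \<in> bush_vertices (\<lambda>_. n)"
  by (induction u) (auto simp: bush_vertices_Cons bush_vertices.root)

lemma measurable_joined_bushes:
  assumes A: "A \<in> sets borel"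
  shows "Measurable.pred (bushes_law \<alpha> \<beta>) (\<lambda>d. u \<in> bush_vertices (d 0) \<and> iso_class (joined_bushes d (0, u)) \<in> A)"
proof -
  \<comment> \<open>\<open>measurable_iso_class\<close> asks for a Family Tree at every sample
    point. When \<open>u\<close> is not a vertex of bush 0, the degrees are replaced by a constant
    exceeding every entry of \<open>u\<close>, which makes \<open>u\<close> a vertex.\<close>
  define D where "D d = (if u \<in> bush_vertices (d 0) then d else (\<lambda>i::int. \<lambda>_::nat list. Suc (sum_list u)))"
    for d :: "int \<Rightarrow> nat list \<Rightarrow> nat"
  have const: "v \<in> bush_vertices (\<lambda>_. Suc (sum_list v))" for v :: "nat list"
    by (rule bush_vertices_const) (auto simp: less_Suc_eq_le member_le_sum_list)
  have G: "(\<lambda>d. iso_class (joined_bushes (D d) (0, u))) \<in> bushes_law \<alpha> \<beta> \<rightarrow>\<^sub>M borel"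
  proof (rule measurable_iso_class)
    show "family_tree (joined_bushes (D d) (0, u))" for d
      by (rule family_tree_joined_bushes) (simp add: D_def const)
    show "Measurable.pred (bushes_law \<alpha> \<beta>) (\<lambda>d. (p, q) \<in> edges (joined_bushes (D d) (0, u)))" for p q
    proof -
      have [measurable]: "Measurable.pred (bushes_law \<alpha> \<beta>) (\<lambda>d. v \<in> bush_vertices (D d i))" for v i
      proof -
        have "(\<lambda>d. v \<in> bush_vertices (D d i)) = (\<lambda>d. if u \<in> bush_vertices (d 0) then v \<in> bush_vertices (d i)
           else v \<in> bush_vertices (\<lambda>_. Suc (sum_list u)))" by (auto simp: D_def)
        then show ?thesis by simp
      qed
      show ?thesis unfolding edges_joined_bushes by measurable
    qed
  qed simp
  have "Measurable.pred (bushes_law \<alpha> \<beta>) (\<lambda>d. iso_class (joined_bushes (D d) (0, u)) \<in> A)"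
    using measurable_sets[OF G A] by (simp add: pred_def vimage_def Int_def conj_commute)
  then have "Measurable.pred (bushes_law \<alpha> \<beta>) (\<lambda>d. u \<in> bush_vertices (d 0) \<and> iso_class (joined_bushes (D d) (0, u)) \<in> A)"
    by measurable
  moreover have "(\<lambda>d. u \<in> bush_vertices (d 0) \<and> iso_class (joined_bushes (D d) (0, u)) \<in> A) =
      (\<lambda>d. u \<in> bush_vertices (d 0) \<and> iso_class (joined_bushes d (0, u)) \<in> A)"
    by (auto simp: D_def)
  ultimately show ?thesis by simp
qed

section \<open>Vertex counts and the unimodularised measure\<close>

definition vertex_count :: "ftree set \<Rightarrow> (int \<Rightarrow> nat list \<Rightarrow> nat) \<Rightarrow> ennreal" where
  "vertex_count A d = (\<integral>\<^sup>+u. indicator A (iso_class (joined_bushes d (0, u))) \<partial>count_space (bush_vertices (d 0)))"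

lemma vertex_count_UNIV:
  "vertex_count A d = (\<integral>\<^sup>+u. indicator {u. u \<in> bush_vertices (d 0) \<and> iso_class (joined_bushes d (0, u)) \<in> A} u \<partial>count_space UNIV)"
  unfolding vertex_count_def
  by (subst nn_integral_count_space_indicator, simp, rule nn_integral_cong) (auto split: split_indicator)

lemma borel_measurable_vertex_count:
  assumes "A \<in> sets borel"
  shows "vertex_count A \<in> borel_measurable (bushes_law \<alpha> \<beta>)"
proof -
  have "vertex_count A = (\<lambda>d. \<integral>\<^sup>+u. indicator {d. u \<in> bush_vertices (d 0) \<and> iso_class (joined_bushes d (0, u)) \<in> A} d \<partial>count_space UNIV)"
    by (rule ext, subst vertex_count_UNIV, rule nn_integral_cong) (auto split: split_indicator)
  moreover have "(indicator {d. u \<in> bush_vertices (d 0) \<and> iso_class (joined_bushes d (0, u)) \<in> A} :: _ \<Rightarrow> ennreal)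
     \<in> borel_measurable (bushes_law \<alpha> \<beta>)" for u
    using measurable_joined_bushes[OF assms, of u \<alpha> \<beta>]
    by (intro borel_measurable_indicator) (simp add: pred_def space_bushes_law)
  ultimately show ?thesis by (simp only: borel_measurable_nn_integral_countable)
qed

text \<open>\<open>measure_of\<close> takes the values of the prescribed set function only if that
  function is countably additive; this reduces to exchanging sums and integrals, given that
  \<open>vertex_count\<close> is measurable.\<close>

lemma emeasure_unimodularised_EKT:
  assumes A: "A \<in> sets borel"
  shows "emeasure (unimodularised_EKT \<alpha> \<beta>) A = (\<integral>\<^sup>+d. vertex_count A d \<partial>bushes_law \<alpha> \<beta>) /
          (\<integral>\<^sup>+d. emeasure (count_space UNIV) (bush_vertices (d 0)) \<partial>bushes_law \<alpha> \<beta>)"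
    (is "_ = ?\<mu> A")
proof (rule emeasure_measure_of)
  show "unimodularised_EKT \<alpha> \<beta> = measure_of UNIV (sets borel) ?\<mu>"
    by (simp add: unimodularised_EKT_def vertex_count_def)
  have sets: "sets (unimodularised_EKT \<alpha> \<beta>) = sets (borel :: ftree measure)"
    unfolding unimodularised_EKT_def by (simp add: sets.sigma_sets_eq[of borel, simplified])
  then show "A \<in> sets (unimodularised_EKT \<alpha> \<beta>)" using A by simp
  have "vertex_count {} = (\<lambda>_. 0)" by (rule ext) (simp add: vertex_count_def)
  then show "positive (sets (unimodularised_EKT \<alpha> \<beta>)) ?\<mu>" by (simp add: positive_def)
  show "countably_additive (sets (unimodularised_EKT \<alpha> \<beta>)) ?\<mu>"
  proof (rule countably_additiveI)
    fix B :: "nat \<Rightarrow> ftree set"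
    assume B: "range B \<subseteq> sets (unimodularised_EKT \<alpha> \<beta>)" "disjoint_family B"
    have "vertex_count (\<Union>i. B i) d = (\<Sum>i. vertex_count (B i) d)" for d
    proof -
      have "vertex_count (\<Union>i. B i) d = (\<integral>\<^sup>+u. (\<Sum>i. indicator (B i) (iso_class (joined_bushes d (0, u)))) \<partial>count_space (bush_vertices (d 0)))"
        unfolding vertex_count_def by (simp add: suminf_indicator[OF B(2)])
      also have "\<dots> = (\<Sum>i. vertex_count (B i) d)"
        unfolding vertex_count_def by (rule nn_integral_suminf) simp
      finally show ?thesis .
    qed
    moreover have "(\<integral>\<^sup>+d. (\<Sum>i. vertex_count (B i) d) \<partial>bushes_law \<alpha> \<beta>) = (\<Sum>i. \<integral>\<^sup>+d. vertex_count (B i) d \<partial>bushes_law \<alpha> \<beta>)"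
      using B(1) sets by (intro nn_integral_suminf borel_measurable_vertex_count) auto
    ultimately show "(\<Sum>i. ?\<mu> (B i)) = ?\<mu> (\<Union>i. B i)" by simp
  qed
qed auto

context offspring
begin

text \<open>The weights of the finite trees sum to 1 for each bush, so this contains the almost sure
  finiteness of the bushes.\<close>

lemma AE_window_event: "AE d in bushes_law \<alpha> \<beta>. \<exists>ts. d \<in> window_event m ts"
proof -
  interpret prob_space "bushes_law \<alpha> \<beta>" by (rule prob_space_bushes_law)
  have "emeasure (bushes_law \<alpha> \<beta>) (\<Union>ts. window_event m ts) = (\<integral>\<^sup>+ts. emeasure (bushes_law \<alpha> \<beta>) (window_event m ts) \<partial>count_space UNIV)"
    by (rule emeasure_UN_countable)
      (auto simp: window_event_sets disjoint_family_on_def dest: window_event_unique)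
  also have "\<dots> = sum_lists (2 * m + 1) (\<lambda>ts. prod_list (map (block_weight \<alpha> \<beta>) ts))"
    by (simp add: emeasure_window_event sum_lists_def)
  also have "\<dots> = 1" by (simp only: sum_lists_prod_list total_block power_one)
  finally have "prob (\<Union>ts. window_event m ts) = 1" by (simp add: emeasure_eq_measure)
  moreover have "(\<Union>ts. window_event m ts) \<in> sets (bushes_law \<alpha> \<beta>)"
    by (intro sets.countable_UN'') (auto simp: window_event_sets)
  ultimately have "AE d in bushes_law \<alpha> \<beta>. d \<in> (\<Union>ts. window_event m ts)" by (simp add: prob_eq_1)
  then show ?thesis by eventually_elim auto
qed

lemma window_integral:
  assumes "\<And>ts d. d \<in> window_event m ts \<Longrightarrow> F d = \<phi> ts"
  shows "(\<integral>\<^sup>+d. F d \<partial>bushes_law \<alpha> \<beta>) = sum_lists (2 * m + 1) (\<lambda>ts. prod_list (map (block_weight \<alpha> \<beta>) ts) * \<phi> ts)"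
proof -
  have "(\<integral>\<^sup>+d. F d \<partial>bushes_law \<alpha> \<beta>) = (\<integral>\<^sup>+ts. \<phi> ts * emeasure (bushes_law \<alpha> \<beta>) (window_event m ts) \<partial>count_space UNIV)"
    by (rule nn_integral_countable_partition)
      (use assms in \<open>auto simp: window_event_sets AE_window_event dest: window_event_unique\<close>)
  then show ?thesis by (simp add: emeasure_window_event sum_lists_def mult_ac)
qed

text \<open>Identifies the normalising constant of \<open>unimodularised_EKT\<close>; a window of
  radius 0 suffices.\<close>

lemma nn_integral_bush_size:
  "(\<integral>\<^sup>+d. emeasure (count_space UNIV) (bush_vertices (d 0)) \<partial>bushes_law \<alpha> \<beta>) = bush_mean"
proof -
  have "(\<integral>\<^sup>+d. emeasure (count_space UNIV) (bush_vertices (d 0)) \<partial>bushes_law \<alpha> \<beta>) =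
    sum_lists (2 * 0 + 1) (\<lambda>ts. prod_list (map (block_weight \<alpha> \<beta>) ts) * of_nat (psize (ts ! 0)))"
  proof (rule window_integral)
    fix ts and d :: "int \<Rightarrow> nat list \<Rightarrow> nat"
    assume "d \<in> window_event 0 ts"
    then have "bush_vertices (d 0) = bush_vertices (deg (ts ! 0))"
      using window_event_bush[of d 0 ts 0] by (simp add: window_degrees_def)
    then show "emeasure (count_space UNIV) (bush_vertices (d 0)) = of_nat (psize (ts ! 0))"
      using bij_betw_same_card[OF bij_pos, of "ts ! 0"] by (simp add: emeasure_count_space_finite finite_bush)
  qed
  also have "\<dots> = (\<integral>\<^sup>+t. block_weight \<alpha> \<beta> t * of_nat (psize t) \<partial>count_space UNIV)"
    by (simp add: sum_lists_Suc sum_lists_0)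
  finally show ?thesis by (simp add: bush_mean_def mult.commute)
qed

lemma nn_integral_vertex_count:
  assumes A: "\<forall>T\<in>A. cyl T m \<subseteq> A"
  shows "(\<integral>\<^sup>+d. vertex_count A d \<partial>bushes_law \<alpha> \<beta>) =
    sum_lists (2 * m + 1) (\<lambda>ts. prod_list (map (block_weight \<alpha> \<beta>) ts) * vertex_count A (window_degrees m ts))"
proof (rule window_integral)
  fix ts and d :: "int \<Rightarrow> nat list \<Rightarrow> nat"
  assume d: "d \<in> window_event m ts"
  note eq = window_event_bush[OF d]
  have "bush_vertices (d 0) = bush_vertices (window_degrees m ts 0)" by (rule eq) simp
  moreover have "iso_class (joined_bushes d (0, u)) \<in> A \<longleftrightarrow> iso_class (joined_bushes (window_degrees m ts) (0, u)) \<in> A"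
    if "u \<in> bush_vertices (d 0)" for u
    by (rule local_event_joined_bushes_cong[OF A]) (rule that, rule eq)
  ultimately show "vertex_count A d = vertex_count A (window_degrees m ts)"
    unfolding vertex_count_def by (auto intro!: nn_integral_cong split: split_indicator)
qed

end

section \<open>The random walk\<close>

locale walk = offspring Q + prob_space M for Q :: "nat pmf" and M :: "'a measure" +
  fixes X :: "int \<Rightarrow> 'a \<Rightarrow> int"
  assumes indep: "indep_vars (\<lambda>_. count_space UNIV) X UNIV"
    and law: "emeasure M {\<omega>\<in>space M. X n \<omega> \<in> V} = emeasure (measure_pmf Q) {k. int k - 1 \<in> V}"
    and ge: "\<omega> \<in> space M \<Longrightarrow> - 1 \<le> X n \<omega>"
begin

definition traj :: "'a \<Rightarrow> int \<Rightarrow> int" where "traj \<omega> n = X n \<omega>"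

lemma measurable_traj [measurable]: "(\<lambda>\<omega>. traj \<omega> n) \<in> M \<rightarrow>\<^sub>M count_space UNIV"
  using indep unfolding indep_vars_def traj_def by auto

definition step_weight :: "int set list \<Rightarrow> ennreal" where
  "step_weight w = prod_list (map (\<lambda>V. emeasure (measure_pmf Q) {k. int k - 1 \<in> V}) w)"

lemma step_weight_append [simp]: "step_weight (v @ w) = step_weight v * step_weight w"
  by (simp add: step_weight_def)

lemma match_sets [measurable]: "Measurable.pred M (\<lambda>\<omega>. match (traj \<omega>) a w)"
proof -
  have [measurable]: "Measurable.pred M (\<lambda>\<omega>. traj \<omega> n \<in> V)" for n V
    using measurable_sets[OF measurable_traj, of V n] by (simp add: pred_def vimage_def Int_def conj_commute)
  show ?thesis unfolding match_def by measurable
qed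

text \<open>The order of reading is left open by the injection \<open>j\<close>: leftward reading
  serves \<open>match\<close>, rightward reading the hitting probability.\<close>

lemma emeasure_letters:
  fixes j :: "nat \<Rightarrow> int"
  assumes "inj j"
  shows "emeasure M {\<omega>\<in>space M. \<forall>m<length w. X (j m) \<omega> \<in> w ! m} = step_weight w"
proof (cases "w = []")
  case True
  then show ?thesis by (simp add: step_weight_def emeasure_space_1)
next
  case False
  let ?J = "j ` {..<length w}" and ?A = "\<lambda>i. w ! the_inv j i"
  have j: "the_inv j (j m) = m" for m using assms by (rule the_inv_f_f)
  have "{\<omega>\<in>space M. \<forall>m<length w. X (j m) \<omega> \<in> w ! m} = (\<Inter>i\<in>?J. X i -` ?A i \<inter> space M)"
    using False by (auto simp: j)
  then have "emeasure M {\<omega>\<in>space M. \<forall>m<length w. X (j m) \<omega> \<in> w ! m} = ennreal (prob (\<Inter>i\<in>?J. X i -` ?A i \<inter> space M))"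
    by (simp add: emeasure_eq_measure)
  also have "prob (\<Inter>i\<in>?J. X i -` ?A i \<inter> space M) = (\<Prod>i\<in>?J. prob (X i -` ?A i \<inter> space M))"
    using False by (intro indep_varsD[OF indep]) auto
  also have "ennreal \<dots> = (\<Prod>i\<in>?J. emeasure M {\<omega>\<in>space M. X i \<omega> \<in> ?A i})"
    by (simp add: prod_ennreal[symmetric] emeasure_eq_measure vimage_def Int_def conj_commute)
  also have "\<dots> = (\<Prod>m<length w. emeasure (measure_pmf Q) {k. int k - 1 \<in> w ! m})"
    unfolding law using inj_on_subset[OF assms] by (subst prod.reindex) (simp_all add: j)
  finally show ?thesis by (simp add: step_weight_def prod_list_nth_lessThan)
qed

lemma emeasure_match: "emeasure M {\<omega>\<in>space M. match (traj \<omega>) a w} = step_weight w"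
  using emeasure_letters[of "\<lambda>m. a - 1 - int m" w] by (simp add: match_def traj_def inj_def)

lemma step_weight_pre: "step_weight (singles (pre t)) = weight Q t"
proof (induction t)
  case (Node ts)
  then have "step_weight (singles (concat (map pre ts))) = prod_list (map (weight Q) ts)"
    by (induction ts) (simp_all add: step_weight_def singles_def)
  moreover have "{k. int k - 1 = int (length ts) - 1} = {length ts}" by auto
  ultimately show ?case by (simp add: pre.simps step_weight_def singles_def emeasure_pmf_single)
qed

text \<open>Each of the root subtrees brings one factor \<open>c\<close> beyond its Galton-Watson
  probability; these factors join the tail of the root letter to form \<open>bar\<close>.\<close>

lemma step_weight_block: "step_weight (block t) = block_weight \<alpha> \<beta> t"
proof -
  let ?n = "length (children t)"
  have "step_weight (singles (forest ts)) = prod_list (map (weight Q) ts)" for ts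
    by (induction ts) (simp_all add: step_weight_pre, simp add: step_weight_def singles_def)
  moreover have "prod_list (map (weight Q) ts) = ennreal c ^ length ts * prod_list (map (weight \<beta>) ts)" for ts
    by (induction ts) (simp_all add: weight_eq mult_ac)
  moreover have "{k. int k - 1 \<in> {int ?n..}} = {?n<..}" by auto
  moreover have "step_weight (block t) = emeasure (measure_pmf Q) {k. int k - 1 \<in> {int ?n..}} * step_weight (singles (forest (children t)))"
    by (simp add: block_def step_weight_def)
  ultimately have "step_weight (block t) = emeasure (measure_pmf Q) {?n<..} * ennreal c ^ ?n * prod_list (map (weight \<beta>) (children t))"
    by (simp only: mult.assoc)
  moreover have "emeasure (measure_pmf Q) {?n<..} * ennreal c ^ ?n = ennreal (bar ?n)"
    using c_pos by (simp add: bar_def measure_pmf.emeasure_eq_measure ennreal_power mult.commute flip: ennreal_mult)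
  ultimately show ?thesis by (simp add: block_weight_def pmf_\<alpha>)
qed

lemma not_spine_traj: "\<omega> \<in> space M \<Longrightarrow> \<not> spine (traj \<omega>) a \<longleftrightarrow> (\<exists>t. match (traj \<omega>) a (singles (pre t)))"
  by (rule not_spine_iff) (simp add: traj_def ge)

lemma spine_sets [measurable]: "Measurable.pred M (\<lambda>\<omega>. spine (traj \<omega>) a)"
proof -
  have "Measurable.pred M (\<lambda>\<omega>. \<not> (\<exists>t. match (traj \<omega>) a (singles (pre t))))" by measurable
  moreover have "spine (traj \<omega>) a = (\<not> (\<exists>t. match (traj \<omega>) a (singles (pre t))))" if "\<omega> \<in> space M" for \<omega>
    using not_spine_traj[OF that, of a] by blast
  ultimately show ?thesis by (rule measurable_cong[THEN iffD2, rotated])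
qed

text \<open>Once \<open>w\<close> is matched, the point at its left end is either on the spine or
  preceded by exactly one tree code. The second alternative has total probability
  \<open>step_weight w * c\<close>, and the first is the rest. Only finite words are measured, so
  the infinite past calls for no separate independence argument.\<close>

lemma emeasure_match_spine:
  "emeasure M {\<omega>\<in>space M. match (traj \<omega>) e w \<and> spine (traj \<omega>) (e - int (length w))} = ennreal (1 - c) * step_weight w"
proof -
  let ?S = "{\<omega>\<in>space M. match (traj \<omega>) e w \<and> spine (traj \<omega>) (e - int (length w))}"
  let ?N = "\<lambda>t. {\<omega>\<in>space M. match (traj \<omega>) e (w @ singles (pre t))}"
  have "emeasure M (\<Union>t. ?N t) = (\<integral>\<^sup>+t. emeasure M (?N t) \<partial>count_space UNIV)"
    by (rule emeasure_UN_countable) (auto simp: disjoint_family_on_def match_append dest: match_pre_unique)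
  also have "\<dots> = step_weight w * ennreal c"
    by (simp add: emeasure_match step_weight_pre nn_integral_cmult ennreal_c)
  finally have N: "emeasure M (\<Union>t. ?N t) = step_weight w * ennreal c" .
  have "{\<omega>\<in>space M. match (traj \<omega>) e w} = ?S \<union> (\<Union>t. ?N t)"
    using not_spine_traj by (auto simp: match_append)
  then have "step_weight w = emeasure M (?S \<union> (\<Union>t. ?N t))" by (simp flip: emeasure_match[of e])
  also have "\<dots> = emeasure M ?S + emeasure M (\<Union>t. ?N t)"
    using not_spine_traj by (intro plus_emeasure[symmetric]) (auto simp: match_append)
  finally have "step_weight w = emeasure M ?S + step_weight w * ennreal c" using N by simp
  moreover have "step_weight w * ennreal c + step_weight w * ennreal (1 - c) = step_weight w"
    using c_pos c_less_1 by (simp flip: distrib_left ennreal_plus)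
  ultimately have "step_weight w * ennreal c + emeasure M ?S = step_weight w * ennreal c + step_weight w * ennreal (1 - c)"
    by (simp only: add.commute)
  \<comment> \<open>Finiteness licenses the cancellation in \<open>ennreal\<close>.\<close>
  moreover have "step_weight w * ennreal c \<noteq> \<infinity>" unfolding N[symmetric] by simp
  ultimately have "emeasure M ?S = step_weight w * ennreal (1 - c)" by (simp only: ennreal_add_left_cancel simp_thms)
  then show ?thesis by (simp only: mult.commute)
qed

section \<open>Windows along the trajectory\<close>

definition list_sets :: "nat \<Rightarrow> nat \<times> ptree list \<Rightarrow> 'a set" where
  "list_sets m p = {\<omega>\<in>space M. list_event (traj \<omega>) m (fst p) (snd p)}"

lemma list_sets [measurable]: "list_sets m p \<in> events"
proof -
  have "Measurable.pred M (\<lambda>\<omega>. list_event (traj \<omega>) m (fst p) (snd p))"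
    unfolding list_event_def by (intro pred_intros_logic match_sets spine_sets) simp_all
  then show ?thesis unfolding list_sets_def by (simp add: pred_def)
qed

text \<open>By stationarity the position \<open>a\<close> enters only through its admissible range;
  summing over it produces the size bias of the unimodularised law.\<close>

lemma emeasure_list_sets:
  "emeasure M (list_sets m (a, ts)) = ennreal (1 - c) * (indicator {..<psize (ts ! m)} a *
     (prod_list (map (block_weight \<alpha> \<beta>) ts) * indicator {ts. length ts = 2 * m + 1} ts))"
proof (cases "length ts = 2 * m + 1 \<and> a < psize (ts ! m)")
  case True
  let ?e = "int a + int (fsize (take m ts))"
  have "list_sets m (a, ts) = {\<omega>\<in>space M. match (traj \<omega>) ?e (concat (map block ts)) \<and>
      spine (traj \<omega>) (?e - int (length (concat (map block ts))))}"
    unfolding list_sets_def list_event_def length_concat_block using True by auto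
  then have "emeasure M (list_sets m (a, ts)) = ennreal (1 - c) * step_weight (concat (map block ts))"
    by (simp only: emeasure_match_spine)
  moreover have "step_weight (concat (map block ts)) = prod_list (map (block_weight \<alpha> \<beta>) ts)" for ts
    by (induction ts) (simp_all add: step_weight_block, simp add: step_weight_def)
  ultimately show ?thesis using True by simp
qed (auto simp: list_sets_def list_event_def)

lemma nn_integral_list_sets:
  "(\<integral>\<^sup>+p. \<phi> p * emeasure M (list_sets m p) \<partial>count_space UNIV) =
    ennreal (1 - c) * sum_lists (2 * m + 1) (\<lambda>ts. prod_list (map (block_weight \<alpha> \<beta>) ts) *
      (\<integral>\<^sup>+a. \<phi> (a, ts) \<partial>count_space {..<psize (ts ! m)}))"
proof -
  let ?P = "\<lambda>ts. prod_list (map (block_weight \<alpha> \<beta>) ts) * indicator {ts. length ts = 2 * m + 1} ts"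
  have "(\<integral>\<^sup>+p. \<phi> p * emeasure M (list_sets m p) \<partial>count_space UNIV) =
    (\<integral>\<^sup>+ts. \<integral>\<^sup>+a. \<phi> (a, ts) * emeasure M (list_sets m (a, ts)) \<partial>count_space UNIV \<partial>count_space UNIV)"
    by (rule nn_integral_snd_count_space[symmetric])
  also have "\<dots> = (\<integral>\<^sup>+ts. ennreal (1 - c) * (?P ts * (\<integral>\<^sup>+a. \<phi> (a, ts) \<partial>count_space {..<psize (ts ! m)})) \<partial>count_space UNIV)"
  proof (rule nn_integral_cong)
    fix ts
    have "(\<integral>\<^sup>+a. \<phi> (a, ts) * emeasure M (list_sets m (a, ts)) \<partial>count_space UNIV) =
      (\<integral>\<^sup>+a. (ennreal (1 - c) * ?P ts) * (\<phi> (a, ts) * indicator {..<psize (ts ! m)} a) \<partial>count_space UNIV)"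
      unfolding emeasure_list_sets by (simp only: mult_ac)
    also have "\<dots> = (ennreal (1 - c) * ?P ts) * (\<integral>\<^sup>+a. \<phi> (a, ts) \<partial>count_space {..<psize (ts ! m)})"
      by (subst nn_integral_cmult) (simp_all add: nn_integral_count_space_indicator)
    finally show "(\<integral>\<^sup>+a. \<phi> (a, ts) * emeasure M (list_sets m (a, ts)) \<partial>count_space UNIV) =
      ennreal (1 - c) * (?P ts * (\<integral>\<^sup>+a. \<phi> (a, ts) \<partial>count_space {..<psize (ts ! m)}))" by (simp only: mult.assoc)
  qed
  also have "\<dots> = ennreal (1 - c) * sum_lists (2 * m + 1) (\<lambda>ts. prod_list (map (block_weight \<alpha> \<beta>) ts) *
      (\<integral>\<^sup>+a. \<phi> (a, ts) \<partial>count_space {..<psize (ts ! m)}))"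
    unfolding sum_lists_def by (subst nn_integral_cmult) (simp_all only: mult_ac, simp)
  finally show ?thesis .
qed

text \<open>The middle one of \<open>2 * m + 1\<close> independent bushes has the mean size of any
  bush. This is read off \<open>window_integral\<close>, with the size of bush 0 as
  integrand.\<close>

lemma sum_lists_psize:
  "sum_lists (2 * m + 1) (\<lambda>ts. prod_list (map (block_weight \<alpha> \<beta>) ts) * of_nat (psize (ts ! m))) = bush_mean"
  unfolding nn_integral_bush_size[symmetric]
proof (rule window_integral[symmetric])
  fix ts and d :: "int \<Rightarrow> nat list \<Rightarrow> nat"
  assume "d \<in> window_event m ts"
  then have "bush_vertices (d 0) = bush_vertices (deg (ts ! m))"
    using window_event_bush[of d m ts 0] by (simp add: window_degrees_def)
  then show "emeasure (count_space UNIV) (bush_vertices (d 0)) = of_nat (psize (ts ! m))"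
    using bij_betw_same_card[OF bij_pos, of "ts ! m"] by (simp add: emeasure_count_space_finite finite_bush)
qed

lemma list_sets_unique: "\<omega> \<in> list_sets m p \<Longrightarrow> \<omega> \<in> list_sets m q \<Longrightarrow> p = q"
  unfolding list_sets_def using list_event_unique by (auto simp: prod_eq_iff)

lemma emeasure_list_sets_UN: "emeasure M (\<Union>p. list_sets m p) = ennreal (1 - c) * bush_mean"
proof -
  have "emeasure M (\<Union>p. list_sets m p) = (\<integral>\<^sup>+p. emeasure M (list_sets m p) \<partial>count_space UNIV)"
    by (rule emeasure_UN_countable) (auto simp: disjoint_family_on_def dest: list_sets_unique)
  also have "\<dots> = (\<integral>\<^sup>+p. 1 * emeasure M (list_sets m p) \<partial>count_space UNIV)" by simp
  also have "\<dots> = ennreal (1 - c) * bush_mean"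
    unfolding nn_integral_list_sets by (simp add: sum_lists_psize emeasure_count_space_finite del: One_nat_def)
  finally show ?thesis .
qed

text \<open>Radius 0 is enough: disjoint events have mass at most 1, which is the bound that
  \<open>bush_mean_eq\<close> asks for.\<close>

lemma mass_bush_mean: "ennreal (1 - c) * bush_mean = 1"
  using emeasure_list_sets_UN[of 0] emeasure_space_1
  by (intro bush_mean_eq) (metis emeasure_space sets.top)

text \<open>The mass of the windows is \<open>(1 - c) * bush_mean\<close> at every radius, hence 1.
  In particular the spine almost surely extends indefinitely on both sides of the origin.\<close>

lemma AE_list_sets: "AE \<omega> in M. \<forall>m. \<exists>p. \<omega> \<in> list_sets m p"
proof (subst AE_all_countable, rule allI)
  fix m
  have "prob (\<Union>p. list_sets m p) = 1"
    using emeasure_list_sets_UN[of m] by (simp add: emeasure_eq_measure mass_bush_mean)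
  moreover have "(\<Union>p. list_sets m p) \<in> events" by measurable
  ultimately have "AE \<omega> in M. \<omega> \<in> (\<Union>p. list_sets m p)" by (simp add: prob_eq_1)
  then show "AE \<omega> in M. \<exists>p. \<omega> \<in> list_sets m p" by eventually_elim auto
qed

definition address :: "ptree \<Rightarrow> nat \<Rightarrow> nat list" where
  "address t = inv_into (bush_vertices (deg t)) (pos t)"

text \<open>On a trajectory with windows of all radii the component is a tree of joined bushes; a
  local event sees only its bushes up to index \<open>m\<close> in absolute value, and these are
  listed in \<open>ts\<close>.\<close>

lemma iso_class_record_component:
  assumes A: "\<forall>T\<in>A. cyl T m \<subseteq> A" and good: "\<forall>m. \<exists>p. \<omega> \<in> list_sets m p" and p: "\<omega> \<in> list_sets m (a, ts)"
  shows "iso_class (record_component (traj \<omega>) 0) \<in> A \<longleftrightarrow>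
    iso_class (joined_bushes (window_degrees m ts) (0, address (ts ! m) a)) \<in> A"
proof -
  have all: "\<exists>a ts. list_event (traj \<omega>) m a ts" for m using good by (auto simp: list_sets_def)
  have "list_event (traj \<omega>) m a ts" using p by (simp add: list_sets_def)
  then obtain \<tau> u where \<tau>: "\<forall>i. \<bar>i\<bar> \<le> int m \<longrightarrow> \<tau> i = ts ! nat (int m - i)"
    and u: "u \<in> bush_vertices (deg (ts ! m))" "pos (ts ! m) u = a"
    and iso: "rooted_isomorphic (joined_bushes (\<lambda>i. deg (\<tau> i)) (0, u)) (record_component (traj \<omega>) 0)"
    using record_component_list_event[OF all] by blast
  have u0: "u \<in> bush_vertices (deg (\<tau> 0))" using u \<tau> by simp
  have "address (ts ! m) a = u"
    unfolding address_def using u bij_betw_inv_into_left[OF bij_pos] by blast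
  have "iso_class (joined_bushes (\<lambda>i. deg (\<tau> i)) (0, u)) = iso_class (record_component (traj \<omega>) 0)"
    by (rule iso_class_cong[OF _ family_tree_record_component iso]) (rule family_tree_joined_bushes, rule u0)
  moreover have "iso_class (joined_bushes (\<lambda>i. deg (\<tau> i)) (0, u)) \<in> A \<longleftrightarrow>
      iso_class (joined_bushes (window_degrees m ts) (0, u)) \<in> A"
    using \<tau> by (intro local_event_joined_bushes_cong[OF A] u0) (simp add: window_degrees_def)
  ultimately show ?thesis using \<open>address (ts ! m) a = u\<close> by simp
qed

text \<open>Replaces the infimum by countably many conditions on finite sums, for the sake of
  measurability.\<close>

lemma record_edges_iff:
  "(p, q) \<in> record_edges x \<longleftrightarrow> p < q \<and> 0 \<le> (\<Sum>l=p..<q. x l) \<and> (\<forall>k. p < k \<and> k < q \<longrightarrow> (\<Sum>l=p..<k. x l) < 0)"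
  (is "?L \<longleftrightarrow> ?R")
proof
  assume ?L
  then show ?R using record_map_cases[of x p ?R] by (auto simp: record_edges_def)
next
  assume R: ?R
  then have "record_map x p = q" by (intro record_map_eqI) auto
  then show ?L using R by (auto simp: record_edges_def)
qed

lemma measurable_record_component:
  "(\<lambda>\<omega>. iso_class (record_component (traj \<omega>) 0)) \<in> M \<rightarrow>\<^sub>M borel"
proof (rule measurable_iso_class)
  have [measurable]: "Measurable.pred M (\<lambda>\<omega>. 0 \<le> (\<Sum>l=p..<q. traj \<omega> l))" "Measurable.pred M (\<lambda>\<omega>. (\<Sum>l=p..<q. traj \<omega> l) < 0)" for p q
  proof -
    have "0 \<le> (\<Sum>l=p..<q. traj \<omega> l) \<longleftrightarrow> 0 \<le> (\<Sum>l=p..<q. real_of_int (traj \<omega> l))"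
      "(\<Sum>l=p..<q. traj \<omega> l) < 0 \<longleftrightarrow> (\<Sum>l=p..<q. real_of_int (traj \<omega> l)) < 0" for \<omega>
      by (simp_all flip: of_int_sum)
    moreover have [measurable]: "(\<lambda>\<omega>. real_of_int (traj \<omega> l)) \<in> borel_measurable M" for l
      by (rule measurable_compose[OF measurable_traj]) simp
    ultimately show "Measurable.pred M (\<lambda>\<omega>. 0 \<le> (\<Sum>l=p..<q. traj \<omega> l))" "Measurable.pred M (\<lambda>\<omega>. (\<Sum>l=p..<q. traj \<omega> l) < 0)"
      by (simp_all only:) measurable
  qed
  have [measurable]: "Measurable.pred M (\<lambda>\<omega>. (p, q) \<in> record_edges (traj \<omega>))" for p q
    unfolding record_edges_iff by measurable
  have [measurable]: "Measurable.pred M (\<lambda>\<omega>. (0, q) \<in> (record_edges (traj \<omega>) \<union> (record_edges (traj \<omega>))\<inverse>) ^^ n)" for n q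
  proof (induction n arbitrary: q)
    case (Suc n)
    note Suc [measurable]
    have "(\<lambda>\<omega>. (0, q) \<in> (record_edges (traj \<omega>) \<union> (record_edges (traj \<omega>))\<inverse>) ^^ Suc n) =
      (\<lambda>\<omega>. \<exists>p. (0, p) \<in> (record_edges (traj \<omega>) \<union> (record_edges (traj \<omega>))\<inverse>) ^^ n \<and>
        ((p, q) \<in> record_edges (traj \<omega>) \<or> (q, p) \<in> record_edges (traj \<omega>)))" by auto
    moreover have "Measurable.pred M (\<lambda>\<omega>. \<exists>p. (0, p) \<in> (record_edges (traj \<omega>) \<union> (record_edges (traj \<omega>))\<inverse>) ^^ n \<and>
        ((p, q) \<in> record_edges (traj \<omega>) \<or> (q, p) \<in> record_edges (traj \<omega>)))"
      by measurable
    ultimately show ?case by (simp only:)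
  qed simp
  show "Measurable.pred M (\<lambda>\<omega>. (p, q) \<in> edges (record_component (traj \<omega>) 0))" for p q
    \<comment> \<open>\<open>rtrancl_power\<close> expresses membership in the component through
      walks of finite length, whose measurability has just been shown.\<close>
    unfolding record_component_simps Int_iff mem_Sigma_iff mem_Collect_eq rtrancl_power by measurable
qed (simp_all add: family_tree_record_component record_component_simps)

text \<open>Both sides become the same sum over lists of \<open>2 * m + 1\<close> trees. On the walk
  side the inner sum runs over the position \<open>a\<close>, which \<open>pos\<close> turns into
  the vertices of the middle bush, that is into \<open>vertex_count\<close>.\<close>

lemma emeasure_local_event:
  assumes A: "\<forall>T\<in>A. cyl T m \<subseteq> A" and meas: "A \<in> sets borel"
  shows "emeasure (distr M borel (\<lambda>\<omega>. iso_class (record_component (traj \<omega>) 0))) A = emeasure (unimodularised_EKT \<alpha> \<beta>) A"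
proof -
  let ?T = "\<lambda>\<omega>. iso_class (record_component (traj \<omega>) 0)"
  \<comment> \<open>Restriction to this event of full probability is what lets a single window
    determine whether the component belongs to \<open>A\<close>.\<close>
  let ?G = "{\<omega>\<in>space M. \<forall>m. \<exists>p. \<omega> \<in> list_sets m p}"
  define \<phi> :: "nat \<times> ptree list \<Rightarrow> ennreal" where
    "\<phi> = (\<lambda>(a, ts). indicator A (iso_class (joined_bushes (window_degrees m ts) (0, address (ts ! m) a))))"
  have G: "?G \<in> events" by measurable
  have "emeasure (distr M borel ?T) A = (\<integral>\<^sup>+\<omega>. indicator A (?T \<omega>) \<partial>M)"
  proof -
    have "emeasure (distr M borel ?T) A = (\<integral>\<^sup>+T. indicator A T \<partial>distr M borel ?T)" using meas by simp
    also have "\<dots> = (\<integral>\<^sup>+\<omega>. indicator A (?T \<omega>) \<partial>M)"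
      using meas by (intro nn_integral_distr measurable_record_component) simp
    finally show ?thesis .
  qed
  also have "\<dots> = (\<integral>\<^sup>+p. \<phi> p * emeasure M (list_sets m p \<inter> ?G) \<partial>count_space UNIV)"
  proof (rule nn_integral_countable_partition)
    show "list_sets m p \<inter> ?G \<in> events" for p using G by measurable
    show "AE \<omega> in M. \<exists>p. \<omega> \<in> list_sets m p \<inter> ?G"
      using AE_list_sets AE_space by eventually_elim auto
    show "indicator A (?T \<omega>) = \<phi> p" if "\<omega> \<in> list_sets m p \<inter> ?G" for p \<omega>
      using iso_class_record_component[OF A, of \<omega> "fst p" "snd p"] that
      by (auto simp: \<phi>_def split_beta split: split_indicator)
  qed (use list_sets_unique in blast)
  also have "\<dots> = (\<integral>\<^sup>+p. \<phi> p * emeasure M (list_sets m p) \<partial>count_space UNIV)"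
  proof (rule nn_integral_cong)
    fix p
    have "emeasure M (list_sets m p \<inter> ?G) = emeasure M (list_sets m p)"
    proof (rule emeasure_eq_AE)
      show "AE \<omega> in M. \<omega> \<in> list_sets m p \<inter> ?G \<longleftrightarrow> \<omega> \<in> list_sets m p"
        using AE_list_sets AE_space by eventually_elim auto
      show "list_sets m p \<inter> ?G \<in> events" using G list_sets by (rule sets.Int[rotated])
    qed (rule list_sets)
    then show "\<phi> p * emeasure M (list_sets m p \<inter> ?G) = \<phi> p * emeasure M (list_sets m p)" by simp
  qed
  also have "\<dots> = ennreal (1 - c) * sum_lists (2 * m + 1) (\<lambda>ts. prod_list (map (block_weight \<alpha> \<beta>) ts) * vertex_count A (window_degrees m ts))"
  proof -
    have "(\<integral>\<^sup>+a. \<phi> (a, ts) \<partial>count_space {..<psize (ts ! m)}) = vertex_count A (window_degrees m ts)" for ts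
    proof -
      have "(\<integral>\<^sup>+a. \<phi> (a, ts) \<partial>count_space {..<psize (ts ! m)}) =
          (\<integral>\<^sup>+u. \<phi> (pos (ts ! m) u, ts) \<partial>count_space (bush_vertices (deg (ts ! m))))"
        by (rule nn_integral_bij_count_space[OF bij_pos, symmetric])
      also have "\<dots> = (\<integral>\<^sup>+u. indicator A (iso_class (joined_bushes (window_degrees m ts) (0, u))) \<partial>count_space (bush_vertices (deg (ts ! m))))"
        using bij_betw_inv_into_left[OF bij_pos] by (intro nn_integral_cong) (simp add: \<phi>_def address_def)
      finally show ?thesis by (simp add: vertex_count_def window_degrees_def)
    qed
    then show ?thesis by (simp only: nn_integral_list_sets)
  qed
  also have "\<dots> = ennreal (1 - c) * (\<integral>\<^sup>+d. vertex_count A d \<partial>bushes_law \<alpha> \<beta>)"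
    by (simp only: nn_integral_vertex_count[OF A])
  also have "\<dots> = (\<integral>\<^sup>+d. vertex_count A d \<partial>bushes_law \<alpha> \<beta>) / bush_mean"
  proof -
    have "bush_mean \<noteq> 0" using mass_bush_mean by auto
    moreover have "bush_mean \<noteq> top" using mass_bush_mean c_less_1 by (auto simp: ennreal_mult_top)
    ultimately have "ennreal (1 - c) = 1 / bush_mean"
      using mass_bush_mean by (metis ennreal_mult_divide_eq)
    then show ?thesis by (simp add: divide_ennreal_def mult.commute)
  qed
  also have "\<dots> = emeasure (unimodularised_EKT \<alpha> \<beta>) A"
    using meas by (simp add: emeasure_unimodularised_EKT nn_integral_bush_size)
  finally show ?thesis .
qed

lemma distr_record_component:
  "distr M borel (\<lambda>\<omega>. iso_class (record_component (traj \<omega>) 0)) = unimodularised_EKT \<alpha> \<beta>"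
proof (rule measure_eqI_generator_eq)
  show "Int_stable local_events" by (rule Int_stable_local_events)
  show "local_events \<subseteq> Pow UNIV" by simp
  show "emeasure (distr M borel (\<lambda>\<omega>. iso_class (record_component (traj \<omega>) 0))) A = emeasure (unimodularised_EKT \<alpha> \<beta>) A"
    if "A \<in> local_events" for A
  proof -
    have "A \<in> sets borel" using that unfolding borel_ftree by auto
    then show ?thesis using that emeasure_local_event unfolding local_events_def by blast
  qed
  show "sets (distr M borel (\<lambda>\<omega>. iso_class (record_component (traj \<omega>) 0))) = sigma_sets UNIV local_events"
    by (simp add: borel_ftree)
  show "sets (unimodularised_EKT \<alpha> \<beta>) = sigma_sets UNIV local_events"
    unfolding borel_ftree[symmetric] unimodularised_EKT_def by (simp add: sets.sigma_sets_eq[of borel, simplified])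
  show "range (\<lambda>_::nat. UNIV) \<subseteq> local_events" by (auto simp: local_events_def)
  show "(\<Union>i::nat. UNIV) = (UNIV :: ftree set)" by simp
  show "emeasure (distr M borel (\<lambda>\<omega>. iso_class (record_component (traj \<omega>) 0))) UNIV \<noteq> \<infinity>"
    using measurable_record_component by (subst emeasure_distr) auto
qed

text \<open>Reading a match from left to right instead of from right to left amounts to reflecting the walk.\<close>

lemma prob_hitting: "prob {\<omega>\<in>space M. \<exists>n>0. (\<Sum>k<n. X (int k) \<omega>) = - 1} = c"
proof -
  \<comment> \<open>The shift by one makes a reading at 0, which starts with
    \<open>y \<omega> (- 1)\<close>, begin with \<open>X 0\<close>.\<close>
  define y where "y \<omega> l = X (- 1 - l) \<omega>" for \<omega> l
  have sum: "sum_list (word (y \<omega>) 0 n) = (\<Sum>k<n. X (int k) \<omega>)" for \<omega> n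
    by (induction n) (simp_all add: word_Suc y_def, simp add: word_def)
  let ?N = "\<lambda>t. {\<omega>\<in>space M. match (y \<omega>) 0 (singles (pre t))}"
  have N: "?N t = {\<omega>\<in>space M. \<forall>m<length (singles (pre t)). X (int m) \<omega> \<in> singles (pre t) ! m}" for t
    by (simp add: match_def y_def)
  have hit: "(\<exists>n>0. (\<Sum>k<n. X (int k) \<omega>) = - 1) \<longleftrightarrow> (\<exists>t. match (y \<omega>) 0 (singles (pre t)))" if "\<omega> \<in> space M" for \<omega>
  proof
    assume "\<exists>n>0. (\<Sum>k<n. X (int k) \<omega>) = - 1"
    then obtain n where "(\<Sum>k<n. X (int k) \<omega>) = - 1" by blast
    then have "\<not> 0 \<le> sum_list (word (y \<omega>) 0 n)" by (simp add: sum)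
    then have "\<not> spine (y \<omega>) 0" unfolding spine_def by blast
    then show "\<exists>t. match (y \<omega>) 0 (singles (pre t))"
      by (subst (asm) not_spine_iff) (simp_all add: y_def ge that)
  next
    assume "\<exists>t. match (y \<omega>) 0 (singles (pre t))"
    then obtain t where "word (y \<omega>) 0 (psize t) = pre t" by (auto simp: match_singles)
    then have "(\<Sum>k<psize t. X (int k) \<omega>) = - 1" using sum[of \<omega> "psize t"] by simp
    then show "\<exists>n>0. (\<Sum>k<n. X (int k) \<omega>) = - 1" using psize_pos by blast
  qed
  have meas: "?N t \<in> events" for t
  proof -
    have [measurable]: "Measurable.pred M (\<lambda>\<omega>. X n \<omega> \<in> V)" for n V
      using measurable_sets[OF measurable_traj, of V n] by (simp add: traj_def pred_def vimage_def Int_def conj_commute)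
    show ?thesis unfolding N by measurable
  qed
  have "{\<omega>\<in>space M. \<exists>n>0. (\<Sum>k<n. X (int k) \<omega>) = - 1} = (\<Union>t. ?N t)"
    using hit by auto
  moreover have "emeasure M (\<Union>t. ?N t) = (\<integral>\<^sup>+t. emeasure M (?N t) \<partial>count_space UNIV)"
    by (rule emeasure_UN_countable) (use meas in \<open>auto simp: disjoint_family_on_def dest: match_pre_unique\<close>)
  moreover have "emeasure M (?N t) = weight Q t" for t
    unfolding N by (simp only: emeasure_letters[OF inj_of_nat] step_weight_pre)
  ultimately have "emeasure M {\<omega>\<in>space M. \<exists>n>0. (\<Sum>k<n. X (int k) \<omega>) = - 1} = ennreal c"
    by (simp only: ennreal_c)
  then show ?thesis using c_pos by (simp add: measure_def)
qed

lemma pmf_increment: "pmf Q k = prob {\<omega>\<in>space M. X 0 \<omega> = int k - 1}"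
proof -
  have "{j. int j - 1 \<in> {int k - 1}} = {k}" by auto
  then show ?thesis using law[of 0 "{int k - 1}"] by (simp add: emeasure_eq_measure emeasure_pmf_single)
qed

lemma prob_increment_ge: "measure_pmf.prob Q {k<..} = prob {\<omega>\<in>space M. int k \<le> X 0 \<omega>}"
proof -
  have "{j. int j - 1 \<in> {int k..}} = {k<..}" by auto
  then show ?thesis using law[of 0 "{int k..}"] by (simp add: emeasure_eq_measure measure_pmf.emeasure_eq_measure)
qed

end

lemma (in prob_space) pmf_distr_countable:
  fixes f :: "'a \<Rightarrow> 'b::countable"
  assumes "f \<in> M \<rightarrow>\<^sub>M count_space UNIV"
  obtains Q where "measure_pmf Q = distr M (count_space UNIV) f"
proof
  let ?N = "distr M (count_space UNIV) f"
  interpret N: prob_space ?N by (rule prob_space_distr[OF assms])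
  have "AE x in ?N. measure ?N {x} \<noteq> 0"
    by (subst N.AE_support_countable) (auto intro!: exI[of _ UNIV])
  then show "measure_pmf (Abs_pmf ?N) = ?N"
    by (intro Abs_pmf_inverse) (simp add: N.prob_space_axioms)
qed

text \<open>\<open>Q\<close> is the law of \<open>X 0 + 1\<close>; truncation by \<open>nat\<close>
  is harmless since \<open>X 0\<close> is at least \<open>-1\<close> at every point of the space.
  Identical distribution carries the law over to all increments, and positive drift becomes a mean
  above one.\<close>

lemma skip_free_left_increments_walk:
  assumes skip_free: "skip_free_left_increments M X" and drift: "0 < (\<integral>\<omega>. real_of_int (X 0 \<omega>) \<partial>M)"
  obtains Q where "walk Q M X"
proof -
  interpret prob_space M using skip_free by (simp add: skip_free_left_increments_def)
  have indep: "indep_vars (\<lambda>_. count_space UNIV) X UNIV"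
    and same: "distr M (count_space UNIV) (X n) = distr M (count_space UNIV) (X 0)"
    and ge: "\<omega> \<in> space M \<Longrightarrow> - 1 \<le> X n \<omega>"
    and neg: "0 < measure M {\<omega>\<in>space M. X 0 \<omega> = - 1}"
    and int: "integrable M (\<lambda>\<omega>. real_of_int (X 0 \<omega>))" for n \<omega>
    using skip_free by (auto simp: skip_free_left_increments_def)
  have X: "X n \<in> M \<rightarrow>\<^sub>M count_space UNIV" for n using indep unfolding indep_vars_def by auto
  let ?K = "\<lambda>\<omega>. nat (X 0 \<omega> + 1)"
  have K: "?K \<in> M \<rightarrow>\<^sub>M count_space UNIV"
    by (rule measurable_compose[OF X]) simp
  obtain Q where Q: "measure_pmf Q = distr M (count_space UNIV) ?K" using pmf_distr_countable[OF K] .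
  have law: "emeasure M {\<omega>\<in>space M. X n \<omega> \<in> V} = emeasure (measure_pmf Q) {k. int k - 1 \<in> V}" for n V
  proof -
    have "emeasure M {\<omega>\<in>space M. X n \<omega> \<in> V} = emeasure (distr M (count_space UNIV) (X n)) V"
      by (simp add: emeasure_distr[OF X] vimage_def Int_def conj_commute)
    also have "\<dots> = emeasure M {\<omega>\<in>space M. X 0 \<omega> \<in> V}"
      unfolding same[of n] by (simp add: emeasure_distr[OF X] vimage_def Int_def conj_commute)
    also have "{\<omega>\<in>space M. X 0 \<omega> \<in> V} = ?K -` {k. int k - 1 \<in> V} \<inter> space M"
    proof -
      have "int (?K \<omega>) - 1 = X 0 \<omega>" if "\<omega> \<in> space M" for \<omega> using ge[OF that, of 0] by simp
      then show ?thesis by (intro set_eqI) (simp only: mem_Collect_eq vimage_def Int_iff, metis)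
    qed
    also have "emeasure M \<dots> = emeasure (measure_pmf Q) {k. int k - 1 \<in> V}"
      unfolding Q by (simp add: emeasure_distr[OF K])
    finally show ?thesis .
  qed
  have "walk Q M X"
  proof
    have "{j. int j - 1 \<in> {- 1}} = {0}" by auto
    then have "pmf Q 0 = measure M {\<omega>\<in>space M. X 0 \<omega> = - 1}"
      using law[of 0 "{- 1}"] by (simp add: emeasure_eq_measure emeasure_pmf_single)
    then show "0 < pmf Q 0" using neg by simp
    have "mean_pmf Q = (\<integral>\<^sup>+\<omega>. ennreal (real (?K \<omega>)) \<partial>M)"
      unfolding mean_pmf_def Q by (subst nn_integral_distr[OF K]) simp_all
    also have "\<dots> = (\<integral>\<^sup>+\<omega>. ennreal (real_of_int (X 0 \<omega>) + 1) \<partial>M)"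
    proof (rule nn_integral_cong)
      fix \<omega> assume "\<omega> \<in> space M"
      from ge[OF this, of 0] have "real (?K \<omega>) = real_of_int (X 0 \<omega>) + 1" by simp
      then show "ennreal (real (?K \<omega>)) = ennreal (real_of_int (X 0 \<omega>) + 1)" by simp
    qed
    also have "\<dots> = ennreal (\<integral>\<omega>. real_of_int (X 0 \<omega>) + 1 \<partial>M)"
    proof (rule nn_integral_eq_integral)
      show "AE \<omega> in M. 0 \<le> real_of_int (X 0 \<omega>) + 1"
      proof (rule AE_I2)
        fix \<omega> assume "\<omega> \<in> space M"
        from ge[OF this, of 0] show "0 \<le> real_of_int (X 0 \<omega>) + 1" by linarith
      qed
    qed (use int in simp)
    also have "(\<integral>\<omega>. real_of_int (X 0 \<omega>) + 1 \<partial>M) = (\<integral>\<omega>. real_of_int (X 0 \<omega>) \<partial>M) + 1"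
      using int by (simp add: prob_space)
    finally show "1 < mean_pmf Q" using drift by (simp add: ennreal_less_iff flip: ennreal_1)
  qed (use indep law ge in auto)
  then show thesis by (rule that)
qed

theorem theorem54:
  fixes M :: "'a measure" and X :: "int \<Rightarrow> 'a \<Rightarrow> int"
    and S :: "nat \<Rightarrow> 'a \<Rightarrow> int" and c :: real
    and pitilde pibar :: "nat \<Rightarrow> real"
  assumes "skip_free_left_increments M X"
    and "0 < (\<integral>\<omega>. real_of_int (X 0 \<omega>) \<partial>M)"
    and "\<And>n \<omega>. S n \<omega> = (\<Sum>k<n. X (int k) \<omega>)"
    and "c = measure M {\<omega>\<in>space M. \<exists>n>0. S n \<omega> = - 1}"
    and "\<And>k. pitilde k = c powi (int k - 1) * measure M {\<omega>\<in>space M. X 0 \<omega> = int k - 1}"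
    and "\<And>k. pibar k = c ^ k * measure M {\<omega>\<in>space M. X 0 \<omega> \<ge> int k}"
  shows "\<exists>\<alpha> \<beta> :: nat pmf.
           pmf \<alpha> = pibar \<and> pmf \<beta> = pitilde \<and>
           (\<integral>\<^sup>+k. ennreal (real k) \<partial>measure_pmf \<alpha>) < \<infinity> \<and>
           (\<integral>\<^sup>+k. ennreal (real k) \<partial>measure_pmf \<beta>) < 1 \<and>
           (\<lambda>\<omega>. iso_class (record_component (\<lambda>n. X n \<omega>) 0)) \<in> M \<rightarrow>\<^sub>M borel \<and>
           distr M borel (\<lambda>\<omega>. iso_class (record_component (\<lambda>n. X n \<omega>) 0))
             = unimodularised_EKT \<alpha> \<beta>"
proof -
  obtain Q where "walk Q M X" using skip_free_left_increments_walk[OF assms(1,2)] .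
  then interpret W: walk Q M X .
  have c: "c = W.c" using W.prob_hitting by (simp add: assms(3,4))
  have traj: "(\<lambda>n. X n \<omega>) = W.traj \<omega>" for \<omega> by (simp add: W.traj_def fun_eq_iff)
  show ?thesis
  proof (intro exI conjI)
    show "pmf W.\<alpha> = pibar"
      by (rule ext) (simp add: W.pmf_\<alpha> W.bar_def W.prob_increment_ge assms(6) c)
    show "pmf W.\<beta> = pitilde"
      by (rule ext) (simp add: W.pmf_\<beta> W.tilde_def W.pmf_increment assms(5) c)
    show "(\<integral>\<^sup>+k. ennreal (real k) \<partial>measure_pmf W.\<alpha>) < \<infinity>"
      using W.mean_\<alpha>_finite by (simp add: mean_pmf_def)
    show "(\<integral>\<^sup>+k. ennreal (real k) \<partial>measure_pmf W.\<beta>) < 1"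
      using W.mean_\<beta>_less_1 by (simp add: mean_pmf_def)
    show "(\<lambda>\<omega>. iso_class (record_component (\<lambda>n. X n \<omega>) 0)) \<in> M \<rightarrow>\<^sub>M borel"
      unfolding traj by (rule W.measurable_record_component)
    show "distr M borel (\<lambda>\<omega>. iso_class (record_component (\<lambda>n. X n \<omega>) 0)) = unimodularised_EKT W.\<alpha> W.\<beta>"
      unfolding traj by (rule W.distr_record_component)
  qed
qed

end
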